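(* Let $\overline\eta_0,\hat\eta_0\in\mathcal P(\mathbb T^d)$, let $\overline\eta_t=\mathcal{L}aw(Z_t\mid T>t)$ when $Z_0\sim\overline\eta_0$, and let $\hat\eta_t=\mathcal{L}aw(Z_t\mid T>t)$ when $Z_0\sim\hat\eta_0$. For all $t\geqslant0$, $$\mathcal W_\rho(\overline\eta_t,\hat\eta_t)\leqslant e^{-\kappa_0t}\,\mathcal W_\rho(\overline\eta_0,\hat\eta_0),\qquad\text{where }\kappa_0=c_1-c_2L_\lambda .$$
   Context: $\mathbb T^d=\mathbb R^d/\mathbb Z^d$ is the flat torus with Euclidean distance $|x-y|$; $b\in\mathcal C^1(\mathbb T^d)$ is an $\mathbb R^d$-valued drift; $\lambda:\mathbb T^d\to[0,\infty)$ is Lipschitz with constant $L_\lambda$ (standing assumption). $\mathcal P(F)$ is the set of Borel probability measures on $F$; $\mathcal W_\rho(\mu,\nu)=\inf\{\mathbb E(\rho(X,Y)):X\sim\mu,\ Y\sim\nu\}$ for a distance $\rho$. Killed diffusion: $dZ_t=b(Z_t)dt+dB_t$ on $\mathbb T^d$ ($B$ a $d$-dimensional Brownian motion) and $T=\inf\{t\geqslant0:E\leqslant\int_0^t\lambda(Z_s)ds\}$ with $E$ an exponential variable of parameter 1 independent of $Z$. Discrete system (needed to specify the constants): for $\gamma>0$, $K$ is the Markov kernel on $\mathbb T^d$ given by $Kf(x)=(2\pi)^{-d/2}\int_{\mathbb R^d}f(x+\gamma b(x)+\sqrt\gamma y)e^{-|y|^2/2}dy$, and $p(z)=1-e^{-\gamma\lambda(z)}$.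 For $\mu\in\mathcal P(\mathbb T^d)$, $Q_\mu(x,\cdot)$ is the law of $X_H$, where $(X_k,U_k)_{k\in\mathbb N}$ are independent random variables with, for every $k$, $X_k$ and $U_k$ independent, $U_k$ uniform on $[0,1]$, $X_0\sim K(x,\cdot)$, $X_k\sim\mu K$ for $k\geqslant1$, and $H=\inf\{k\in\mathbb N:U_k\geqslant p(X_k)\}$. For $x\in\mathbb T^{dN}$, $\pi(x)=\frac1N\sum_{i=1}^N\delta_{x_i}$ and $R_{N,\gamma}(x,\cdot)=Q_{\pi(x)}(x_1,\cdot)\otimes\cdots\otimes Q_{\pi(x)}(x_N,\cdot)$. Constants (fixed throughout, such constants exist): $c_1,a,\gamma_0>0$ depend only on $b$ and $d$ and are such that, with the metric $\rho(x,y)=(1-e^{-a|x-y|})/a$ on $\mathbb T^d$, $\mathcal W_\rho(\mu K,\nu K)\leqslant(1-c_1\gamma)\mathcal W_\rho(\mu,\nu)$ for all $\gamma\in(0,\gamma_0]$ and $\mu,\nu\in\mathcal P(\mathbb T^d)$; $c_2>0$ depends only on $b$ and $d$ and is such that, with $\kappa_\gamma=c_1-c_2L_\lambda e^{\gamma\|\lambda\|_\infty}$ (not assumed positive) and $\rho_N(x,y)=\sum_{i=1}^N\rho(x_i,y_i)$, one has $\mathcal W_{\rho_N}(\mu R_{N,\gamma},\nu R_{N,\gamma})\leqslant(1-\gamma\kappa_\gamma)\mathcal W_{\rho_N}(\mu,\nu)$ for all $\gamma\in(0,\gamma_0]$, $N\geqslant1$ and $\mu,\nu\in\mathcal P(\mathbb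 T^{dN})$. *)

theory Defs
  imports "HOL-Probability.Probability"
begin

section \<open>The flat torus\<close>

definition int_translate :: "real ^ 'n \<Rightarrow> real ^ 'n \<Rightarrow> bool" where
  "int_translate u v \<longleftrightarrow> (\<forall>i. u $ i - v $ i \<in> \<int>)"

lemma int_translate_refl: "int_translate u u"
  by (simp add: int_translate_def)

lemma int_translate_sym: "int_translate u v \<Longrightarrow> int_translate v u"
  unfolding int_translate_def by (metis Ints_minus minus_diff_eq)

lemma int_translate_trans:
  assumes "int_translate u v" "int_translate v w"
  shows "int_translate u w"
  unfolding int_translate_def
proof
  fix i
  have "(u $ i - v $ i) + (v $ i - w $ i) \<in> \<int>"
    using assms by (intro Ints_add) (auto simp: int_translate_def)
  then show "u $ i - w $ i \<in> \<int>" by simp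
qed

quotient_type 'n torus = "real ^ ('n :: finite)" / int_translate
  morphisms rep_torus torus_proj
  by (intro equivpI reflpI sympI transpI)
     (blast intro: int_translate_refl int_translate_sym int_translate_trans)+

lemma torus_proj_eq_iff: "torus_proj u = torus_proj v \<longleftrightarrow> int_translate u v"
  by (rule torus.abs_eq_iff)

lemma torus_proj_surj: "\<exists>u. torus_proj u = x"
  by (induct x rule: torus.abs_induct) blast

lift_definition torus_shift :: "('n :: finite) torus \<Rightarrow> real ^ 'n \<Rightarrow> 'n torus" is "(+)"
  by (simp add: int_translate_def)

instantiation torus :: (finite) metric_space
begin

definition dist_torus :: "'a torus \<Rightarrow> 'a torus \<Rightarrow> real" where
  "dist_torus x y = Inf {norm (u - v) | u v. torus_proj u = x \<and> torus_proj v = y}"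

definition uniformity_torus :: "('a torus \<times> 'a torus) filter" where
  "uniformity_torus = (INF e\<in>{0 <..}. principal {(x, y). dist x y < e})"

definition open_torus :: "'a torus set \<Rightarrow> bool" where
  "open_torus U \<longleftrightarrow> (\<forall>x\<in>U. eventually (\<lambda>(x', y). x' = x \<longrightarrow> y \<in> U) uniformity)"

instance
proof
  let ?S = "\<lambda>x y :: 'a torus. {norm (u - v) | u v. torus_proj u = x \<and> torus_proj v = y}"
  have bdd: "bdd_below (?S x y)" for x y
    by (intro bdd_belowI[of _ 0]) auto
  have ne: "?S x y \<noteq> {}" for x y
    using torus_proj_surj[of x] torus_proj_surj[of y] by blast
  have low: "dist x y \<le> norm (u - v)" if "torus_proj u = x" "torus_proj v = y" for x y u v
    unfolding dist_torus_def using that by (intro cInf_lower bdd) blast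
  have approx: "\<exists>u v. torus_proj u = x \<and> torus_proj v = y \<and> norm (u - v) < dist x y + e"
    if "e > 0" for x y and e :: real
  proof -
    have "Inf (?S x y) < dist x y + e"
      unfolding dist_torus_def using that by simp
    from cInf_lessD[OF ne this] show ?thesis by blast
  qed
  show "dist x y = 0 \<longleftrightarrow> x = y" for x y :: "'a torus"
  proof
    assume "x = y"
    obtain u where u: "torus_proj u = x" using torus_proj_surj by blast
    have "dist x y \<le> 0" using low[OF u u] \<open>x = y\<close> by simp
    moreover have "dist x y \<ge> 0"
      unfolding dist_torus_def by (rule cInf_greatest[OF ne]) auto
    ultimately show "dist x y = 0" by simp
  next
    assume d0: "dist x y = 0"
    obtain u0 v0 where u0: "torus_proj u0 = x" and v0: "torus_proj v0 = y"
      using torus_proj_surj by metis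
    have "u0 $ i - v0 $ i \<in> \<int>" for i
    proof -
      have "\<exists>k\<in>\<int>. dist k (u0 $ i - v0 $ i) < e" if e: "e > 0" for e
      proof -
        obtain u v where uv: "torus_proj u = x" "torus_proj v = y" "norm (u - v) < e"
          using approx[OF e, of x y] d0 by auto
        have "u0 $ i - u $ i \<in> \<int>" "v0 $ i - v $ i \<in> \<int>"
          using torus_proj_eq_iff[of u0 u] torus_proj_eq_iff[of v0 v] u0 v0 uv
          by (auto simp: int_translate_def)
        then have "(u0 $ i - u $ i) - (v0 $ i - v $ i) \<in> \<int>" by (rule Ints_diff)
        moreover have "\<bar>u $ i - v $ i\<bar> < e"
          using component_le_norm_cart[of "u - v" i] uv(3) by simp
        ultimately show ?thesis
          by (intro bexI[of _ "(u0 $ i - u $ i) - (v0 $ i - v $ i)"])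
             (auto simp: dist_real_def)
      qed
      then have "u0 $ i - v0 $ i \<in> closure \<int>"
        by (subst closure_approachable) blast
      then show ?thesis by simp
    qed
    then show "x = y"
      using torus_proj_eq_iff[of u0 v0] u0 v0 by (simp add: int_translate_def)
  qed
  show "dist x y \<le> dist x z + dist y z" for x y z :: "'a torus"
  proof (rule field_le_epsilon)
    fix e :: real assume "e > 0"
    then have e2: "e / 2 > 0" by simp
    obtain u w where uw: "torus_proj u = x" "torus_proj w = z" "norm (u - w) < dist x z + e / 2"
      using approx[OF e2] by blast
    obtain v w' where vw: "torus_proj v = y" "torus_proj w' = z" "norm (v - w') < dist y z + e / 2"
      using approx[OF e2] by blast
    have "int_translate w w'" using uw(2) vw(2) torus_proj_eq_iff[of w w'] by simp
    then have "int_translate (v + (w - w')) v" by (simp add: int_translate_def)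
    then have "torus_proj (v + (w - w')) = y" using vw(1) torus_proj_eq_iff by metis
    from low[OF uw(1) this]
    have "dist x y \<le> norm ((u - w) - (v - w'))" by (simp add: algebra_simps)
    also have "\<dots> \<le> norm (u - w) + norm (v - w')" by (rule norm_triangle_ineq4)
    finally show "dist x y \<le> dist x z + dist y z + e" using uw(3) vw(3) by simp
  qed
qed (simp_all add: uniformity_torus_def open_torus_def)

end

text \<open>A vector field on the torus is of class \<open>C\<^sup>1\<close> when its periodic lift is.\<close>

definition C1_torus :: "(('n :: finite) torus \<Rightarrow> real ^ 'n) \<Rightarrow> bool" where
  "C1_torus b \<longleftrightarrow>
    (\<exists>D :: real ^ 'n \<Rightarrow> (real ^ 'n) \<Rightarrow>\<^sub>L (real ^ 'n).
      (\<forall>v. ((\<lambda>w. b (torus_proj w)) has_derivative blinfun_apply (D v)) (at v)) \<and>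
      continuous_on UNIV D)"


section \<open>Wasserstein distances\<close>

text \<open>Couplings are represented by the joint law of the pair \<open>(X, Y)\<close>. The Wasserstein distance
  is real valued; it is only used below for bounded \<open>r\<close>.\<close>

definition couplings :: "'a measure \<Rightarrow> 'a measure \<Rightarrow> ('a \<times> 'a) measure set" where
  "couplings \<mu> \<nu> =
    {P. prob_space P \<and> sets P = sets (\<mu> \<Otimes>\<^sub>M \<nu>) \<and> distr P \<mu> fst = \<mu> \<and> distr P \<nu> snd = \<nu>}"

definition wasserstein :: "('a \<Rightarrow> 'a \<Rightarrow> real) \<Rightarrow> 'a measure \<Rightarrow> 'a measure \<Rightarrow> real" where
  "wasserstein r \<mu> \<nu> = (INF P\<in>couplings \<mu> \<nu>. \<integral>z. r (fst z) (snd z) \<partial>P)"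

definition rho :: "real \<Rightarrow> ('n :: finite) torus \<Rightarrow> 'n torus \<Rightarrow> real" where
  "rho a x y = (1 - exp (- a * dist x y)) / a"

definition rho_sum ::
    "real \<Rightarrow> nat \<Rightarrow> (nat \<Rightarrow> ('n :: finite) torus) \<Rightarrow> (nat \<Rightarrow> 'n torus) \<Rightarrow> real" where
  "rho_sum a N x y = (\<Sum>i<N. rho a (x i) (y i))"


section \<open>The discrete particle system\<close>

definition std_gauss :: "(real ^ ('n :: finite)) measure" where
  "std_gauss = density lborel
    (\<lambda>y. ennreal ((2 * pi) powr (- real CARD('n) / 2) * exp (- (norm y)\<^sup>2 / 2)))"

definition kernel_K ::
    "(('n :: finite) torus \<Rightarrow> real ^ 'n) \<Rightarrow> real \<Rightarrow> 'n torus \<Rightarrow> 'n torus measure" where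
  "kernel_K b \<gamma> x = distr std_gauss borel (\<lambda>y. torus_shift x (\<gamma> *\<^sub>R b x + sqrt \<gamma> *\<^sub>R y))"

definition death_prob :: "(('n :: finite) torus \<Rightarrow> real) \<Rightarrow> real \<Rightarrow> 'n torus \<Rightarrow> real" where
  "death_prob lam \<gamma> z = 1 - exp (- \<gamma> * lam z)"

text \<open>The sequence \<open>(X\<^sub>k, U\<^sub>k)\<close> is the coordinate process on the product space, and
  \<open>H\<close> is the first accepted index. When \<open>lam\<close> is bounded, some index is accepted almost surely,
  so the value of \<open>LEAST\<close> on the exceptional event is irrelevant.\<close>

definition kernel_Q ::
    "(('n :: finite) torus \<Rightarrow> real ^ 'n) \<Rightarrow> ('n torus \<Rightarrow> real) \<Rightarrow> real \<Rightarrow>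
     'n torus measure \<Rightarrow> 'n torus \<Rightarrow> 'n torus measure" where
  "kernel_Q b lam \<gamma> \<mu> x =
    distr
      (PiM (UNIV :: nat set) (\<lambda>k.
        (if k = 0 then kernel_K b \<gamma> x else \<mu> \<bind> kernel_K b \<gamma>)
          \<Otimes>\<^sub>M uniform_measure lborel {0..1 :: real}))
      borel
      (\<lambda>\<omega>. fst (\<omega> (LEAST k. snd (\<omega> k) \<ge> death_prob lam \<gamma> (fst (\<omega> k)))))"

definition empirical :: "nat \<Rightarrow> (nat \<Rightarrow> ('n :: finite) torus) \<Rightarrow> 'n torus measure" where
  "empirical N x = distr (uniform_count_measure {..<N}) borel x"

definition torus_power :: "nat \<Rightarrow> (nat \<Rightarrow> ('n :: finite) torus) measure" where
  "torus_power N = PiM {..<N} (\<lambda>_. borel)"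

definition kernel_R ::
    "(('n :: finite) torus \<Rightarrow> real ^ 'n) \<Rightarrow> ('n torus \<Rightarrow> real) \<Rightarrow> nat \<Rightarrow> real \<Rightarrow>
     (nat \<Rightarrow> 'n torus) \<Rightarrow> (nat \<Rightarrow> 'n torus) measure" where
  "kernel_R b lam N \<gamma> x = PiM {..<N} (\<lambda>i. kernel_Q b lam \<gamma> (empirical N x) (x i))"

definition kappa :: "real \<Rightarrow> real \<Rightarrow> real \<Rightarrow> (('n :: finite) torus \<Rightarrow> real) \<Rightarrow> real \<Rightarrow> real" where
  "kappa c1 c2 L lam \<gamma> = c1 - c2 * L * exp (\<gamma> * (SUP x. \<bar>lam x\<bar>))"


section \<open>The killed diffusion\<close>

definition brownian_motion :: "'w measure \<Rightarrow> (real \<Rightarrow> 'w \<Rightarrow> real ^ ('n :: finite)) \<Rightarrow> bool" where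
  "brownian_motion M B \<longleftrightarrow>
    prob_space M \<and>
    (\<forall>t\<ge>0. B t \<in> borel_measurable M) \<and>
    (AE \<omega> in M. B 0 \<omega> = 0) \<and>
    (AE \<omega> in M. continuous_on {0..} (\<lambda>t. B t \<omega>)) \<and>
    (\<forall>s t. 0 \<le> s \<and> s < t \<longrightarrow>
      distr M borel (\<lambda>\<omega>. B t \<omega> - B s \<omega>) = distr std_gauss borel (\<lambda>y. sqrt (t - s) *\<^sub>R y)) \<and>
    (\<forall>(n :: nat) \<tau>. 0 \<le> \<tau> 0 \<and> strict_mono_on {..n} \<tau> \<longrightarrow>
      prob_space.indep_vars M (\<lambda>_. borel) (\<lambda>i \<omega>. B (\<tau> (Suc i)) \<omega> - B (\<tau> i) \<omega>) {..<n})"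

text \<open>Independence of two random variables with values in measurable spaces of different types.\<close>

definition indep_rv ::
    "'w measure \<Rightarrow> 'a measure \<Rightarrow> ('w \<Rightarrow> 'a) \<Rightarrow> 'b measure \<Rightarrow> ('w \<Rightarrow> 'b) \<Rightarrow> bool" where
  "indep_rv M S X S' Y \<longleftrightarrow>
    X \<in> measurable M S \<and> Y \<in> measurable M S' \<and>
    prob_space.indep_set M {X -` A \<inter> space M | A. A \<in> sets S} {Y -` A \<inter> space M | A. A \<in> sets S'}"

text \<open>The random path \<open>(X\<^sub>t)\<close>, \<open>t \<ge> 0\<close>, takes values in the product space
  \<open>PiM {0..} (\<lambda>_. borel)\<close>.\<close>

definition path_of :: "(real \<Rightarrow> 'w \<Rightarrow> 'a) \<Rightarrow> 'w \<Rightarrow> real \<Rightarrow> 'a" where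
  "path_of X \<omega> = (\<lambda>t\<in>{0..}. X t \<omega>)"

text \<open>The equation \<open>dZ = b(Z) dt + dB\<close> has additive noise, so its integrated form is a pathwise
  identity in the torus. All paths of \<open>Z\<close> are required to be continuous (not just almost all of
  them) so that the killing time below is measurable.\<close>

definition torus_diffusion ::
    "'w measure \<Rightarrow> (('n :: finite) torus \<Rightarrow> real ^ 'n) \<Rightarrow> (real \<Rightarrow> 'w \<Rightarrow> real ^ 'n) \<Rightarrow>
     (real \<Rightarrow> 'w \<Rightarrow> 'n torus) \<Rightarrow> bool" where
  "torus_diffusion M b B Z \<longleftrightarrow>
    brownian_motion M B \<and>
    (\<forall>t\<ge>0. Z t \<in> borel_measurable M) \<and>
    indep_rv M borel (Z 0) (PiM {0..} (\<lambda>_. borel)) (path_of B) \<and>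
    (\<forall>\<omega>\<in>space M. continuous_on {0..} (\<lambda>t. Z t \<omega>)) \<and>
    (AE \<omega> in M. \<forall>t\<ge>0.
      Z t \<omega> = torus_shift (Z 0 \<omega>) (integral {0..t} (\<lambda>s. b (Z s \<omega>)) + B t \<omega>))"

definition killing_time ::
    "('n torus \<Rightarrow> real) \<Rightarrow> (real \<Rightarrow> 'w \<Rightarrow> ('n :: finite) torus) \<Rightarrow> ('w \<Rightarrow> real) \<Rightarrow> 'w \<Rightarrow> ereal" where
  "killing_time lam Z E \<omega> =
    Inf {ereal t | t. 0 \<le> t \<and> E \<omega> \<le> integral {0..t} (\<lambda>s. lam (Z s \<omega>))}"

definition killed_diffusion ::
    "'w measure \<Rightarrow> (('n :: finite) torus \<Rightarrow> real ^ 'n) \<Rightarrow> (real \<Rightarrow> 'w \<Rightarrow> real ^ 'n) \<Rightarrow>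
     (real \<Rightarrow> 'w \<Rightarrow> 'n torus) \<Rightarrow> ('w \<Rightarrow> real) \<Rightarrow> bool" where
  "killed_diffusion M b B Z E \<longleftrightarrow>
    torus_diffusion M b B Z \<and>
    distributed M lborel E (exponential_density 1) \<and>
    indep_rv M borel E (PiM {0..} (\<lambda>_. borel)) (path_of Z)"

text \<open>The law of \<open>Z\<^sub>t\<close> conditionally on \<open>T > t\<close>.\<close>

definition survival_law ::
    "'w measure \<Rightarrow> ('n torus \<Rightarrow> real) \<Rightarrow> (real \<Rightarrow> 'w \<Rightarrow> ('n :: finite) torus) \<Rightarrow> ('w \<Rightarrow> real) \<Rightarrow>
     real \<Rightarrow> 'n torus measure" where
  "survival_law M lam Z E t =
    distr (uniform_measure M {\<omega> \<in> space M. ereal t < killing_time lam Z E \<omega>}) borel (Z t)"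

end

theory Submission
  imports Defs
begin

text \<open>For a step \<open>\<gamma>\<close> let \<open>\<Phi>\<^sub>\<gamma>\<close> move a law by \<open>K\<close>, weight it by \<open>q = e\<^sup>-\<^sup>\<gamma>\<^sup>\<lambda>\<close> and normalise.
  If \<open>N\<close> iid particles make one step of the particle system, each coordinate has a law that tends to
  \<open>\<Phi>\<^sub>\<gamma> \<eta>\<close> as \<open>N \<rightarrow> \<infinity>\<close>. The distance of product laws is at most \<open>N\<close> times that of the factors and at least
  the sum over the marginals, so the contraction of the particle system passes to \<open>\<Phi>\<^sub>\<gamma>\<close> with the same
  factor \<open>1 - \<gamma> \<kappa>\<^sub>\<gamma>\<close>. On the other hand \<open>\<Phi>\<^sub>\<gamma>\<^sup>n \<eta>\<close> is the law of the Euler scheme weighted by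
  \<open>exp (- \<gamma> \<Sum> \<lambda>)\<close>, and the survival law is the law of \<open>Z\<^sub>t\<close> weighted by \<open>exp (- \<integral> \<lambda>)\<close>. The noise is
  additive, so with \<open>\<gamma> = t / n\<close> the scheme driven by the same Brownian motion converges pathwise, and
  dominated convergence gives the claim, since \<open>(1 - \<gamma> \<kappa>\<^sub>\<gamma>)\<^sup>n \<le> e\<^sup>-\<^sup>t\<^sup>\<kappa>\<close>.\<close>

section \<open>Topology of the torus\<close>

text \<open>The particle system is tied to \<open>\<Phi>\<^sub>\<gamma>\<close> by an exact
  identity: a particle that moves from \<open>\<eta>\<close> and, if killed, is replaced by a draw
  from the survivors of \<open>\<eta>\<close> has law \<open>\<Phi>\<^sub>\<gamma> \<eta>\<close>.
  With finitely many particles only the empirical averages in \<open>kernel_Q\<close> fluctuate. The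
  limits are taken one after the other, first \<open>N\<close> to infinity at a fixed step, then the
  step to 0, so neither has to be uniform in the other. Wasserstein distances are compared through
  the triangle inequality, which usually rests on disintegration. Compactness replaces this by
  finite partitions into small cells: laws with close masses on all cells are close, so convergence
  of the mass of each single Borel set is enough. The rate \<open>\<kappa>\<^sub>\<gamma>\<close>
  may be negative. Iterating the contraction needs only
  \<open>1 - \<gamma> \<kappa>\<^sub>\<gamma> \<ge> 0\<close>, which holds for
  \<open>\<gamma> \<le> 1 / c1\<close>; and \<open>\<kappa>\<^sub>\<gamma>\<close> tends to
  \<open>c1 - c2 * L\<close> since its exponential factor tends to 1. The two diffusions may live on
  unrelated probability spaces. They meet only in the iterates of
  \<open>\<Phi>\<^sub>\<gamma>\<close>, which depend on the initial laws alone.\<close>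

lemma dist_torus_proj_le: "dist (torus_proj u) (torus_proj v) \<le> norm (u - v)"
  unfolding dist_torus_def by (intro cInf_lower bdd_belowI[of _ 0]) auto

text \<open>The infimum in the distance runs over lifts of both points. Shifting both by one integer
  vector keeps their difference, so the lift \<open>u\<close> can be prescribed. The slack
  \<open>e\<close> makes attainment unnecessary.\<close>

lemma torus_lift_near:
  assumes "e > 0"
  obtains v where "torus_proj v = y" "norm (u - v) < dist (torus_proj u) y + e"
proof -
  let ?S = "{norm (u' - v) | u' v. torus_proj u' = torus_proj u \<and> torus_proj v = y}"
  have "Inf ?S < dist (torus_proj u) y + e"
    using assms by (simp add: dist_torus_def)
  moreover have "?S \<noteq> {}"
    using torus_proj_surj[of y] by blast
  ultimately have "\<exists>x\<in>?S. x < dist (torus_proj u) y + e" by (intro cInf_lessD)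
  then obtain u' v where uv: "torus_proj u' = torus_proj u" "torus_proj v = y"
      "norm (u' - v) < dist (torus_proj u) y + e"
    by auto
  have "int_translate u u'"
    using uv(1) int_translate_sym unfolding torus_proj_eq_iff by auto
  then have "torus_proj (v + (u - u')) = torus_proj v"
    unfolding torus_proj_eq_iff by (simp add: int_translate_def)
  then show ?thesis
    using that[of "v + (u - u')"] uv by (simp add: algebra_simps)
qed

lemma continuous_torus_proj: "continuous_on A torus_proj"
  by (intro lipschitz_on_continuous_on[of 1] lipschitz_onI) (simp_all add: dist_norm dist_torus_proj_le)

lemma torus_shift_proj: "torus_shift (torus_proj u) v = torus_proj (u + v)"
  by (rule torus_shift.abs_eq)

text \<open>Applied to one base point and two translations it leaves only the norm of their
  difference; this is how the common Brownian part cancels between the Euler scheme and the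
  diffusion.\<close>

lemma dist_torus_shift_le: "dist (torus_shift x u) (torus_shift y v) \<le> dist x y + norm (u - v)"
proof (rule field_le_epsilon)
  fix e :: real assume "e > 0"
  obtain x' where x: "torus_proj x' = x" using torus_proj_surj by blast
  obtain y' where y: "torus_proj y' = y" "norm (x' - y') < dist x y + e"
    using torus_lift_near[OF \<open>e > 0\<close>, of y x'] x by auto
  have "dist (torus_shift x u) (torus_shift y v) \<le> norm ((x' + u) - (y' + v))"
    unfolding x[symmetric] y(1)[symmetric] torus_shift_proj by (rule dist_torus_proj_le)
  also have "\<dots> \<le> norm (x' - y') + norm (u - v)"
    using norm_triangle_ineq[of "x' - y'" "u - v"] by (simp add: algebra_simps)
  finally show "dist (torus_shift x u) (torus_shift y v) \<le> dist x y + norm (u - v) + e"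
    using y by simp
qed

lemma torus_shift_shift: "torus_shift (torus_shift x u) v = torus_shift x (u + v)"
proof -
  obtain x' where "torus_proj x' = x" using torus_proj_surj by blast
  then show ?thesis by (metis torus_shift_proj add.assoc)
qed

lemma torus_shift_0 [simp]: "torus_shift x 0 = x"
proof -
  obtain x' where "torus_proj x' = x" using torus_proj_surj by blast
  then show ?thesis by (metis torus_shift_proj add.right_neutral)
qed

lemma continuous_torus_shift: "continuous_on A (\<lambda>p. torus_shift (fst p) (snd p))"
proof (rule continuous_onI)
  fix p :: "'a torus \<times> (real ^ 'a)" and e :: real assume "e > 0"
  show "\<exists>d>0. \<forall>p'\<in>A. dist p' p < d \<longrightarrow>
      dist (torus_shift (fst p') (snd p')) (torus_shift (fst p) (snd p)) \<le> e"
  proof (intro exI[of _ "e / 2"] conjI ballI impI)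
    fix p' assume d: "dist p' p < e / 2"
    have "dist (torus_shift (fst p') (snd p')) (torus_shift (fst p) (snd p))
        \<le> dist (fst p') (fst p) + dist (snd p') (snd p)"
      using dist_torus_shift_le[of "fst p'" "snd p'" "fst p" "snd p"] by (simp add: dist_norm)
    also have "\<dots> \<le> e"
      using dist_fst_le[of p' p] dist_snd_le[of p' p] d by linarith
    finally show "dist (torus_shift (fst p') (snd p')) (torus_shift (fst p) (snd p)) \<le> e" .
  qed (use \<open>e > 0\<close> in auto)
qed

lemma torus_lift_cbox:
  obtains u :: "real ^ ('n :: finite)" where "torus_proj u = x" "u \<in> cbox 0 1"
proof -
  obtain u0 where u0: "torus_proj u0 = x" using torus_proj_surj by blast
  define u where "u = (\<chi> i. frac (u0 $ i))"
  have "torus_proj u = torus_proj u0"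
    unfolding torus_proj_eq_iff by (simp add: int_translate_def u_def frac_def)
  moreover have "u \<in> cbox 0 1"
    by (simp add: u_def mem_box_cart frac_ge_0 frac_lt_1 less_imp_le)
  ultimately show ?thesis using that u0 by simp
qed

lemma compact_UNIV_torus: "compact (UNIV :: ('n :: finite) torus set)"
proof -
  have "compact (torus_proj ` cbox (0 :: real ^ 'n) 1)"
    by (rule compact_continuous_image[OF continuous_torus_proj compact_cbox])
  moreover have "torus_proj ` cbox (0 :: real ^ 'n) 1 = UNIV"
    using torus_lift_cbox by (metis UNIV_eq_I image_eqI)
  ultimately show ?thesis by simp
qed

lemma open_torus_proj_image:
  assumes "open U"
  shows "open (torus_proj ` U)"
  unfolding open_dist
proof (intro ballI)
  fix x assume "x \<in> torus_proj ` U"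
  then obtain u where u: "u \<in> U" "x = torus_proj u" by blast
  then obtain e where e: "e > 0" "\<And>v. dist v u < e \<Longrightarrow> v \<in> U"
    using assms unfolding open_dist by blast
  show "\<exists>e>0. \<forall>y. dist y x < e \<longrightarrow> y \<in> torus_proj ` U"
  proof (intro exI[of _ "e / 2"] conjI allI impI)
    fix y assume "dist y x < e / 2"
    moreover obtain v where "torus_proj v = y" "norm (u - v) < dist (torus_proj u) y + e / 2"
      using torus_lift_near[of "e / 2" y u] e(1) by auto
    ultimately have "dist v u < e" "torus_proj v = y"
      using u by (simp_all add: dist_norm norm_minus_commute dist_commute)
    then show "y \<in> torus_proj ` U" using e(2) by blast
  qed (use e in simp)
qed

text \<open>The projection is open, so the images of a countable basis form a basis. Second
  countability makes \<open>borel \<Otimes>\<^sub>M borel\<close> the Borel sigma algebra of the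
  product; continuous functions of two points, such as distance and shift, are then jointly
  measurable.\<close>

instance torus :: (finite) second_countable_topology
proof
  obtain \<B> :: "(real ^ 'a) set set" where \<B>: "countable \<B>" "topological_basis \<B>"
    using ex_countable_basis by auto
  let ?C = "(\<lambda>U. torus_proj ` U) ` \<B>"
  have "topological_basis ?C"
    unfolding topological_basis_def
  proof (intro conjI allI impI ballI)
    fix S :: "'a torus set" assume "open S"
    then have "open (torus_proj -` S)"
      by (rule open_vimage[OF _ continuous_torus_proj])
    then obtain U where U: "U \<subseteq> \<B>" "\<Union>U = torus_proj -` S"
      using \<B>(2) unfolding topological_basis_def by blast
    have "surj (torus_proj :: _ \<Rightarrow> 'a torus)" unfolding surj_def by (intro allI) (use torus_proj_surj in metis)
    then have "S = torus_proj ` (torus_proj -` S)" by (simp add: surj_image_vimage_eq)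
    also have "\<dots> = \<Union>((\<lambda>U. torus_proj ` U) ` U)" unfolding U(2)[symmetric] by (rule image_Union)
    finally show "\<exists>C\<subseteq>?C. \<Union>C = S"
      using U(1) by (intro exI[of _ "(\<lambda>U. torus_proj ` U) ` U"]) blast
  next
    fix C assume "C \<in> ?C"
    then show "open C"
      using topological_basis_open[OF \<B>(2)] open_torus_proj_image by auto
  qed
  then have "open = generate_topology ?C"
    by (rule topological_basis_imp_subbasis)
  then show "\<exists>B::'a torus set set. countable B \<and> open = generate_topology B"
    using \<B>(1) by (intro exI[of _ ?C]) simp
qed

lemma measurable_torus_shift [measurable]:
  "(\<lambda>p. torus_shift (fst p) (snd p)) \<in> borel_measurable (borel \<Otimes>\<^sub>M borel)"
  unfolding borel_prod by (intro borel_measurable_continuous_onI continuous_torus_shift)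

lemma measurable_torus_shift' [measurable (raw)]:
  assumes "f \<in> borel_measurable M" "g \<in> borel_measurable M"
  shows "(\<lambda>x. torus_shift (f x) (g x)) \<in> borel_measurable M"
  using measurable_compose[OF measurable_Pair[OF assms] measurable_torus_shift] by simp

text \<open>The lift of a \<open>C\<^sup>1\<close> field has a bounded derivative on a large ball, and two
  close points of the torus have close lifts in such a ball.\<close>

lemma C1_torus_lipschitz:
  fixes b :: "('n :: finite) torus \<Rightarrow> real ^ 'n"
  assumes "C1_torus b"
  obtains C where "C > 0" "C-lipschitz_on UNIV b"
proof -
  obtain D :: "real ^ 'n \<Rightarrow> (real ^ 'n) \<Rightarrow>\<^sub>L (real ^ 'n)" where
    D: "\<And>v. ((\<lambda>w. b (torus_proj w)) has_derivative blinfun_apply (D v)) (at v)" "continuous_on UNIV D"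
    using assms unfolding C1_torus_def by blast
  obtain R where R: "\<And>u :: real ^ 'n. u \<in> cbox 0 1 \<Longrightarrow> norm u \<le> R"
    using bounded_cbox[of "0 :: real ^ 'n" 1] unfolding bounded_iff by blast
  obtain Rd where Rd: "\<And>x y :: 'n torus. dist x y \<le> Rd"
    using compact_imp_bounded[OF compact_UNIV_torus] by (metis UNIV_I bounded_two_points)
  \<comment> \<open>Large enough for both lifts: \<open>u\<close> lies in the unit cube and has norm
    at most \<open>R\<close>, and \<open>v\<close> is within \<open>Rd + 1\<close> of it because
    \<open>e' \<le> 1\<close>.\<close>
  let ?S = "cball (0 :: real ^ 'n) (R + Rd + 1)"
  have "bounded (D ` ?S)"
    by (intro compact_imp_bounded compact_continuous_image continuous_on_subset[OF D(2)]) auto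
  then obtain C where C: "C > 0" "\<And>v. v \<in> ?S \<Longrightarrow> norm (D v) \<le> C"
    by (metis bounded_pos imageI)
  have "dist (b x) (b y) \<le> C * dist x y" for x y
  proof (rule field_le_epsilon)
    fix e :: real assume "e > 0"
    define e' where "e' = min 1 (e / C)"
    have e': "e' > 0" "e' \<le> 1" "C * e' \<le> e"
      using \<open>e > 0\<close> C(1) by (auto simp: e'_def min_def field_simps)
    obtain u where u: "torus_proj u = x" "u \<in> cbox 0 1" by (rule torus_lift_cbox)
    obtain v where v: "torus_proj v = y" "norm (u - v) < dist x y + e'"
      using torus_lift_near[OF e'(1), of y u] u by auto
    have "norm v \<le> norm u + norm (u - v)"
      by (metis norm_triangle_sub norm_minus_commute)
    also have "\<dots> \<le> R + Rd + 1" using R[OF u(2)] v(2) Rd[of x y] e' by linarith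
    finally have vS: "v \<in> ?S" by simp
    have "0 \<le> Rd" using Rd[of x x] by simp
    then have uS: "u \<in> ?S" using R[OF u(2)] by simp
    have "norm (b (torus_proj u) - b (torus_proj v)) \<le> C * norm (u - v)"
      by (rule differentiable_bound[of ?S _ "\<lambda>v. blinfun_apply (D v)"])
        (use vS uS C in \<open>auto intro: has_derivative_at_withinI[OF D(1)] simp: norm_blinfun.rep_eq[symmetric]\<close>)
    also have "\<dots> \<le> C * (dist x y + e')"
      using v(2) C(1) by (intro mult_left_mono) auto
    also have "\<dots> \<le> C * dist x y + e" using e'(3) by (simp add: distrib_left)
    finally show "dist (b x) (b y) \<le> C * dist x y + e" using u v by (simp add: dist_norm)
  qed
  then have "C-lipschitz_on UNIV b" using C(1) by (intro lipschitz_onI) auto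
  with C(1) show ?thesis using that by blast
qed

text \<open>The cell of a point is the first ball of a finite cover that contains it. Coding the
  partition by its index map turns comparisons of laws into finite sums, and "same cell" into an
  equation of natural numbers.\<close>

lemma torus_partition:
  assumes "e > 0"
  obtains k :: "('n :: finite) torus \<Rightarrow> nat" and n where
    "k \<in> measurable borel (count_space UNIV)" "\<And>x. k x < n" "\<And>x y. k x = k y \<Longrightarrow> dist x y \<le> e"
proof -
  have cover: "UNIV \<subseteq> (\<Union>x :: 'n torus. ball x (e / 2))" using assms by auto
  obtain F :: "'n torus set" where F: "F \<subseteq> UNIV" "finite F" "UNIV \<subseteq> (\<Union>x\<in>F. ball x (e / 2))"
    using compactE_image[OF compact_UNIV_torus open_ball cover] .
  obtain xs where xs: "set xs = F" using finite_list[OF F(2)] by metis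
  define k where "k x = (LEAST i. i < length xs \<and> dist (xs ! i) x < e / 2)" for x
  have k: "k x < length xs \<and> dist (xs ! k x) x < e / 2" for x
  proof -
    have "x \<in> (\<Union>x\<in>F. ball x (e / 2))" using F(3) by (rule subsetD) simp
    then obtain y where "y \<in> set xs" "dist y x < e / 2" unfolding xs by auto
    then have "\<exists>i. i < length xs \<and> dist (xs ! i) x < e / 2" unfolding in_set_conv_nth by blast
    then show ?thesis unfolding k_def by (rule LeastI_ex)
  qed
  have "k \<in> measurable borel (count_space UNIV)"
    unfolding k_def by (intro measurable_Least) measurable
  moreover have "dist x y \<le> e" if "k x = k y" for x y
    using dist_triangle2[of x y "xs ! k x"] k[of x] k[of y] that by (simp add: dist_commute)
  ultimately show ?thesis using k by (intro that[of k "length xs"]) auto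
qed

lemma torus_lipschitz_bounded:
  fixes f :: "('n :: finite) torus \<Rightarrow> real"
  assumes "L-lipschitz_on UNIV f"
  obtains C where "\<And>x. \<bar>f x\<bar> \<le> C"
proof -
  have "compact (range f)"
    by (intro compact_continuous_image lipschitz_on_continuous_on[OF assms] compact_UNIV_torus)
  then show ?thesis
    using compact_imp_bounded[of "range f"] that unfolding bounded_iff by auto
qed

section \<open>Wasserstein distances of laws on the torus\<close>

lemma rho_nonneg: "a > 0 \<Longrightarrow> 0 \<le> rho a x y"
  by (simp add: rho_def)

lemma rho_le_inverse: "a > 0 \<Longrightarrow> rho a x y \<le> 1 / a"
  by (simp add: rho_def divide_right_mono)

lemma rho_le_dist:
  assumes "a > 0"
  shows "rho a x y \<le> dist x y"
  using exp_ge_add_one_self[of "- a * dist x y"] assms by (simp add: rho_def field_simps)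

lemma rho_commute: "rho a x y = rho a y x"
  by (simp add: rho_def dist_commute)

text \<open>With \<open>u\<close> and \<open>v\<close> the exponentials of the two shorter legs,
  everything reduces to \<open>0 \<le> (1 - u) * (1 - v)\<close>.\<close>

lemma rho_triangle:
  assumes "a > 0"
  shows "rho a x z \<le> rho a x y + rho a y z"
proof -
  let ?u = "exp (- a * dist x y)" and ?v = "exp (- a * dist y z)"
  have "?u * ?v \<le> exp (- a * dist x z)"
    using mult_left_mono[OF dist_triangle[of x z y], of a] assms
    by (simp add: exp_add[symmetric] distrib_left)
  moreover have "0 \<le> (1 - ?u) * (1 - ?v)"
    using assms by (intro mult_nonneg_nonneg) auto
  ultimately have "1 - exp (- a * dist x z) \<le> (1 - ?u) + (1 - ?v)" by (simp add: algebra_simps)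
  then show ?thesis
    using assms by (simp add: rho_def add_divide_distrib[symmetric] divide_right_mono)
qed

lemma measurable_rho [measurable (raw)]:
  assumes "f \<in> borel_measurable M" "g \<in> borel_measurable M"
  shows "(\<lambda>x. rho a (f x) (g x)) \<in> borel_measurable M"
  unfolding rho_def using assms by measurable

section \<open>Couplings given by a density with respect to a product law\<close>

lemma nn_integral_pair_marginal:
  fixes h :: "'b \<times> 'c \<Rightarrow> ennreal"
  assumes P: "prob_space P" and P': "prob_space P'" and h [measurable]: "h \<in> borel_measurable (P \<Otimes>\<^sub>M P')"
  shows "AE w in P. (\<integral>\<^sup>+w'. h (w, w') \<partial>P') = 1 \<Longrightarrow> f \<in> borel_measurable P \<Longrightarrow>
      (\<integral>\<^sup>+z. h z * f (fst z) \<partial>(P \<Otimes>\<^sub>M P')) = (\<integral>\<^sup>+w. f w \<partial>P)"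
    and "AE w' in P'. (\<integral>\<^sup>+w. h (w, w') \<partial>P) = 1 \<Longrightarrow> g \<in> borel_measurable P' \<Longrightarrow>
      (\<integral>\<^sup>+z. h z * g (snd z) \<partial>(P \<Otimes>\<^sub>M P')) = (\<integral>\<^sup>+w. g w \<partial>P')"
proof -
  interpret P: prob_space P by fact
  interpret P': prob_space P' by fact
  interpret PP: pair_sigma_finite P P' ..
  show "(\<integral>\<^sup>+z. h z * f (fst z) \<partial>(P \<Otimes>\<^sub>M P')) = (\<integral>\<^sup>+w. f w \<partial>P)"
    if h1: "AE w in P. (\<integral>\<^sup>+w'. h (w, w') \<partial>P') = 1" and [measurable]: "f \<in> borel_measurable P"
  proof -
    have "(\<integral>\<^sup>+z. h z * f (fst z) \<partial>(P \<Otimes>\<^sub>M P')) = (\<integral>\<^sup>+w. \<integral>\<^sup>+w'. h (w, w') * f w \<partial>P' \<partial>P)"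
      by (subst P'.nn_integral_fst[symmetric]) auto
    also have "\<dots> = (\<integral>\<^sup>+w. (\<integral>\<^sup>+w'. h (w, w') \<partial>P') * f w \<partial>P)"
      by (intro nn_integral_cong nn_integral_multc) measurable
    also have "\<dots> = (\<integral>\<^sup>+w. f w \<partial>P)"
      by (rule nn_integral_cong_AE) (use h1 in eventually_elim, simp)
    finally show ?thesis .
  qed
  show "(\<integral>\<^sup>+z. h z * g (snd z) \<partial>(P \<Otimes>\<^sub>M P')) = (\<integral>\<^sup>+w. g w \<partial>P')"
    if h2: "AE w' in P'. (\<integral>\<^sup>+w. h (w, w') \<partial>P) = 1" and [measurable]: "g \<in> borel_measurable P'"
  proof -
    have "(\<integral>\<^sup>+z. h z * g (snd z) \<partial>(P \<Otimes>\<^sub>M P')) = (\<integral>\<^sup>+w'. \<integral>\<^sup>+w. h (w, w') * g w' \<partial>P \<partial>P')"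
      by (subst PP.nn_integral_snd[symmetric]) auto
    also have "\<dots> = (\<integral>\<^sup>+w'. (\<integral>\<^sup>+w. h (w, w') \<partial>P) * g w' \<partial>P')"
      by (intro nn_integral_cong nn_integral_multc) measurable
    also have "\<dots> = (\<integral>\<^sup>+w. g w \<partial>P')"
      by (rule nn_integral_cong_AE) (use h2 in eventually_elim, simp)
    finally show ?thesis .
  qed
qed

text \<open>Unit partial integrals of \<open>h\<close> say that tilting the product keeps both
  marginals. The maps \<open>X\<close> and \<open>Y\<close> are there for gluing: then
  \<open>P\<close> and \<open>P'\<close> are themselves couplings, \<open>h\<close> links their
  inner coordinates, and \<open>X\<close>, \<open>Y\<close> retain the outer ones.\<close>

lemma density_in_couplings:
  fixes h :: "'b \<times> 'c \<Rightarrow> ennreal"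
  assumes P: "prob_space P" and P': "prob_space P'"
    and X [measurable]: "X \<in> P \<rightarrow>\<^sub>M S" and Y [measurable]: "Y \<in> P' \<rightarrow>\<^sub>M S"
    and h [measurable]: "h \<in> borel_measurable (P \<Otimes>\<^sub>M P')"
    and h1: "AE w in P. (\<integral>\<^sup>+w'. h (w, w') \<partial>P') = 1"
    and h2: "AE w' in P'. (\<integral>\<^sup>+w. h (w, w') \<partial>P) = 1"
  shows "distr (density (P \<Otimes>\<^sub>M P') h) (S \<Otimes>\<^sub>M S) (\<lambda>z. (X (fst z), Y (snd z)))
    \<in> couplings (distr P S X) (distr P' S Y)" (is "distr ?D _ ?XY \<in> _")
proof -
  note m = nn_integral_pair_marginal[OF P P' h]
  have em: "emeasure (distr ?D S V) A = (\<integral>\<^sup>+z. h z * indicator A (V z) \<partial>(P \<Otimes>\<^sub>M P'))"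
    if [measurable]: "V \<in> P \<Otimes>\<^sub>M P' \<rightarrow>\<^sub>M S" "A \<in> sets S" for V A
  proof -
    have "emeasure (distr ?D S V) A = (\<integral>\<^sup>+x. indicator A x \<partial>distr ?D S V)" by simp
    also have "\<dots> = (\<integral>\<^sup>+z. h z * indicator A (V z) \<partial>(P \<Otimes>\<^sub>M P'))"
      by (subst nn_integral_distr, measurable, subst nn_integral_density) auto
    finally show ?thesis .
  qed
  have D1: "distr ?D S (\<lambda>z. X (fst z)) = distr P S X"
  proof (rule measure_eqI)
    fix A assume "A \<in> sets (distr ?D S (\<lambda>z. X (fst z)))"
    then have [measurable]: "A \<in> sets S" by simp
    have "emeasure (distr ?D S (\<lambda>z. X (fst z))) A = (\<integral>\<^sup>+w. indicator A (X w) \<partial>P)"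
      using m(1)[OF h1, of "\<lambda>w. indicator A (X w)"] by (subst em) simp_all
    also have "\<dots> = (\<integral>\<^sup>+x. indicator A x \<partial>distr P S X)" by (subst nn_integral_distr) auto
    finally show "emeasure (distr ?D S (\<lambda>z. X (fst z))) A = emeasure (distr P S X) A" by simp
  qed simp
  have D2: "distr ?D S (\<lambda>z. Y (snd z)) = distr P' S Y"
  proof (rule measure_eqI)
    fix A assume "A \<in> sets (distr ?D S (\<lambda>z. Y (snd z)))"
    then have [measurable]: "A \<in> sets S" by simp
    have "emeasure (distr ?D S (\<lambda>z. Y (snd z))) A = (\<integral>\<^sup>+w. indicator A (Y w) \<partial>P')"
      using m(2)[OF h2, of "\<lambda>w. indicator A (Y w)"] by (subst em) simp_all
    also have "\<dots> = (\<integral>\<^sup>+x. indicator A x \<partial>distr P' S Y)" by (subst nn_integral_distr) auto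
    finally show "emeasure (distr ?D S (\<lambda>z. Y (snd z))) A = emeasure (distr P' S Y) A" by simp
  qed simp
  have XY: "?XY \<in> ?D \<rightarrow>\<^sub>M S \<Otimes>\<^sub>M S" by simp
  have "emeasure ?D (space ?D) = (\<integral>\<^sup>+z. h z * 1 \<partial>(P \<Otimes>\<^sub>M P'))"
    by (subst emeasure_density) (auto simp: space_density intro!: nn_integral_cong)
  also have "\<dots> = 1" using m(1)[OF h1, of "\<lambda>_. 1"] P by (simp add: prob_space.emeasure_space_1)
  finally interpret D: prob_space ?D by (rule prob_spaceI)
  show ?thesis
    unfolding couplings_def
  proof (intro CollectI conjI)
    show "prob_space (distr ?D (S \<Otimes>\<^sub>M S) ?XY)" by (rule D.prob_space_distr[OF XY])
    show "sets (distr ?D (S \<Otimes>\<^sub>M S) ?XY) = sets (distr P S X \<Otimes>\<^sub>M distr P' S Y)"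
      by (simp cong: sets_pair_measure_cong)
    \<comment> \<open>The target of \<open>distr\<close> matters only through its sets, so the
      marginals in the definition of \<open>couplings\<close> may be taken over
      \<open>S\<close>.\<close>
    have "distr (distr ?D (S \<Otimes>\<^sub>M S) ?XY) (distr P S X) fst = distr (distr ?D (S \<Otimes>\<^sub>M S) ?XY) S fst"
      "distr (distr ?D (S \<Otimes>\<^sub>M S) ?XY) (distr P' S Y) snd = distr (distr ?D (S \<Otimes>\<^sub>M S) ?XY) S snd"
      by (auto intro!: distr_cong)
    then show "distr (distr ?D (S \<Otimes>\<^sub>M S) ?XY) (distr P S X) fst = distr P S X"
      "distr (distr ?D (S \<Otimes>\<^sub>M S) ?XY) (distr P' S Y) snd = distr P' S Y"
      by (simp_all add: distr_distr[OF measurable_fst XY] distr_distr[OF measurable_snd XY] comp_def D1 D2)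
  qed
qed

lemma nn_integral_density_coupling:
  fixes h :: "'b \<times> 'c \<Rightarrow> ennreal"
  assumes [measurable]: "X \<in> P \<rightarrow>\<^sub>M S" "Y \<in> P' \<rightarrow>\<^sub>M S"
      "h \<in> borel_measurable (P \<Otimes>\<^sub>M P')" "f \<in> borel_measurable (S \<Otimes>\<^sub>M S)"
  shows "(\<integral>\<^sup>+z. f z \<partial>distr (density (P \<Otimes>\<^sub>M P') h) (S \<Otimes>\<^sub>M S) (\<lambda>z. (X (fst z), Y (snd z))))
    = (\<integral>\<^sup>+z. h z * f (X (fst z), Y (snd z)) \<partial>(P \<Otimes>\<^sub>M P'))"
  by (subst nn_integral_distr, measurable, subst nn_integral_density) auto

text \<open>The product law, as the density 1. Nonemptiness makes the infimum in
  \<open>wasserstein\<close> meaningful.\<close>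

lemma couplings_pair_measure:
  assumes "\<mu> \<in> space (prob_algebra S)" "\<nu> \<in> space (prob_algebra S)"
  shows "couplings \<mu> \<nu> \<noteq> {}"
proof -
  have *: "prob_space \<mu>" "prob_space \<nu>" "sets \<mu> = sets S" "sets \<nu> = sets S"
    using assms by (auto simp: space_prob_algebra)
  have "distr (density (\<mu> \<Otimes>\<^sub>M \<nu>) (\<lambda>_. 1)) (S \<Otimes>\<^sub>M S) (\<lambda>z. ((\<lambda>x. x) (fst z), (\<lambda>x. x) (snd z)))
      \<in> couplings (distr \<mu> S (\<lambda>x. x)) (distr \<nu> S (\<lambda>x. x))"
    using * by (intro density_in_couplings) (auto simp: prob_space.emeasure_space_1)
  moreover have "distr \<mu> S (\<lambda>x. x) = \<mu>" "distr \<nu> S (\<lambda>x. x) = \<nu>"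
    using * by (auto intro!: distr_id2)
  ultimately show ?thesis by auto
qed

lemma couplingsD:
  assumes "C \<in> couplings \<mu> \<nu>" "sets \<mu> = sets S" "sets \<nu> = sets S"
  shows "prob_space C" "sets C = sets (S \<Otimes>\<^sub>M S)" "distr C S fst = \<mu>" "distr C S snd = \<nu>"
    "fst \<in> C \<rightarrow>\<^sub>M S" "snd \<in> C \<rightarrow>\<^sub>M S"
proof -
  have *: "sets C = sets (S \<Otimes>\<^sub>M S)"
    using assms by (simp add: couplings_def cong: sets_pair_measure_cong)
  then show "fst \<in> C \<rightarrow>\<^sub>M S" "snd \<in> C \<rightarrow>\<^sub>M S"
    by (simp_all cong: measurable_cong_sets)
  have "distr C S fst = distr C \<mu> fst" "distr C S snd = distr C \<nu> snd"
    using assms by (auto intro!: distr_cong)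
  with * assms show "prob_space C" "sets C = sets (S \<Otimes>\<^sub>M S)" "distr C S fst = \<mu>" "distr C S snd = \<nu>"
    by (auto simp: couplings_def)
qed

lemma wasserstein_le_coupling:
  assumes "C \<in> couplings \<mu> \<nu>" "\<And>x y. 0 \<le> r x y"
  shows "wasserstein r \<mu> \<nu> \<le> (\<integral>z. r (fst z) (snd z) \<partial>C)"
  unfolding wasserstein_def
  by (rule cINF_lower[OF bdd_belowI2[of _ 0] assms(1)])
    (intro Bochner_Integration.integral_nonneg assms(2))

lemma wasserstein_nonneg:
  assumes "couplings \<mu> \<nu> \<noteq> {}" "\<And>x y. 0 \<le> r x y"
  shows "0 \<le> wasserstein r \<mu> \<nu>"
  unfolding wasserstein_def by (rule cINF_greatest[OF assms(1)]) (auto intro!: Bochner_Integration.integral_nonneg assms)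

lemma wasserstein_approx:
  assumes "couplings \<mu> \<nu> \<noteq> {}" "e > 0"
  obtains C where "C \<in> couplings \<mu> \<nu>" "(\<integral>z. r (fst z) (snd z) \<partial>C) < wasserstein r \<mu> \<nu> + e"
proof -
  have "(INF P\<in>couplings \<mu> \<nu>. \<integral>z. r (fst z) (snd z) \<partial>P) < wasserstein r \<mu> \<nu> + e"
    using assms(2) by (simp add: wasserstein_def)
  then have "\<exists>x\<in>(\<lambda>P. \<integral>z. r (fst z) (snd z) \<partial>P) ` couplings \<mu> \<nu>. x < wasserstein r \<mu> \<nu> + e"
    using assms(1) by (intro cInf_lessD) auto
  then show ?thesis using that by auto
qed

lemma integral_rho_coupling:
  fixes C :: "(('n :: finite) torus \<times> 'n torus) measure"
  assumes "a > 0" "prob_space C" "sets C = sets (borel \<Otimes>\<^sub>M borel)"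
  shows "integrable C (\<lambda>z. rho a (fst z) (snd z))"
    "ennreal (\<integral>z. rho a (fst z) (snd z) \<partial>C) = (\<integral>\<^sup>+z. ennreal (rho a (fst z) (snd z)) \<partial>C)"
proof -
  interpret prob_space C by fact
  note [measurable_cong] = assms(3)
  show i: "integrable C (\<lambda>z. rho a (fst z) (snd z))"
    by (rule integrable_const_bound[of _ "1 / a"])
      (auto simp: rho_nonneg[OF \<open>a > 0\<close>] rho_le_inverse[OF \<open>a > 0\<close>])
  show "ennreal (\<integral>z. rho a (fst z) (snd z) \<partial>C) = (\<integral>\<^sup>+z. ennreal (rho a (fst z) (snd z)) \<partial>C)"
    using nn_integral_eq_integral[OF i] by (simp add: rho_nonneg[OF \<open>a > 0\<close>])
qed

text \<open>Costs are estimated in \<open>ennreal\<close>, where densities and Fubini come without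
  integrability conditions; this is the way back to real numbers.\<close>

lemma wasserstein_rho_le:
  fixes C :: "(('n :: finite) torus \<times> 'n torus) measure"
  assumes "a > 0" "C \<in> couplings \<mu> \<nu>" "\<mu> \<in> space (prob_algebra borel)" "\<nu> \<in> space (prob_algebra borel)"
    and "(\<integral>\<^sup>+z. ennreal (rho a (fst z) (snd z)) \<partial>C) \<le> ennreal c" "0 \<le> c"
  shows "wasserstein (rho a) \<mu> \<nu> \<le> c"
proof -
  have *: "sets \<mu> = sets borel" "sets \<nu> = sets borel" using assms by (auto simp: space_prob_algebra)
  have "(\<integral>z. rho a (fst z) (snd z) \<partial>C) \<le> c"
    using assms(5,6) integral_rho_coupling(2)[OF assms(1) couplingsD(1,2)[OF assms(2) *]]
    by (metis ennreal_le_iff)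
  with wasserstein_le_coupling[OF assms(2) rho_nonneg[OF \<open>a > 0\<close>]] show ?thesis
    by (rule order_trans)
qed

section \<open>Couplings through a finite partition into cells\<close>

lemma cell_integrals:
  fixes k :: "'a :: topological_space \<Rightarrow> nat"
  assumes \<mu>: "prob_space \<mu>" "sets \<mu> = sets borel"
    and k [measurable]: "k \<in> measurable borel (count_space UNIV)" and kn: "\<And>x. k x < n"
  shows "(\<Sum>i<n. measure \<mu> {x. k x = i}) = 1"
    and "(\<And>j. 0 \<le> F j) \<Longrightarrow> (\<integral>\<^sup>+x. ennreal (F (k x)) \<partial>\<mu>) = ennreal (\<Sum>j<n. F j * measure \<mu> {x. k x = j})"
    and "AE x in \<mu>. measure \<mu> {y. k y = k x} > 0"
proof -
  interpret prob_space \<mu> by fact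
  note [measurable_cong] = \<mu>(2)
  have sp: "space \<mu> = UNIV" using sets_eq_imp_space_eq[OF \<mu>(2)] by simp
  have cell: "{x. k x = i} \<in> sets \<mu>" for i
  proof -
    have "{x \<in> space \<mu>. k x = i} \<in> sets \<mu>" by measurable
    then show ?thesis by (simp add: sp)
  qed
  have "(\<Sum>i<n. measure \<mu> {x. k x = i}) = measure \<mu> (\<Union>i\<in>{..<n}. {x. k x = i})"
    by (rule finite_measure_finite_Union[symmetric]) (auto simp: cell disjoint_family_on_def)
  also have "(\<Union>i\<in>{..<n}. {x. k x = i}) = space \<mu>" using kn by (auto simp: sp)
  finally show "(\<Sum>i<n. measure \<mu> {x. k x = i}) = 1" by (simp add: prob_space)
  show "(\<integral>\<^sup>+x. ennreal (F (k x)) \<partial>\<mu>) = ennreal (\<Sum>j<n. F j * measure \<mu> {x. k x = j})"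
    if F: "\<And>j. 0 \<le> F j"
  proof -
    have "(\<integral>\<^sup>+x. ennreal (F (k x)) \<partial>\<mu>) = (\<integral>\<^sup>+x. (\<Sum>j<n. ennreal (F j) * indicator {x. k x = j} x) \<partial>\<mu>)"
      using kn by (intro nn_integral_cong) (simp add: indicator_def if_distrib cong: if_cong)
    also have "\<dots> = (\<Sum>j<n. ennreal (F j) * ennreal (measure \<mu> {x. k x = j}))"
      by (subst nn_integral_sum) (auto simp: nn_integral_cmult_indicator cell emeasure_eq_measure)
    also have "\<dots> = ennreal (\<Sum>j<n. F j * measure \<mu> {x. k x = j})"
      by (simp add: ennreal_mult[symmetric] F sum_ennreal)
    finally show ?thesis .
  qed
  \<comment> \<open>Each null cell is avoided almost surely, and countably many indices allow the
    quantifier to move inside.\<close>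
  have "AE x in \<mu>. measure \<mu> {x. k x = i} = 0 \<longrightarrow> k x \<noteq> i" for i
  proof (cases "measure \<mu> {x. k x = i} = 0")
    case True
    then have "{x. k x = i} \<in> null_sets \<mu>" by (auto simp: null_sets_def cell emeasure_eq_measure)
    from AE_not_in[OF this] show ?thesis by simp
  qed simp
  then have "AE x in \<mu>. \<forall>i. measure \<mu> {x. k x = i} = 0 \<longrightarrow> k x \<noteq> i" by (simp add: AE_all_countable)
  then show "AE x in \<mu>. measure \<mu> {y. k y = k x} > 0"
    by eventually_elim (metis measure_nonneg less_eq_real_def)
qed

text \<open>\<open>H\<close> is a density with respect to the product of the two laws: the pair of cells \<open>(i, j)\<close>
  receives \<open>H i j\<close> times the product of their masses.\<close>

lemma cell_density:
  fixes k :: "'a :: topological_space \<Rightarrow> nat" and P :: "'b measure" and P' :: "'c measure"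
  assumes P: "prob_space P" "Y \<in> P \<rightarrow>\<^sub>M borel" "distr P borel Y = \<mu>"
    and P': "prob_space P'" "Y' \<in> P' \<rightarrow>\<^sub>M borel" "distr P' borel Y' = \<nu>"
    and k [measurable]: "k \<in> measurable borel (count_space UNIV)" and kn: "\<And>x. k x < n"
    and H0: "\<And>i j. 0 \<le> H i j"
    and row: "\<And>i. i < n \<Longrightarrow> 0 < measure \<mu> {x. k x = i} \<Longrightarrow> (\<Sum>j<n. H i j * measure \<nu> {x. k x = j}) = 1"
    and col: "\<And>j. j < n \<Longrightarrow> 0 < measure \<nu> {x. k x = j} \<Longrightarrow> (\<Sum>i<n. H i j * measure \<mu> {x. k x = i}) = 1"
  shows "(\<lambda>z. ennreal (H (k (Y (fst z))) (k (Y' (snd z))))) \<in> borel_measurable (P \<Otimes>\<^sub>M P')"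
    and "AE w in P. (\<integral>\<^sup>+w'. ennreal (H (k (Y w)) (k (Y' w'))) \<partial>P') = 1"
    and "AE w' in P'. (\<integral>\<^sup>+w. ennreal (H (k (Y w)) (k (Y' w'))) \<partial>P) = 1"
proof -
  note [measurable] = P(2) P'(2)
  show "(\<lambda>z. ennreal (H (k (Y (fst z))) (k (Y' (snd z))))) \<in> borel_measurable (P \<Otimes>\<^sub>M P')"
    by measurable
  have p: "prob_space \<mu>" "sets \<mu> = sets borel" "prob_space \<nu>" "sets \<nu> = sets borel"
    using prob_space.prob_space_distr[OF P(1,2)] prob_space.prob_space_distr[OF P'(1,2)] P(3) P'(3)
    by auto
  note C = cell_integrals[OF p(1,2) k kn] and C' = cell_integrals[OF p(3,4) k kn]
  have i: "(\<integral>\<^sup>+w'. ennreal (F (k (Y' w'))) \<partial>P') = (\<integral>\<^sup>+y. ennreal (F (k y)) \<partial>\<nu>)"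
    "(\<integral>\<^sup>+w. ennreal (F (k (Y w))) \<partial>P) = (\<integral>\<^sup>+y. ennreal (F (k y)) \<partial>\<mu>)" for F :: "nat \<Rightarrow> real"
    unfolding P(3)[symmetric] P'(3)[symmetric] by (subst nn_integral_distr; measurable)+
  have "AE w in P. 0 < measure \<mu> {y. k y = k (Y w)}"
    using C(3) unfolding P(3)[symmetric] by (rule AE_distrD[OF P(2)])
  then show "AE w in P. (\<integral>\<^sup>+w'. ennreal (H (k (Y w)) (k (Y' w'))) \<partial>P') = 1"
    by eventually_elim (simp add: i(1) C'(2) H0 row kn)
  have "AE w in P'. 0 < measure \<nu> {y. k y = k (Y' w)}"
    using C'(3) unfolding P'(3)[symmetric] by (rule AE_distrD[OF P'(2)])
  then show "AE w' in P'. (\<integral>\<^sup>+w. ennreal (H (k (Y w)) (k (Y' w'))) \<partial>P) = 1"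
    by eventually_elim (simp add: i(2)[of "\<lambda>i. H i _"] C(2)[of "\<lambda>i. H i _"] H0 col kn)
qed

text \<open>Approximate gluing: the middle coordinates of the two couplings are only required to lie in
  the same cell of a fine partition, which avoids disintegration.\<close>

lemma wasserstein_triangle:
  fixes \<mu> \<nu> \<sigma> :: "('n :: finite) torus measure"
  assumes a: "a > 0"
    and \<mu>: "\<mu> \<in> space (prob_algebra borel)" and \<nu>: "\<nu> \<in> space (prob_algebra borel)"
    and \<sigma>: "\<sigma> \<in> space (prob_algebra borel)"
  shows "wasserstein (rho a) \<mu> \<sigma> \<le> wasserstein (rho a) \<mu> \<nu> + wasserstein (rho a) \<nu> \<sigma>"
proof (rule field_le_epsilon)
  fix e :: real assume "e > 0"
  then have e3: "e / 3 > 0" by simp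
  have s: "sets \<mu> = sets borel" "sets \<nu> = sets borel" "sets \<sigma> = sets borel"
    using \<mu> \<nu> \<sigma> by (auto simp: space_prob_algebra)
  obtain k :: "'n torus \<Rightarrow> nat" and n where k: "k \<in> measurable borel (count_space UNIV)"
    and kn: "\<And>x. k x < n" and kd: "\<And>x y. k x = k y \<Longrightarrow> dist x y \<le> e / 3"
    using torus_partition[OF e3] by metis
  obtain C where C: "C \<in> couplings \<mu> \<nu>"
      "(\<integral>z. rho a (fst z) (snd z) \<partial>C) < wasserstein (rho a) \<mu> \<nu> + e / 3"
    using wasserstein_approx[OF couplings_pair_measure[OF \<mu> \<nu>] e3] by metis
  obtain D where D: "D \<in> couplings \<nu> \<sigma>"
      "(\<integral>z. rho a (fst z) (snd z) \<partial>D) < wasserstein (rho a) \<nu> \<sigma> + e / 3"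
    using wasserstein_approx[OF couplings_pair_measure[OF \<nu> \<sigma>] e3] by metis
  note C' = couplingsD[OF C(1) s(1,2)] and D' = couplingsD[OF D(1) s(2,3)]
  note [measurable_cong] = C'(2) D'(2)
  \<comment> \<open>The two couplings become independent given that their middle coordinates share a
    cell. On a cell of mass 0 the value is \<open>1 / 0 = 0\<close>; such cells are almost surely
    avoided.\<close>
  define H where "H i j = (if i = j then 1 / measure \<nu> {x. k x = i} else 0)" for i j
  define h where "h z = ennreal (H (k (snd (fst z))) (k (fst (snd z))))"
    for z :: "('n torus \<times> 'n torus) \<times> ('n torus \<times> 'n torus)"
  have H: "0 \<le> H i j"
    "i < n \<Longrightarrow> 0 < measure \<nu> {x. k x = i} \<Longrightarrow> (\<Sum>j<n. H i j * measure \<nu> {x. k x = j}) = 1"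
    "i < n \<Longrightarrow> 0 < measure \<nu> {x. k x = i} \<Longrightarrow> (\<Sum>j<n. H j i * measure \<nu> {x. k x = j}) = 1" for i j
    by (simp_all add: H_def if_distrib[of "\<lambda>x. x * _"] cong: if_cong)
  note h = cell_density[where H = H, OF C'(1,6,4) D'(1,5,3) k kn H]
  have hm [measurable]: "h \<in> borel_measurable (C \<Otimes>\<^sub>M D)" unfolding h_def by (rule h(1))
  have h1: "AE z in C. (\<integral>\<^sup>+z'. h (z, z') \<partial>D) = 1" and h2: "AE z' in D. (\<integral>\<^sup>+z. h (z, z') \<partial>C) = 1"
    using h(2,3) by (simp_all add: h_def)
  note marg = nn_integral_pair_marginal[OF C'(1) D'(1) hm]
  define G where "G = distr (density (C \<Otimes>\<^sub>M D) h) (borel \<Otimes>\<^sub>M borel) (\<lambda>z. (fst (fst z), snd (snd z)))"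
  have G: "G \<in> couplings \<mu> \<sigma>"
    using density_in_couplings[OF C'(1) D'(1) C'(5) D'(6) hm h1 h2] by (simp add: C'(3) D'(4) G_def)
  let ?r = "\<lambda>x y. ennreal (rho a x y)"
  have "(\<integral>\<^sup>+z. ?r (fst z) (snd z) \<partial>G)
      = (\<integral>\<^sup>+z. h z * ?r (fst (fst z)) (snd (snd z)) \<partial>(C \<Otimes>\<^sub>M D))"
    unfolding G_def using nn_integral_density_coupling[OF C'(5) D'(6) hm, of "\<lambda>z. ?r (fst z) (snd z)"]
    by simp
  also have "\<dots> \<le> (\<integral>\<^sup>+z. h z * (?r (fst (fst z)) (snd (fst z)) + ennreal (e / 3))
      + h z * ?r (fst (snd z)) (snd (snd z)) \<partial>(C \<Otimes>\<^sub>M D))"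
  proof (intro nn_integral_mono)
    fix z :: "('n torus \<times> 'n torus) \<times> ('n torus \<times> 'n torus)"
    obtain x y y' u where z: "z = ((x, y), (y', u))" by (metis prod.collapse)
    show "h z * ?r (fst (fst z)) (snd (snd z)) \<le> h z * (?r (fst (fst z)) (snd (fst z)) + ennreal (e / 3))
      + h z * ?r (fst (snd z)) (snd (snd z))"
    \<comment> \<open>Where the cells differ \<open>h\<close> is 0. Where they agree, the jump
      between the middle points costs at most \<open>e / 3\<close>; the other two thirds of
      \<open>e\<close> go to the near optimal couplings \<open>C\<close> and
      \<open>D\<close>.\<close>
    proof (cases "k y = k y'")
      case True
      have "rho a x u \<le> rho a x y + e / 3 + rho a y' u"
        using rho_triangle[OF a, of x u y] rho_triangle[OF a, of y u y'] rho_le_dist[OF a, of y y'] kd[OF True]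
        by linarith
      then have "?r x u \<le> ?r x y + ennreal (e / 3) + ?r y' u"
        using \<open>e > 0\<close> by (simp add: ennreal_plus[symmetric] rho_nonneg[OF a] ennreal_leI del: ennreal_plus)
      then show ?thesis
        unfolding z distrib_left[symmetric] by (intro mult_left_mono) auto
    qed (simp add: z h_def H_def)
  qed
  also have "\<dots> = (\<integral>\<^sup>+z. h z * (?r (fst (fst z)) (snd (fst z)) + ennreal (e / 3)) \<partial>(C \<Otimes>\<^sub>M D))
      + (\<integral>\<^sup>+z. h z * ?r (fst (snd z)) (snd (snd z)) \<partial>(C \<Otimes>\<^sub>M D))"
    by (rule nn_integral_add) measurable
  also have "\<dots> = (\<integral>\<^sup>+z. ?r (fst z) (snd z) + ennreal (e / 3) \<partial>C) + (\<integral>\<^sup>+z. ?r (fst z) (snd z) \<partial>D)"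
    using marg(1)[OF h1, of "\<lambda>z. ?r (fst z) (snd z) + ennreal (e / 3)"] marg(2)[OF h2, of "\<lambda>z. ?r (fst z) (snd z)"]
    by simp
  also have "\<dots> = (\<integral>\<^sup>+z. ?r (fst z) (snd z) \<partial>C) + ennreal (e / 3) + (\<integral>\<^sup>+z. ?r (fst z) (snd z) \<partial>D)"
    by (subst nn_integral_add) (simp_all add: prob_space.emeasure_space_1[OF C'(1)])
  also have "\<dots> = ennreal ((\<integral>z. rho a (fst z) (snd z) \<partial>C) + e / 3 + (\<integral>z. rho a (fst z) (snd z) \<partial>D))"
    unfolding integral_rho_coupling(2)[OF a C'(1,2), symmetric] integral_rho_coupling(2)[OF a D'(1,2), symmetric]
    using \<open>e > 0\<close> by (simp add: Bochner_Integration.integral_nonneg rho_nonneg[OF a])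
  finally have "wasserstein (rho a) \<mu> \<sigma> \<le> (\<integral>z. rho a (fst z) (snd z) \<partial>C) + e / 3 + (\<integral>z. rho a (fst z) (snd z) \<partial>D)"
    using \<open>e > 0\<close> a
    by (intro wasserstein_rho_le[OF a G \<mu> \<sigma>]) (auto simp: Bochner_Integration.integral_nonneg rho_nonneg)
  then show "wasserstein (rho a) \<mu> \<sigma> \<le> wasserstein (rho a) \<mu> \<nu> + wasserstein (rho a) \<nu> \<sigma> + e"
    using C(2) D(2) by linarith
qed

text \<open>Mass common to both laws stays in its cell, the excess of \<open>\<mu>\<close> over \<open>\<nu>\<close> is
  sent independently to the cells where \<open>\<nu>\<close> exceeds \<open>\<mu>\<close>; the total excess is \<open>m\<close>.
  For \<open>m = 0\<close> the second summand of \<open>H\<close> is 0 because \<open>x / 0 = 0\<close>.\<close>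

lemma wasserstein_le_partition:
  fixes \<mu> \<nu> :: "('n :: finite) torus measure" and k :: "'n torus \<Rightarrow> nat"
  assumes "a > 0" "e \<ge> 0"
    and \<mu>: "\<mu> \<in> space (prob_algebra borel)" and \<nu>: "\<nu> \<in> space (prob_algebra borel)"
    and k [measurable]: "k \<in> measurable borel (count_space UNIV)"
    and kn: "\<And>x. k x < n" and kd: "\<And>x y. k x = k y \<Longrightarrow> dist x y \<le> e"
  shows "wasserstein (rho a) \<mu> \<nu>
    \<le> e + (\<Sum>i<n. \<bar>measure \<mu> {x. k x = i} - measure \<nu> {x. k x = i}\<bar>) / a"
proof -
  have P: "prob_space \<mu>" "sets \<mu> = sets borel" and P': "prob_space \<nu>" "sets \<nu> = sets borel"
    using \<mu> \<nu> by (auto simp: space_prob_algebra)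
  note [measurable_cong] = P(2) P'(2)
  note C = cell_integrals[OF P k kn] and C' = cell_integrals[OF P' k kn]
  define u where "u i = measure \<mu> {x. k x = i}" for i
  define v where "v i = measure \<nu> {x. k x = i}" for i
  have uv0: "u i \<ge> 0" "v i \<ge> 0" for i by (simp_all add: u_def v_def)
  have u1: "(\<Sum>i<n. u i) = 1" and v1: "(\<Sum>i<n. v i) = 1" using C(1) C'(1) by (simp_all add: u_def v_def)
  define p where "p i = max (u i - v i) 0" for i
  define q where "q i = max (v i - u i) 0" for i
  define m where "m = (\<Sum>i<n. p i)"
  have pq0: "p i \<ge> 0" "q i \<ge> 0" for i by (simp_all add: p_def q_def)
  have m0: "m \<ge> 0" unfolding m_def by (intro sum_nonneg pq0)
  \<comment> \<open>Both laws have total mass 1, so the excesses in the two directions have the same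
    total.\<close>
  have "m - (\<Sum>i<n. q i) = (\<Sum>i<n. u i - v i)"
    unfolding m_def sum_subtractf[symmetric] by (intro sum.cong) (auto simp: p_def q_def max_def)
  then have mq: "(\<Sum>i<n. q i) = m" by (simp add: sum_subtractf u1 v1)
  \<comment> \<open>The first term is \<open>min (u i) (v i) / (u i * v i)\<close>, the density of
    the common mass. The second is \<open>m\<close> times the density of the product of the
    normalised excesses \<open>p / m\<close> and \<open>q / m\<close>.\<close>
  define H where "H i j = (if i = j then 1 / max (u i) (v i) else 0) + p i * q j / (u i * v j * m)" for i j
  have H0: "H i j \<ge> 0" for i j
    unfolding H_def using uv0 pq0 m0 by (intro add_nonneg_nonneg divide_nonneg_nonneg mult_nonneg_nonneg) (auto simp: max_def)
  \<comment> \<open>If \<open>m = 0\<close>, division by \<open>m\<close> yields 0, but then all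
    excesses vanish too, so the marginal sums below are right in this case as well.\<close>
  have pz: "p i = 0" if "m = 0" "i < n" for i
    using that pq0 unfolding m_def by (subst (asm) sum_nonneg_eq_0_iff) auto
  have qz: "q i = 0" if "m = 0" "i < n" for i
    using that pq0 mq by (subst (asm) (2) eq_commute) (simp add: sum_nonneg_eq_0_iff)
  have row: "(\<Sum>j<n. H i j * v j) = 1" if "i < n" "u i > 0" for i
  proof -
    have "(\<Sum>j<n. p i * q j / (u i * v j * m) * v j) = (\<Sum>j<n. p i / (u i * m) * q j)"
    proof (rule sum.cong)
      fix j
      \<comment> \<open>A cell without \<open>\<nu>\<close>-mass has no excess of
        \<open>\<nu>\<close>, so cancelling \<open>v j\<close> is harmless even when it is
        0.\<close>
      have "q j = 0" if "v j = 0" using that uv0[of j] by (simp add: q_def)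
      then show "p i * q j / (u i * v j * m) * v j = p i / (u i * m) * q j"
        by (cases "v j = 0") auto
    qed simp
    also have "\<dots> = p i / (u i * m) * m" by (simp only: sum_distrib_left[symmetric] mq)
    also have "\<dots> = p i / u i" using pz[OF _ \<open>i < n\<close>] by (cases "m = 0") auto
    finally have "(\<Sum>j<n. H i j * v j) = v i / max (u i) (v i) + p i / u i"
      using \<open>i < n\<close> by (simp add: H_def distrib_right sum.distrib if_distrib[of "\<lambda>x. x * _"] cong: if_cong)
    also have "\<dots> = 1" using that(2) uv0[of i] by (auto simp: p_def max_def field_simps)
    finally show ?thesis .
  qed
  have col: "(\<Sum>i<n. H i j * u i) = 1" if "j < n" "v j > 0" for j
  proof -
    have "(\<Sum>i<n. p i * q j / (u i * v j * m) * u i) = (\<Sum>i<n. q j / (v j * m) * p i)"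
    proof (rule sum.cong)
      fix i
      have "p i = 0" if "u i = 0" using that uv0[of i] by (simp add: p_def)
      then show "p i * q j / (u i * v j * m) * u i = q j / (v j * m) * p i"
        by (cases "u i = 0") auto
    qed simp
    also have "\<dots> = q j / (v j * m) * m" by (simp only: sum_distrib_left[symmetric] m_def)
    also have "\<dots> = q j / v j" using qz[OF _ \<open>j < n\<close>] by (cases "m = 0") auto
    finally have "(\<Sum>i<n. H i j * u i) = u j / max (u j) (v j) + q j / v j"
      using \<open>j < n\<close> by (simp add: H_def distrib_right sum.distrib if_distrib[of "\<lambda>x. x * _"] cong: if_cong)
    also have "\<dots> = 1" using that(2) uv0[of j] by (auto simp: q_def max_def field_simps)
    finally show ?thesis .
  qed
  have id: "(\<lambda>x. x) \<in> \<mu> \<rightarrow>\<^sub>M borel" "(\<lambda>x. x) \<in> \<nu> \<rightarrow>\<^sub>M borel" by measurable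
  have idd: "distr \<mu> borel (\<lambda>x. x) = \<mu>" "distr \<nu> borel (\<lambda>x. x) = \<nu>" using P P' by (simp_all add: distr_id2)
  define h where "h z = ennreal (H (k (fst z)) (k (snd z)))" for z :: "'n torus \<times> 'n torus"
  note h = cell_density[where H = H, OF P(1) id(1) idd(1) P'(1) id(2) idd(2) k kn H0, folded u_def v_def, OF row col]
  have hm [measurable]: "h \<in> borel_measurable (\<mu> \<Otimes>\<^sub>M \<nu>)" unfolding h_def by (rule h(1))
  have h1: "AE x in \<mu>. (\<integral>\<^sup>+y. h (x, y) \<partial>\<nu>) = 1" and h2: "AE y in \<nu>. (\<integral>\<^sup>+x. h (x, y) \<partial>\<mu>) = 1"
    using h(2,3) by (simp_all add: h_def)
  define G where "G = distr (density (\<mu> \<Otimes>\<^sub>M \<nu>) h) (borel \<Otimes>\<^sub>M borel) (\<lambda>z. (fst z, snd z))"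
  have G: "G \<in> couplings \<mu> \<nu>"
    using density_in_couplings[OF P(1) P'(1) id hm h1 h2] by (simp add: idd G_def)
  \<comment> \<open>Only mass that changes its cell is charged \<open>1 / a\<close>, the maximum of
    \<open>rho\<close>; pairs within one cell cost at most \<open>e\<close>.\<close>
  define H' where "H' i j = (if i = j then 0 else H i j)" for i j
  have H'0: "H' i j \<ge> 0" for i j by (simp add: H'_def H0)
  have cost: "(\<Sum>i<n. (\<Sum>j<n. H' i j * v j) * u i) \<le> m"
  proof -
    have "(\<Sum>j<n. H' i j * v j) * u i \<le> p i" if "i < n" for i
    proof -
      have "(\<Sum>j<n. H' i j * v j) \<le> (\<Sum>j<n. p i / (u i * m) * q j)"
      proof (rule sum_mono)
        fix j
        have "q j = 0" if "v j = 0" using that uv0[of j] by (simp add: q_def)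
        moreover have "p i / (u i * m) * q j \<ge> 0"
          using uv0 pq0 m0 by (intro mult_nonneg_nonneg divide_nonneg_nonneg) auto
        ultimately show "H' i j * v j \<le> p i / (u i * m) * q j"
          by (cases "v j = 0") (auto simp: H'_def H_def)
      qed
      also have "\<dots> = p i / (u i * m) * m" by (simp only: sum_distrib_left[symmetric] mq)
      finally have "(\<Sum>j<n. H' i j * v j) * u i \<le> p i / (u i * m) * m * u i"
        using uv0 by (intro mult_right_mono) auto
      also have "\<dots> \<le> p i" using pq0[of i] by (cases "m = 0"; cases "u i = 0") auto
      finally show ?thesis .
    qed
    then show ?thesis unfolding m_def by (intro sum_mono) auto
  qed
  have "(\<integral>\<^sup>+z. ennreal (rho a (fst z) (snd z)) \<partial>G) = (\<integral>\<^sup>+z. h z * ennreal (rho a (fst z) (snd z)) \<partial>(\<mu> \<Otimes>\<^sub>M \<nu>))"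
    unfolding G_def using nn_integral_density_coupling[OF id hm, of "\<lambda>z. ennreal (rho a (fst z) (snd z))"]
    by simp
  also have "\<dots> \<le> (\<integral>\<^sup>+z. h z * ennreal e + ennreal (1 / a) * ennreal (H' (k (fst z)) (k (snd z))) \<partial>(\<mu> \<Otimes>\<^sub>M \<nu>))"
  proof (intro nn_integral_mono)
    fix z :: "'n torus \<times> 'n torus"
    show "h z * ennreal (rho a (fst z) (snd z)) \<le> h z * ennreal e
        + ennreal (1 / a) * ennreal (H' (k (fst z)) (k (snd z)))"
    proof (cases "k (fst z) = k (snd z)")
      case True
      then have "rho a (fst z) (snd z) \<le> e"
        using rho_le_dist[OF \<open>a > 0\<close>, of "fst z" "snd z"] kd by (meson order_trans)
      then show ?thesis using True by (simp add: H'_def mult_left_mono ennreal_leI)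
    next
      case False
      have "h z * ennreal (rho a (fst z) (snd z)) \<le> h z * ennreal (1 / a)"
        by (intro mult_left_mono ennreal_leI rho_le_inverse[OF \<open>a > 0\<close>]) auto
      also have "\<dots> \<le> h z * ennreal e + h z * ennreal (1 / a)" by simp
      finally show ?thesis using False by (simp add: h_def H'_def mult.commute)
    qed
  qed
  also have "\<dots> = (\<integral>\<^sup>+z. h z * ennreal e \<partial>(\<mu> \<Otimes>\<^sub>M \<nu>))
      + ennreal (1 / a) * (\<integral>\<^sup>+z. ennreal (H' (k (fst z)) (k (snd z))) \<partial>(\<mu> \<Otimes>\<^sub>M \<nu>))"
    by (simp add: nn_integral_add nn_integral_cmult)
  also have "(\<integral>\<^sup>+z. h z * ennreal e \<partial>(\<mu> \<Otimes>\<^sub>M \<nu>)) = ennreal e"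
    using nn_integral_pair_marginal(1)[OF P(1) P'(1) hm h1, of "\<lambda>_. ennreal e"] P(1)
    by (simp add: prob_space.emeasure_space_1)
  also have "(\<integral>\<^sup>+z. ennreal (H' (k (fst z)) (k (snd z))) \<partial>(\<mu> \<Otimes>\<^sub>M \<nu>))
      = ennreal (\<Sum>i<n. (\<Sum>j<n. H' i j * v j) * u i)"
  proof -
    interpret P': prob_space \<nu> by (rule P')
    have "(\<integral>\<^sup>+z. ennreal (H' (k (fst z)) (k (snd z))) \<partial>(\<mu> \<Otimes>\<^sub>M \<nu>))
        = (\<integral>\<^sup>+x. (\<integral>\<^sup>+y. ennreal (H' (k x) (k y)) \<partial>\<nu>) \<partial>\<mu>)"
      by (subst P'.nn_integral_fst[symmetric], measurable)
    also have "\<dots> = (\<integral>\<^sup>+x. ennreal (\<Sum>j<n. H' (k x) j * v j) \<partial>\<mu>)"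
      unfolding v_def by (intro nn_integral_cong C'(2)) (simp add: H'0)
    also have "\<dots> = ennreal (\<Sum>i<n. (\<Sum>j<n. H' i j * v j) * u i)"
      unfolding u_def by (intro C(2) sum_nonneg mult_nonneg_nonneg) (auto simp: H'0 uv0)
    finally show ?thesis .
  qed
  also have "ennreal e + ennreal (1 / a) * ennreal (\<Sum>i<n. (\<Sum>j<n. H' i j * v j) * u i)
      \<le> ennreal e + ennreal (1 / a) * ennreal m"
    by (intro add_left_mono mult_left_mono ennreal_leI cost) auto
  also have "\<dots> = ennreal (e + m / a)"
    using \<open>a > 0\<close> \<open>e \<ge> 0\<close> m0 by (simp add: ennreal_mult[symmetric] ennreal_plus[symmetric] del: ennreal_plus)
  finally have "wasserstein (rho a) \<mu> \<nu> \<le> e + m / a"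
    using \<open>a > 0\<close> \<open>e \<ge> 0\<close> m0 by (intro wasserstein_rho_le[OF \<open>a > 0\<close> G \<mu> \<nu>]) auto
  \<comment> \<open>\<open>m\<close> is half of this sum; the factor is given away.\<close>
  also have "m \<le> (\<Sum>i<n. \<bar>u i - v i\<bar>)"
    unfolding m_def by (intro sum_mono) (auto simp: p_def max_def)
  then have "e + m / a \<le> e + (\<Sum>i<n. \<bar>u i - v i\<bar>) / a"
    using \<open>a > 0\<close> by (simp add: divide_right_mono)
  finally show ?thesis by (simp add: u_def v_def)
qed

section \<open>Transition kernels and rejection sampling\<close>

text \<open>The density factors over \<open>Basis\<close> into one-dimensional standard normal
  densities, so the total mass is a product of ones.\<close>

lemma prob_space_std_gauss: "prob_space (std_gauss :: (real ^ ('n :: finite)) measure)"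
proof (rule prob_spaceI)
  let ?c = "(2 * pi) powr (- real CARD('n) / 2)"
  have "1 / sqrt (2 * pi) = (2 * pi) powr (- (1 / 2))"
    by (simp add: powr_minus_divide powr_half_sqrt)
  then have c: "?c = (\<Prod>b\<in>(Basis :: (real ^ 'n) set). 1 / sqrt (2 * pi))"
    by (simp only: prod_constant) (simp add: powr_power)
  have e: "?c * exp (- (norm y)\<^sup>2 / 2) = (\<Prod>b\<in>Basis. std_normal_density (y \<bullet> b))" for y :: "real ^ 'n"
  proof -
    have "(norm y)\<^sup>2 = (\<Sum>b\<in>Basis. (y \<bullet> b) * (y \<bullet> b))"
      unfolding power2_norm_eq_inner by (rule euclidean_inner)
    then have "- (norm y)\<^sup>2 / 2 = (\<Sum>b\<in>Basis. - (y \<bullet> b)\<^sup>2 / 2)"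
      by (simp only: sum_negf[symmetric] sum_divide_distrib power2_eq_square)
    then have "exp (- (norm y)\<^sup>2 / 2) = (\<Prod>b\<in>Basis. exp (- (y \<bullet> b)\<^sup>2 / 2))"
      by (simp only: exp_sum[OF finite_Basis])
    then show ?thesis
      unfolding c std_normal_density_def by (simp only: prod.distrib)
  qed
  have "emeasure (std_gauss :: (real ^ 'n) measure) (space std_gauss)
      = (\<integral>\<^sup>+y. ennreal (?c * exp (- (norm (y :: real ^ 'n))\<^sup>2 / 2)) \<partial>lborel)"
    unfolding std_gauss_def by (subst emeasure_density) (auto simp: space_density)
  also have "\<dots> = (\<integral>\<^sup>+y. (\<Prod>b\<in>Basis. ennreal (std_normal_density ((y :: real ^ 'n) \<bullet> b))) \<partial>lborel)"
    unfolding e by (simp add: prod_ennreal)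
  also have "\<dots> = (\<Prod>b\<in>(Basis :: (real ^ 'n) set). \<integral>\<^sup>+x. ennreal (std_normal_density x) \<partial>lborel)"
    by (subst nn_integral_lborel_prod) auto
  also have "(\<integral>\<^sup>+x. ennreal (std_normal_density x) \<partial>lborel) = 1"
    by (subst nn_integral_eq_integral) auto
  finally show "emeasure (std_gauss :: (real ^ 'n) measure) (space std_gauss) = 1" by simp
qed

lemma sets_std_gauss [simp, measurable_cong]: "sets std_gauss = sets borel"
  by (simp add: std_gauss_def)

lemma measurable_torus_lipschitz:
  assumes "C-lipschitz_on UNIV b"
  shows "b \<in> borel_measurable borel"
  by (intro borel_measurable_continuous_onI lipschitz_on_continuous_on[OF assms])

lemma measurable_kernel_K:
  fixes b :: "('n :: finite) torus \<Rightarrow> real ^ 'n"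
  assumes [measurable]: "b \<in> borel_measurable borel"
  shows "kernel_K b \<gamma> \<in> borel \<rightarrow>\<^sub>M prob_algebra borel"
  unfolding kernel_K_def
proof (rule measurable_distr_prob_space2)
  show "(\<lambda>x. std_gauss) \<in> borel \<rightarrow>\<^sub>M prob_algebra (borel :: (real ^ 'n) measure)"
    by (intro measurable_const) (simp add: space_prob_algebra prob_space_std_gauss)
qed measurable

lemma prob_space_kernel_K:
  assumes "b \<in> borel_measurable borel"
  shows "prob_space (kernel_K b \<gamma> x)" "sets (kernel_K b \<gamma> x) = sets borel"
  using measurable_space[OF measurable_kernel_K[OF assms], of x \<gamma>] by (auto simp: space_prob_algebra)

text \<open>Weights and indicators take values in [0, 1]; integrability, bounds and the passage to
  \<open>ennreal\<close> are settled here for all of them.\<close>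

lemma integral_01:
  assumes "prob_space M" "g \<in> borel_measurable M" "\<And>x. 0 \<le> g x" "\<And>x. g x \<le> (1 :: real)"
  shows "integrable M g" "0 \<le> integral\<^sup>L M g" "integral\<^sup>L M g \<le> 1"
    "ennreal (integral\<^sup>L M g) = (\<integral>\<^sup>+x. ennreal (g x) \<partial>M)"
proof -
  interpret prob_space M by fact
  show i: "integrable M g"
    by (rule integrable_const_bound[of _ 1]) (use assms in auto)
  show "0 \<le> integral\<^sup>L M g" using assms by simp
  have "integral\<^sup>L M g \<le> integral\<^sup>L M (\<lambda>_. 1)" using i assms by (intro integral_mono) auto
  then show "integral\<^sup>L M g \<le> 1" by (simp add: prob_space)
  show "ennreal (integral\<^sup>L M g) = (\<integral>\<^sup>+x. ennreal (g x) \<partial>M)"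
    using nn_integral_eq_integral[OF i] assms by simp
qed

lemma integral_bind_01:
  assumes M: "M \<in> space (prob_algebra N)" and K: "K \<in> N \<rightarrow>\<^sub>M prob_algebra S"
    and g [measurable]: "g \<in> borel_measurable S" and "\<And>x. 0 \<le> g x" "\<And>x. g x \<le> (1 :: real)"
  shows "(\<integral>x. g x \<partial>(M \<bind> K)) = (\<integral>x. \<integral>y. g y \<partial>K x \<partial>M)"
    and "(\<lambda>x. \<integral>y. g y \<partial>K x) \<in> borel_measurable N"
    and "M \<bind> K \<in> space (prob_algebra S)"
proof -
  have [measurable_cong]: "sets M = sets N" and pM: "prob_space M" using M by (auto simp: space_prob_algebra)
  note [measurable] = measurable_prob_algebraD[OF K]
  show BK: "M \<bind> K \<in> space (prob_algebra S)"
  proof -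
    have "K \<in> M \<rightarrow>\<^sub>M prob_algebra S" using K by measurable
    then show ?thesis using pM
      by (auto simp: space_prob_algebra intro!: prob_space_bind'[of M N] sets_bind' M K)
  qed
  show m [measurable]: "(\<lambda>x. \<integral>y. g y \<partial>K x) \<in> borel_measurable N" by measurable
  have Kx: "prob_space (K x)" "sets (K x) = sets S" if "x \<in> space M" for x
    using measurable_space[OF K, of x] that sets_eq_imp_space_eq[OF \<open>sets M = sets N\<close>]
    by (auto simp: space_prob_algebra)
  have e: "ennreal (\<integral>y. g y \<partial>K x) = (\<integral>\<^sup>+y. ennreal (g y) \<partial>K x)"
    and b: "0 \<le> (\<integral>y. g y \<partial>K x)" "(\<integral>y. g y \<partial>K x) \<le> 1" if "x \<in> space M" for x
    using integral_01[OF Kx(1)[OF that], of g] assms Kx(2)[OF that]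
    by (auto cong: measurable_cong_sets)
  have "ennreal (\<integral>x. g x \<partial>(M \<bind> K)) = (\<integral>\<^sup>+x. ennreal (g x) \<partial>(M \<bind> K))"
    using BK assms by (intro integral_01) (auto simp: space_prob_algebra cong: measurable_cong_sets)
  also have "\<dots> = (\<integral>\<^sup>+x. \<integral>\<^sup>+y. ennreal (g y) \<partial>K x \<partial>M)"
    by (rule nn_integral_bind[where B=S]) measurable
  also have "\<dots> = (\<integral>\<^sup>+x. ennreal (\<integral>y. g y \<partial>K x) \<partial>M)"
    by (intro nn_integral_cong) (simp add: e)
  also have "\<dots> = ennreal (\<integral>x. \<integral>y. g y \<partial>K x \<partial>M)"
  proof (rule nn_integral_eq_integral)
    interpret prob_space M by fact
    show "integrable M (\<lambda>x. \<integral>y. g y \<partial>K x)"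
      by (rule integrable_const_bound[of _ 1]) (use b in \<open>auto intro!: AE_I2\<close>)
    show "AE x in M. 0 \<le> (\<integral>y. g y \<partial>K x)" using b by auto
  qed
  finally show "(\<integral>x. g x \<partial>(M \<bind> K)) = (\<integral>x. \<integral>y. g y \<partial>K x \<partial>M)"
    using assms b by (subst (asm) ennreal_inj) (auto intro!: Bochner_Integration.integral_nonneg)
qed

section \<open>Rejection sampling with a uniform threshold\<close>

lemma measure_uniform_01:
  assumes "0 \<le> c" "c \<le> 1"
  shows "emeasure (uniform_measure lborel {0..1 :: real}) {u. u < c} = ennreal c"
    "emeasure (uniform_measure lborel {0..1 :: real}) {u. c \<le> u} = ennreal (1 - c)"
proof -
  have "{0..1} \<inter> {u. u < c} = {0..<c}" "{0..1} \<inter> {u. c \<le> u} = {c..1}" using assms by auto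
  moreover have "{u. u < c} = {..<c}" "{u. c \<le> u} = {c..}" by auto
  ultimately show "emeasure (uniform_measure lborel {0..1 :: real}) {u. u < c} = ennreal c"
    "emeasure (uniform_measure lborel {0..1 :: real}) {u. c \<le> u} = ennreal (1 - c)"
    using assms by (simp_all add: divide_ennreal_def)
qed

lemma prob_space_uniform_01: "prob_space (uniform_measure lborel {0..1 :: real})"
  by (rule prob_space_uniform_measure) auto

text \<open>Integrating out the uniform variable first turns rejection into the weight
  \<open>p\<close> and acceptance into the weight \<open>1 - p\<close>.\<close>

lemma emeasure_pair_threshold:
  assumes "prob_space N" "p \<in> borel_measurable N" "\<And>x. 0 \<le> p x" "\<And>x. p x \<le> 1" "A \<in> sets N"
  shows "emeasure (N \<Otimes>\<^sub>M uniform_measure lborel {0..1 :: real}) {z \<in> space (N \<Otimes>\<^sub>M borel). snd z < p (fst z)}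
      = ennreal (\<integral>x. p x \<partial>N)" (is ?reject)
    "emeasure (N \<Otimes>\<^sub>M uniform_measure lborel {0..1 :: real})
      {z \<in> space (N \<Otimes>\<^sub>M borel). fst z \<in> A \<and> p (fst z) \<le> snd z}
      = ennreal (\<integral>x. indicator A x * (1 - p x) \<partial>N)" (is ?accept)
proof -
  let ?U = "uniform_measure lborel {0..1 :: real}"
  note [measurable] = assms(2,5)
  interpret U: prob_space ?U by (rule prob_space_uniform_01)
  have s: "sets (N \<Otimes>\<^sub>M ?U) = sets (N \<Otimes>\<^sub>M borel)" by (intro sets_pair_measure_cong) auto
  have "emeasure (N \<Otimes>\<^sub>M ?U) {z \<in> space (N \<Otimes>\<^sub>M borel). snd z < p (fst z)}
      = (\<integral>\<^sup>+x. emeasure ?U (Pair x -` {z \<in> space (N \<Otimes>\<^sub>M borel). snd z < p (fst z)}) \<partial>N)"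
    by (rule U.emeasure_pair_measure_alt) (unfold s, measurable)
  also have "\<dots> = (\<integral>\<^sup>+x. ennreal (p x) \<partial>N)"
  proof (rule nn_integral_cong)
    fix x assume "x \<in> space N"
    then have "Pair x -` {z \<in> space (N \<Otimes>\<^sub>M borel). snd z < p (fst z)} = {u. u < p x}"
      by (auto simp: space_pair_measure)
    then show "emeasure ?U (Pair x -` {z \<in> space (N \<Otimes>\<^sub>M borel). snd z < p (fst z)}) = ennreal (p x)"
      using measure_uniform_01(1)[of "p x"] assms by simp
  qed
  also have "\<dots> = ennreal (\<integral>x. p x \<partial>N)" using integral_01(4)[OF assms(1-4)] by simp
  finally show ?reject .
  have "emeasure (N \<Otimes>\<^sub>M ?U) {z \<in> space (N \<Otimes>\<^sub>M borel). fst z \<in> A \<and> p (fst z) \<le> snd z}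
      = (\<integral>\<^sup>+x. emeasure ?U (Pair x -` {z \<in> space (N \<Otimes>\<^sub>M borel). fst z \<in> A \<and> p (fst z) \<le> snd z}) \<partial>N)"
    by (rule U.emeasure_pair_measure_alt) (unfold s, measurable)
  also have "\<dots> = (\<integral>\<^sup>+x. ennreal (indicator A x * (1 - p x)) \<partial>N)"
  proof (rule nn_integral_cong)
    fix x assume "x \<in> space N"
    then have "Pair x -` {z \<in> space (N \<Otimes>\<^sub>M borel). fst z \<in> A \<and> p (fst z) \<le> snd z}
        = (if x \<in> A then {u. p x \<le> u} else {})"
      by (auto simp: space_pair_measure)
    then show "emeasure ?U (Pair x -` {z \<in> space (N \<Otimes>\<^sub>M borel). fst z \<in> A \<and> p (fst z) \<le> snd z})
        = ennreal (indicator A x * (1 - p x))"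
      using measure_uniform_01(2)[of "p x"] assms by simp
  qed
  also have "\<dots> = ennreal (\<integral>x. indicator A x * (1 - p x) \<partial>N)"
    by (rule integral_01(4)[OF assms(1), symmetric]) (use assms in \<open>auto simp: indicator_def\<close>)
  finally show ?accept .
qed

text \<open>The events that the \<open>k\<close>-th proposal is the first accepted one and lies in \<open>A\<close> are disjoint
  cylinders. Summing their probabilities gives lower bounds for \<open>A\<close> and for its complement, and
  these add up to 1, so no separate argument is needed for the event that nothing is accepted.\<close>

lemma measure_rejection_sampling:
  fixes N0 N1 :: "'a :: topological_space measure" and p :: "'a \<Rightarrow> real"
  defines "U \<equiv> uniform_measure lborel {0..1 :: real}"
  defines "D \<equiv> distr (PiM (UNIV :: nat set) (\<lambda>k. (if k = 0 then N0 else N1) \<Otimes>\<^sub>M U)) borel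
      (\<lambda>\<omega>. fst (\<omega> (LEAST k. snd (\<omega> k) \<ge> p (fst (\<omega> k)))))"
  assumes N: "N0 \<in> space (prob_algebra borel)" "N1 \<in> space (prob_algebra borel)"
    and p [measurable]: "p \<in> borel_measurable borel" and p01: "\<And>x. 0 \<le> p x" "\<And>x. p x \<le> 1"
    and less1: "(\<integral>x. p x \<partial>N1) < 1" and A: "A \<in> sets borel"
  shows "measure D A = (\<integral>x. indicator A x * (1 - p x) \<partial>N0)
      + (\<integral>x. p x \<partial>N0) * (\<integral>x. indicator A x * (1 - p x) \<partial>N1) / (1 - (\<integral>x. p x \<partial>N1))"
    and "prob_space D"
proof -
  have s [measurable_cong]: "sets N0 = sets borel" "sets N1 = sets borel"
    and P: "prob_space N0" "prob_space N1" using N by (auto simp: space_prob_algebra)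
  have sp: "space N0 = UNIV" "space N1 = UNIV" using s by (auto dest: sets_eq_imp_space_eq)
  define F where "F k = (if k = 0 then N0 else N1)" for k :: nat
  have F: "prob_space (F k)" "sets (F k) = sets borel" "space (F k) = UNIV" for k
    using P s sp by (auto simp: F_def)
  have pU: "prob_space U" unfolding U_def by (rule prob_space_uniform_01)
  have sU: "sets U = sets borel" by (simp add: U_def)
  define M where "M = PiM (UNIV :: nat set) (\<lambda>k. F k \<Otimes>\<^sub>M U)"
  have sF: "sets (F k \<Otimes>\<^sub>M U) = sets (borel \<Otimes>\<^sub>M borel)" for k
    using F sU by (intro sets_pair_measure_cong) auto
  have pFU: "prob_space (F k \<Otimes>\<^sub>M U)" for k by (intro prob_space_pair F pU)
  then have pM: "prob_space M" unfolding M_def by (intro prob_space_PiM)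
  interpret M: prob_space M by (rule pM)
  have sM: "sets M = sets (PiM (UNIV :: nat set) (\<lambda>k. (borel :: 'a measure) \<Otimes>\<^sub>M (borel :: real measure)))"
    unfolding M_def by (intro sets_PiM_cong sF refl)
  note [measurable_cong] = sM
  define H where "H \<omega> = (LEAST k. snd (\<omega> k) \<ge> p (fst (\<omega> k)))" for \<omega> :: "nat \<Rightarrow> 'a \<times> real"
  have H [measurable]: "H \<in> M \<rightarrow>\<^sub>M count_space UNIV" unfolding H_def by measurable
  define T where "T \<omega> = fst (\<omega> (H \<omega>))" for \<omega> :: "nat \<Rightarrow> 'a \<times> real"
  have T [measurable]: "T \<in> M \<rightarrow>\<^sub>M borel"
    unfolding T_def by (rule measurable_compose_countable[of "\<lambda>k \<omega>. fst (\<omega> k)", OF _ H]) measurable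
  have D: "D = distr M borel T"
    unfolding D_def M_def F_def T_def H_def ..
  show pD: "prob_space D" unfolding D by (rule M.prob_space_distr[OF T])
  interpret D: prob_space D by (rule pD)
  define r where "r k = (\<integral>x. p x \<partial>F k)" for k
  define acc where "acc B k = (\<integral>x. indicator B x * (1 - p x) \<partial>F k)" for B k
  have r01: "0 \<le> r k" "r k \<le> 1" for k
    unfolding r_def using p01 F integral_01(2,3)[OF F(1), of p k] by (auto cong: measurable_cong_sets)
  have acc0: "0 \<le> acc B k" for B k
    unfolding acc_def using p01 by (intro Bochner_Integration.integral_nonneg) auto
  define Ev where "Ev B k = {\<omega> \<in> space M. fst (\<omega> k) \<in> B \<and> p (fst (\<omega> k)) \<le> snd (\<omega> k)
      \<and> (\<forall>j<k. snd (\<omega> j) < p (fst (\<omega> j)))}" for B k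
  have Evm: "Ev B k \<in> sets M" if [measurable]: "B \<in> sets borel" for B k
    unfolding Ev_def by measurable
  have HEv: "H \<omega> = k" if "\<omega> \<in> Ev B k" for \<omega> B k
    using that unfolding H_def Ev_def by (intro Least_equality) (auto simp: not_less[symmetric])
  have emEv: "emeasure M (Ev B k) = ennreal (acc B k * (\<Prod>j<k. r j))" if B [measurable]: "B \<in> sets borel" for B k
  proof -
    define X where "X j = (if j < k then {z. snd z < p (fst z)} else {z. fst z \<in> B \<and> p (fst z) \<le> snd z})" for j
    have spF: "space (F j \<Otimes>\<^sub>M borel) = UNIV" for j by (simp add: space_pair_measure F)
    have spM: "space M = UNIV"
      using sets_eq_imp_space_eq[OF sM] by (simp add: space_PiM space_pair_measure PiE_UNIV_domain)
    have "Ev B k = prod_emb UNIV (\<lambda>k. F k \<Otimes>\<^sub>M U) {..k} (Pi\<^sub>E {..k} X)"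
      unfolding Ev_def X_def prod_emb_def
      by (auto simp: spM space_pair_measure F space_PiM PiE_UNIV_domain PiE_iff
          sets_eq_imp_space_eq[OF sU] Pi_iff le_less split: if_splits)
    also have "emeasure M \<dots> = (\<Prod>j\<in>{..k}. emeasure (F j \<Otimes>\<^sub>M U) (X j))"
      unfolding M_def
    proof (rule emeasure_PiM_emb)
      fix j assume "j \<in> {..k}"
      have "{z \<in> space (borel \<Otimes>\<^sub>M borel). snd z < p (fst z)} \<in> sets (borel \<Otimes>\<^sub>M borel)"
        "{z \<in> space (borel \<Otimes>\<^sub>M borel). fst z \<in> B \<and> p (fst z) \<le> snd z} \<in> sets (borel \<Otimes>\<^sub>M borel)"
        by measurable
      then show "X j \<in> sets (F j \<Otimes>\<^sub>M U)" by (simp add: X_def sF space_pair_measure)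
    qed (auto intro: pFU)
    also have "\<dots> = emeasure (F k \<Otimes>\<^sub>M U) (X k) * (\<Prod>j<k. emeasure (F j \<Otimes>\<^sub>M U) (X j))"
      by (simp add: lessThan_Suc_atMost[symmetric] mult.commute)
    also have "emeasure (F k \<Otimes>\<^sub>M U) (X k) = ennreal (acc B k)"
      using emeasure_pair_threshold(2)[OF F(1), of p k B] F(2) B p01
      by (simp add: X_def spF U_def acc_def cong: measurable_cong_sets)
    also have "(\<Prod>j<k. emeasure (F j \<Otimes>\<^sub>M U) (X j)) = (\<Prod>j<k. ennreal (r j))"
      using emeasure_pair_threshold(1)[OF F(1), of p _ B] F(2) B p01
      by (intro prod.cong) (simp_all add: X_def spF U_def r_def cong: measurable_cong_sets)
    finally show ?thesis by (simp add: prod_ennreal r01 ennreal_mult acc0 prod_nonneg)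
  qed
  \<comment> \<open>The sum of the series of acceptance probabilities: the first proposal has law
    \<open>N0\<close>, and after its rejection the remaining ones are iid with law
    \<open>N1\<close>, which gives a geometric series of ratio \<open>r 1\<close>.\<close>
  define q where "q B = acc B 0 + r 0 * acc B 1 / (1 - r 1)" for B
  have r1: "r 1 < 1" using less1 by (simp add: r_def F_def)
  have sums: "(\<lambda>k. acc B k * (\<Prod>j<k. r j)) sums q B" for B
  proof -
    have "(\<lambda>k. (r 0 * acc B 1) * r 1 ^ k) sums ((r 0 * acc B 1) * (1 / (1 - r 1)))"
      using r1 r01[of 1] by (intro sums_mult geometric_sums) simp
    moreover have "acc B (Suc k) * (\<Prod>j<Suc k. r j) = (r 0 * acc B 1) * r 1 ^ k" for k
    proof -
      have "(\<Prod>j<Suc k. r j) = r 0 * (\<Prod>j<k. r (Suc j))"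
        by (simp add: prod.lessThan_Suc_shift del: prod.lessThan_Suc)
      also have "(\<Prod>j<k. r (Suc j)) = r 1 ^ k" by (simp add: r_def F_def)
      finally show ?thesis by (simp add: acc_def F_def)
    qed
    ultimately have "(\<lambda>k. acc B (Suc k) * (\<Prod>j<Suc k. r j)) sums (r 0 * acc B 1 / (1 - r 1))"
      by simp
    from sums_Suc[OF this] show ?thesis by (simp add: q_def add.commute)
  qed
  have q0: "0 \<le> q B" for B
    unfolding q_def using acc0 r01 r1 by (intro add_nonneg_nonneg divide_nonneg_nonneg mult_nonneg_nonneg) auto
  have lower: "q B \<le> measure D B" if B: "B \<in> sets borel" for B
  proof -
    have "ennreal (q B) = (\<Sum>k. ennreal (acc B k * (\<Prod>j<k. r j)))"
      using sums[of B] acc0 r01 by (intro suminf_ennreal_eq[symmetric]) (auto intro!: mult_nonneg_nonneg prod_nonneg)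
    also have "\<dots> = (\<Sum>k. emeasure M (Ev B k))" by (simp add: emEv[OF B])
    also have "\<dots> = emeasure M (\<Union>k. Ev B k)"
    proof (rule suminf_emeasure)
      show "disjoint_family (Ev B)"
        unfolding disjoint_family_on_def disjoint_iff using HEv[of _ B] by metis
    qed (use Evm[OF B] in auto)
    also have "\<dots> \<le> emeasure M (T -` B \<inter> space M)"
    proof (rule emeasure_mono)
      show "(\<Union>k. Ev B k) \<subseteq> T -` B \<inter> space M"
        using HEv by (auto simp: T_def) (auto simp: Ev_def)
      show "T -` B \<inter> space M \<in> sets M" using measurable_sets[OF T B] .
    qed
    also have "\<dots> = emeasure D B" unfolding D by (rule emeasure_distr[OF T B, symmetric])
    finally show ?thesis using D.emeasure_eq_measure by simp
  qed
  have accsum: "acc A k + acc (- A) k = 1 - r k" for k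
  proof -
    note [measurable_cong] = F(2)[of k]
    have i: "integrable (F k) p" "integrable (F k) (\<lambda>x. indicator A x * (1 - p x))"
        "integrable (F k) (\<lambda>x. indicator (- A) x * (1 - p x))"
      using A p01 by (auto intro!: integral_01 F simp: indicator_def)
    interpret F: prob_space "F k" by (rule F)
    have "acc A k + acc (- A) k = (\<integral>x. indicator A x * (1 - p x) + indicator (- A) x * (1 - p x) \<partial>F k)"
      unfolding acc_def using i by simp
    also have "\<dots> = (\<integral>x. 1 - p x \<partial>F k)"
      by (intro Bochner_Integration.integral_cong) (auto simp: indicator_def)
    finally show ?thesis using i by (simp add: r_def F.prob_space)
  qed
  have "q A + q (- A) = (acc A 0 + acc (- A) 0) + r 0 * (acc A 1 + acc (- A) 1) / (1 - r 1)"
    by (simp add: q_def distrib_left add_divide_distrib)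
  also have "\<dots> = 1" using r1 unfolding accsum by simp
  finally have "q A + q (- A) = 1" .
  moreover have "measure D A + measure D (- A) = 1"
    using D.prob_compl[of A] A by (simp add: D Compl_eq_Diff_UNIV)
  ultimately have "measure D A = q A" using lower[of A] lower[of "- A"] A by auto
  then show "measure D A = (\<integral>x. indicator A x * (1 - p x) \<partial>N0)
      + (\<integral>x. p x \<partial>N0) * (\<integral>x. indicator A x * (1 - p x) \<partial>N1) / (1 - (\<integral>x. p x \<partial>N1))"
    by (simp add: q_def acc_def r_def F_def)
qed

section \<open>The particle system started from iid particles\<close>

text \<open>The bound does not depend on the law, so normalising constants stay away from 0
  uniformly over all particle configurations and all \<open>N\<close>.\<close>

lemma integral_survival_ge:
  fixes lam :: "'a \<Rightarrow> real"
  assumes "prob_space M" "lam \<in> borel_measurable M" "0 < \<gamma>" "\<And>x. 0 \<le> lam x" "\<And>x. lam x \<le> C"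
  shows "exp (- \<gamma> * C) \<le> (\<integral>x. exp (- \<gamma> * lam x) \<partial>M)"
proof -
  interpret prob_space M by fact
  note [measurable] = assms(2)
  have "(\<integral>x. exp (- \<gamma> * C) \<partial>M) \<le> (\<integral>x. exp (- \<gamma> * lam x) \<partial>M)"
    using assms order_trans[OF assms(4,5)] by (intro integral_mono integral_01[OF assms(1)]) auto
  then show ?thesis by (simp add: prob_space)
qed

section \<open>One step of the particle system as an explicit kernel\<close>

lemma bind_kernel_K:
  fixes b :: "('n :: finite) torus \<Rightarrow> real ^ 'n"
  assumes "b \<in> borel_measurable borel" "\<mu> \<in> space (prob_algebra borel)"
  shows "\<mu> \<bind> kernel_K b \<gamma> \<in> space (prob_algebra borel)"
    "prob_space (\<mu> \<bind> kernel_K b \<gamma>)" "sets (\<mu> \<bind> kernel_K b \<gamma>) = sets borel"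
proof -
  show "\<mu> \<bind> kernel_K b \<gamma> \<in> space (prob_algebra borel)"
    by (rule integral_bind_01(3)[OF assms(2) measurable_kernel_K[OF assms(1)], of "\<lambda>_. 0"]) auto
  then show "prob_space (\<mu> \<bind> kernel_K b \<gamma>)" "sets (\<mu> \<bind> kernel_K b \<gamma>) = sets borel"
    by (auto simp: space_prob_algebra)
qed

lemma integral_kernel_K_01:
  fixes b :: "('n :: finite) torus \<Rightarrow> real ^ 'n"
  assumes "b \<in> borel_measurable borel"
    and "g \<in> borel_measurable borel" "\<And>x. 0 \<le> g x" "\<And>x. g x \<le> (1 :: real)"
  shows "(\<lambda>x. \<integral>y. g y \<partial>kernel_K b \<gamma> x) \<in> borel_measurable borel"
    "0 \<le> (\<integral>y. g y \<partial>kernel_K b \<gamma> x)" "(\<integral>y. g y \<partial>kernel_K b \<gamma> x) \<le> 1"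
proof -
  have "return borel undefined \<in> space (prob_algebra (borel :: 'n torus measure))"
    by (simp add: space_prob_algebra prob_space_return)
  from integral_bind_01(2)[OF this measurable_kernel_K[OF assms(1)] assms(2-4)]
  show "(\<lambda>x. \<integral>y. g y \<partial>kernel_K b \<gamma> x) \<in> borel_measurable borel" .
  show "0 \<le> (\<integral>y. g y \<partial>kernel_K b \<gamma> x)" "(\<integral>y. g y \<partial>kernel_K b \<gamma> x) \<le> 1"
    using integral_01(2,3)[OF prob_space_kernel_K(1)[OF assms(1)], of g] assms
      prob_space_kernel_K(2)[OF assms(1)] by (auto cong: measurable_cong_sets)
qed

text \<open>In closed form the mean field \<open>\<mu>\<close> enters only through the quotient of
  two integrals against \<open>\<mu> \<bind> kernel_K b \<gamma>\<close>.\<close>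

lemma kernel_Q:
  fixes b :: "('n :: finite) torus \<Rightarrow> real ^ 'n"
  assumes b: "b \<in> borel_measurable borel" and l [measurable]: "lam \<in> borel_measurable borel"
    and l0: "\<And>x. 0 \<le> lam x" and lC: "\<And>x. lam x \<le> C" and \<gamma>: "0 < \<gamma>"
    and \<mu>: "\<mu> \<in> space (prob_algebra borel)"
  shows "prob_space (kernel_Q b lam \<gamma> \<mu> x)" "sets (kernel_Q b lam \<gamma> \<mu> x) = sets borel"
    and "A \<in> sets borel \<Longrightarrow> measure (kernel_Q b lam \<gamma> \<mu> x) A
      = (\<integral>y. indicator A y * exp (- \<gamma> * lam y) \<partial>kernel_K b \<gamma> x)
        + (1 - (\<integral>y. exp (- \<gamma> * lam y) \<partial>kernel_K b \<gamma> x))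
          * (\<integral>y. indicator A y * exp (- \<gamma> * lam y) \<partial>(\<mu> \<bind> kernel_K b \<gamma>))
          / (\<integral>y. exp (- \<gamma> * lam y) \<partial>(\<mu> \<bind> kernel_K b \<gamma>))"
proof -
  note B = bind_kernel_K[OF b \<mu>, of \<gamma>] and K = prob_space_kernel_K[OF b, of \<gamma> x]
  have N: "kernel_K b \<gamma> x \<in> space (prob_algebra borel)" using K by (simp add: space_prob_algebra)
  have p01: "0 \<le> death_prob lam \<gamma> y" "death_prob lam \<gamma> y \<le> 1" for y
    using l0[of y] \<gamma> by (simp_all add: death_prob_def)
  have p [measurable]: "death_prob lam \<gamma> \<in> borel_measurable borel" unfolding death_prob_def by measurable
  have e: "1 - death_prob lam \<gamma> y = exp (- \<gamma> * lam y)" for y by (simp add: death_prob_def)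
  have int: "(\<integral>y. death_prob lam \<gamma> y \<partial>M) = 1 - (\<integral>y. exp (- \<gamma> * lam y) \<partial>M)"
    if "prob_space M" "sets M = sets borel" for M
  proof -
    interpret prob_space M by fact
    note [measurable_cong] = that(2)
    have "integrable M (\<lambda>y. exp (- \<gamma> * lam y))"
      by (intro integral_01[OF that(1)]) (use l0 \<gamma> in auto)
    then show ?thesis unfolding death_prob_def by (simp add: prob_space)
  qed
  have "exp (- \<gamma> * C) \<le> (\<integral>y. exp (- \<gamma> * lam y) \<partial>(\<mu> \<bind> kernel_K b \<gamma>))"
    by (intro integral_survival_ge B \<gamma> l0 lC) (use B in \<open>simp cong: measurable_cong_sets\<close>)
  then have "0 < (\<integral>y. exp (- \<gamma> * lam y) \<partial>(\<mu> \<bind> kernel_K b \<gamma>))"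
    by (rule less_le_trans[OF exp_gt_zero])
  then have less1: "(\<integral>y. death_prob lam \<gamma> y \<partial>(\<mu> \<bind> kernel_K b \<gamma>)) < 1"
    unfolding int[OF B(2,3)] by simp
  show "prob_space (kernel_Q b lam \<gamma> \<mu> x)"
    unfolding kernel_Q_def by (rule measure_rejection_sampling(2)[OF N B(1) p p01 less1 sets.top])
  show "sets (kernel_Q b lam \<gamma> \<mu> x) = sets borel" by (simp add: kernel_Q_def)
  assume A: "A \<in> sets borel"
  show "measure (kernel_Q b lam \<gamma> \<mu> x) A
      = (\<integral>y. indicator A y * exp (- \<gamma> * lam y) \<partial>kernel_K b \<gamma> x)
        + (1 - (\<integral>y. exp (- \<gamma> * lam y) \<partial>kernel_K b \<gamma> x))
          * (\<integral>y. indicator A y * exp (- \<gamma> * lam y) \<partial>(\<mu> \<bind> kernel_K b \<gamma>))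
          / (\<integral>y. exp (- \<gamma> * lam y) \<partial>(\<mu> \<bind> kernel_K b \<gamma>))"
    unfolding kernel_Q_def measure_rejection_sampling(1)[OF N B(1) p p01 less1 A] int[OF B(2,3)] int[OF K] e
    by simp
qed

lemma empirical_in_prob_algebra:
  assumes "N \<ge> 1"
  shows "empirical N x \<in> space (prob_algebra borel)"
proof -
  have "prob_space (uniform_count_measure {..<N})"
    using assms by (intro prob_space_uniform_count_measure) (auto simp: lessThan_empty_iff)
  then have "prob_space (empirical N x)"
    unfolding empirical_def by (rule prob_space.prob_space_distr) (simp add: measurable_def sets_uniform_count_measure space_uniform_count_measure)
  then show ?thesis by (simp add: space_prob_algebra empirical_def)
qed

lemma integral_empirical:
  assumes "g \<in> borel_measurable borel"
  shows "(\<integral>y. g y \<partial>empirical N x) = (\<Sum>j<N. g (x j)) / real N"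
  unfolding empirical_def
  by (subst integral_distr)
    (use assms in \<open>auto simp: measurable_def sets_uniform_count_measure space_uniform_count_measure integral_uniform_count_measure\<close>)

text \<open>For an empirical measure both integrals become averages of fixed functions
  \<open>F\<close> and \<open>G\<close> of the positions. This shows measurability in
  \<open>x\<close> and makes a law of large numbers applicable.\<close>

lemma measure_kernel_Q_empirical:
  fixes b :: "('n :: finite) torus \<Rightarrow> real ^ 'n"
  assumes b: "b \<in> borel_measurable borel" and l [measurable]: "lam \<in> borel_measurable borel"
    and l0: "\<And>x. 0 \<le> lam x" and lC: "\<And>x. lam x \<le> C" and \<gamma>: "0 < \<gamma>" and N: "N \<ge> 1"
    and A [measurable]: "A \<in> sets borel"
  defines "F \<equiv> \<lambda>x. \<integral>y. indicator A y * exp (- \<gamma> * lam y) \<partial>kernel_K b \<gamma> x"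
    and "G \<equiv> \<lambda>x. \<integral>y. exp (- \<gamma> * lam y) \<partial>kernel_K b \<gamma> x"
  shows "measure (kernel_Q b lam \<gamma> (empirical N x) z) A
      = F z + (1 - G z) * ((\<Sum>j<N. F (x j)) / real N) / ((\<Sum>j<N. G (x j)) / real N)"
proof -
  note E = empirical_in_prob_algebra[OF N, of x]
  have g: "(\<lambda>y. indicator A y * exp (- \<gamma> * lam y)) \<in> borel_measurable borel"
    "(\<lambda>y. exp (- \<gamma> * lam y)) \<in> borel_measurable borel" by measurable
  have 01: "0 \<le> indicator A y * exp (- \<gamma> * lam y)" "indicator A y * exp (- \<gamma> * lam y) \<le> 1"
    "0 \<le> exp (- \<gamma> * lam y)" "exp (- \<gamma> * lam y) \<le> 1" for y
    using l0[of y] \<gamma> by (auto simp: indicator_def)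
  have "(\<integral>y. indicator A y * exp (- \<gamma> * lam y) \<partial>(empirical N x \<bind> kernel_K b \<gamma>)) = (\<Sum>j<N. F (x j)) / real N"
    unfolding integral_bind_01(1)[OF E measurable_kernel_K[OF b] g(1) 01(1,2)] F_def
    by (rule integral_empirical) (rule integral_kernel_K_01[OF b g(1) 01(1,2)])
  moreover have "(\<integral>y. exp (- \<gamma> * lam y) \<partial>(empirical N x \<bind> kernel_K b \<gamma>)) = (\<Sum>j<N. G (x j)) / real N"
    unfolding integral_bind_01(1)[OF E measurable_kernel_K[OF b] g(2) 01(3,4)] G_def
    by (rule integral_empirical) (rule integral_kernel_K_01[OF b g(2) 01(3,4)])
  ultimately show ?thesis
    unfolding kernel_Q(3)[OF b l l0 lC \<gamma> E A] by (simp add: F_def G_def)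
qed

lemma prob_space_PiM_iid:
  assumes "\<eta> \<in> space (prob_algebra borel)"
  shows "PiM {..<N} (\<lambda>_. \<eta>) \<in> space (prob_algebra (torus_power N))"
  using assms
  by (auto simp: space_prob_algebra torus_power_def intro!: prob_space_PiM sets_PiM_cong)

lemma emeasure_PiM_component:
  assumes "\<And>i. i \<in> I \<Longrightarrow> prob_space (M i)" "i \<in> I" "A \<in> sets (M i)"
  shows "emeasure (PiM I M) {x \<in> space (PiM I M). x i \<in> A} = emeasure (M i) A"
proof -
  have "{x \<in> space (PiM I M). x i \<in> A} = prod_emb I M {i} (Pi\<^sub>E {i} (\<lambda>_. A))"
    by (auto simp: prod_emb_def space_PiM PiE_iff extensional_def)
  then show ?thesis using emeasure_PiM_emb[of I M "{i}" "\<lambda>_. A"] assms by simp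
qed

text \<open>Measurability is what makes \<open>bind\<close> with this kernel usable. Rectangles
  generate and are stable under intersection; on them the mass is a finite product of the explicit
  formula for \<open>kernel_Q\<close>.\<close>

lemma measurable_kernel_R:
  fixes b :: "('n :: finite) torus \<Rightarrow> real ^ 'n"
  assumes b: "b \<in> borel_measurable borel" and l [measurable]: "lam \<in> borel_measurable borel"
    and l0: "\<And>x. 0 \<le> lam x" and lC: "\<And>x. lam x \<le> C" and \<gamma>: "0 < \<gamma>" and N: "N \<ge> 1"
  shows "kernel_R b lam N \<gamma> \<in> torus_power N \<rightarrow>\<^sub>M prob_algebra (torus_power N)"
proof (rule measurable_prob_algebra_generated)
  note Q = kernel_Q(1,2)[OF b l l0 lC \<gamma> empirical_in_prob_algebra[OF N]]
  show "sets (torus_power N :: (nat \<Rightarrow> 'n torus) measure)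
      = sigma_sets (\<Pi>\<^sub>E i\<in>{..<N}. space borel) (prod_algebra {..<N} (\<lambda>_. borel))"
    unfolding torus_power_def by (rule sets_PiM)
  show "Int_stable (prod_algebra {..<N} (\<lambda>_. borel :: 'n torus measure))" by (rule Int_stable_prod_algebra)
  show "prod_algebra {..<N} (\<lambda>_. borel :: 'n torus measure) \<subseteq> Pow (\<Pi>\<^sub>E i\<in>{..<N}. space borel)"
    by (rule prod_algebra_sets_into_space)
  show "prob_space (kernel_R b lam N \<gamma> x)" for x
    unfolding kernel_R_def by (intro prob_space_PiM Q)
  show "sets (kernel_R b lam N \<gamma> x) = sets (torus_power N)" for x
    unfolding kernel_R_def torus_power_def by (intro sets_PiM_cong refl Q)
  fix A :: "(nat \<Rightarrow> 'n torus) set" assume "A \<in> prod_algebra {..<N} (\<lambda>_. borel)"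
  then obtain E where E: "A = Pi\<^sub>E {..<N} E" "E \<in> (\<Pi> i\<in>{..<N}. sets borel)"
    by (rule prod_algebraE_all)
  have [measurable]: "E i \<in> sets borel" if "i \<in> {..<N}" for i using E that by auto
  have c [measurable]: "(\<lambda>x. x i) \<in> torus_power N \<rightarrow>\<^sub>M (borel :: 'n torus measure)" if "i \<in> {..<N}" for i
    unfolding torus_power_def using that by measurable
  have e: "emeasure (kernel_R b lam N \<gamma> x) A
      = (\<Prod>i<N. ennreal (measure (kernel_Q b lam \<gamma> (empirical N x) (x i)) (E i)))" for x
  proof -
    have "emeasure (PiM {..<N} (\<lambda>i. kernel_Q b lam \<gamma> (empirical N x) (x i))) (prod_emb {..<N} (\<lambda>i. kernel_Q b lam \<gamma> (empirical N x) (x i)) {..<N} (Pi\<^sub>E {..<N} E))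
      = (\<Prod>i<N. emeasure (kernel_Q b lam \<gamma> (empirical N x) (x i)) (E i))"
      using E(2) by (intro emeasure_PiM_emb) (auto intro: Q simp: Q(2))
    moreover have "prod_emb {..<N} (\<lambda>i. kernel_Q b lam \<gamma> (empirical N x) (x i)) {..<N} (Pi\<^sub>E {..<N} E) = Pi\<^sub>E {..<N} E"
      using E(2) sets_eq_imp_space_eq[OF Q(2)] by (intro prod_emb_PiE_same_index) auto
    ultimately show ?thesis
      by (simp add: kernel_R_def E(1) finite_measure.emeasure_eq_measure[OF prob_space.finite_measure[OF Q(1)]])
  qed
  have [measurable]: "(\<lambda>x. measure (kernel_Q b lam \<gamma> (empirical N x) (x i)) (E i)) \<in> borel_measurable (torus_power N)"
    if "i \<in> {..<N}" for i
  proof -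
    have Ei: "E i \<in> sets borel" using E that by auto
    have [measurable]: "(\<lambda>x. \<integral>y. indicator (E i) y * exp (- \<gamma> * lam y) \<partial>kernel_K b \<gamma> x) \<in> borel_measurable borel"
      using Ei l0 \<gamma> by (intro integral_kernel_K_01[OF b]) (auto simp: indicator_def)
    have [measurable]: "(\<lambda>x. \<integral>y. exp (- \<gamma> * lam y) \<partial>kernel_K b \<gamma> x) \<in> borel_measurable borel"
      using l0 \<gamma> by (intro integral_kernel_K_01[OF b]) auto
    show ?thesis
      unfolding measure_kernel_Q_empirical[OF b l l0 lC \<gamma> N Ei] using that by measurable
  qed
  show "(\<lambda>x. emeasure (kernel_R b lam N \<gamma> x) A) \<in> borel_measurable (torus_power N)"
    unfolding e by measurable
qed

text \<open>Given the present configuration the coordinates move independently, so the marginal of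
  \<open>kernel_R\<close> at \<open>i\<close> is the kernel of the single particle \<open>i\<close>,
  averaged over \<open>P\<close>.\<close>

lemma measure_marginal_kernel_R:
  fixes b :: "('n :: finite) torus \<Rightarrow> real ^ 'n"
  assumes b: "b \<in> borel_measurable borel" and l: "lam \<in> borel_measurable borel"
    and l0: "\<And>x. 0 \<le> lam x" and lC: "\<And>x. lam x \<le> C" and \<gamma>: "0 < \<gamma>" and N: "N \<ge> 1"
    and P: "P \<in> space (prob_algebra (torus_power N))" and i: "i < N" and A: "A \<in> sets borel"
  shows "measure (distr (P \<bind> kernel_R b lam N \<gamma>) borel (\<lambda>x. x i)) A
      = (\<integral>x. measure (kernel_Q b lam \<gamma> (empirical N x) (x i)) A \<partial>P)"
    and "P \<bind> kernel_R b lam N \<gamma> \<in> space (prob_algebra (torus_power N))"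
proof -
  note R = measurable_kernel_R[OF b l l0 lC \<gamma> N]
  show PR: "P \<bind> kernel_R b lam N \<gamma> \<in> space (prob_algebra (torus_power N))"
    by (rule integral_bind_01(3)[OF P R, of "\<lambda>_. 0"]) auto
  have PR': "sets (P \<bind> kernel_R b lam N \<gamma>) = sets (torus_power N)" "prob_space (P \<bind> kernel_R b lam N \<gamma>)"
    using PR by (auto simp: space_prob_algebra)
  note [measurable_cong] = PR'(1)
  have c [measurable]: "(\<lambda>x. x i) \<in> torus_power N \<rightarrow>\<^sub>M (borel :: 'n torus measure)"
    unfolding torus_power_def by (rule measurable_component_singleton) (use i in simp)
  define S where "S = {x \<in> space (torus_power N). x i \<in> A}"
  have S: "S \<in> sets (torus_power N)"
    unfolding S_def using A by measurable
  have "measure (distr (P \<bind> kernel_R b lam N \<gamma>) borel (\<lambda>x. x i)) A = measure (P \<bind> kernel_R b lam N \<gamma>) S"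
    using A by (subst measure_distr)
      (auto simp: S_def sets_eq_imp_space_eq[OF PR'(1)] vimage_def Int_def conj_commute)
  also have "\<dots> = (\<integral>y. indicator S y \<partial>(P \<bind> kernel_R b lam N \<gamma>))"
    using S PR' by simp
  also have "\<dots> = (\<integral>x. \<integral>y. indicator S y \<partial>kernel_R b lam N \<gamma> x \<partial>P)"
    by (rule integral_bind_01(1)[OF P R]) (use S in \<open>auto simp: indicator_def\<close>)
  also have "\<dots> = (\<integral>x. measure (kernel_Q b lam \<gamma> (empirical N x) (x i)) A \<partial>P)"
  proof (rule Bochner_Integration.integral_cong[OF refl])
    fix x
    note Q = kernel_Q(1,2)[OF b l l0 lC \<gamma> empirical_in_prob_algebra[OF N]]
    have s: "sets (kernel_R b lam N \<gamma> x) = sets (torus_power N)"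
      unfolding kernel_R_def torus_power_def by (intro sets_PiM_cong refl Q)
    have "(\<integral>y. indicator S y \<partial>kernel_R b lam N \<gamma> x) = measure (kernel_R b lam N \<gamma> x) S"
      using S s by simp
    also have "\<dots> = measure (kernel_Q b lam \<gamma> (empirical N x) (x i)) A"
    proof -
      have "S = {y \<in> space (kernel_R b lam N \<gamma> x). y i \<in> A}"
        unfolding S_def sets_eq_imp_space_eq[OF s] ..
      then have "emeasure (kernel_R b lam N \<gamma> x) S = emeasure (kernel_Q b lam \<gamma> (empirical N x) (x i)) A"
        unfolding kernel_R_def using i A Q by (simp add: emeasure_PiM_component)
      then show ?thesis by (simp add: measure_def)
    qed
    finally show "(\<integral>y. indicator S y \<partial>kernel_R b lam N \<gamma> x) = measure (kernel_Q b lam \<gamma> (empirical N x) (x i)) A" .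
  qed
  finally show "measure (distr (P \<bind> kernel_R b lam N \<gamma>) borel (\<lambda>x. x i)) A
      = (\<integral>x. measure (kernel_Q b lam \<gamma> (empirical N x) (x i)) A \<partial>P)" .
qed

section \<open>The additive cost on configurations of N particles\<close>

lemma rho_sum_nonneg: "a > 0 \<Longrightarrow> 0 \<le> rho_sum a N x y"
  by (simp add: rho_sum_def sum_nonneg rho_nonneg)

lemma measurable_torus_power_component [measurable]:
  "i < N \<Longrightarrow> (\<lambda>x. x i) \<in> torus_power N \<rightarrow>\<^sub>M borel"
  unfolding torus_power_def by (rule measurable_component_singleton) simp

text \<open>The cost is additive: any coupling of the configurations couples each pair of
  coordinates, and the costs of these induced couplings add up to its own.\<close>

lemma wasserstein_marginals_le:
  fixes P P' :: "(nat \<Rightarrow> ('n :: finite) torus) measure"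
  assumes a: "a > 0"
    and P: "P \<in> space (prob_algebra (torus_power N))" and P': "P' \<in> space (prob_algebra (torus_power N))"
  shows "(\<Sum>i<N. wasserstein (rho a) (distr P borel (\<lambda>x. x i)) (distr P' borel (\<lambda>x. x i)))
    \<le> wasserstein (rho_sum a N) P P'"
  unfolding wasserstein_def[of "rho_sum a N"]
proof (rule cINF_greatest)
  show "couplings P P' \<noteq> {}" by (rule couplings_pair_measure[OF P P'])
  fix C assume C: "C \<in> couplings P P'"
  have s: "sets P = sets (torus_power N)" "sets P' = sets (torus_power N)"
    using P P' by (auto simp: space_prob_algebra)
  note C' = couplingsD[OF C s]
  note [measurable_cong] = C'(2)
  interpret C: prob_space C by (rule C')
  define D where "D i = distr C (borel \<Otimes>\<^sub>M borel) (\<lambda>z. (fst z i, snd z i))" for i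
  have m [measurable]: "(\<lambda>z. fst z i) \<in> C \<rightarrow>\<^sub>M borel" "(\<lambda>z. snd z i) \<in> C \<rightarrow>\<^sub>M borel" if "i < N" for i
    using that by (auto intro: measurable_compose[OF C'(5)] measurable_compose[OF C'(6)])
  have int: "integrable C (\<lambda>z. rho a (fst z i) (snd z i))" if i: "i < N" for i
    using m[OF i]
    by (intro C.integrable_const_bound[of _ "1 / a"]) (auto simp: rho_nonneg[OF a] rho_le_inverse[OF a])
  have D: "D i \<in> couplings (distr P borel (\<lambda>x. x i)) (distr P' borel (\<lambda>x. x i))" if i: "i < N" for i
    unfolding couplings_def
  proof (intro CollectI conjI)
    note mi = m[OF i] measurable_Pair[OF m[OF i]]
    show "prob_space (D i)" unfolding D_def by (rule C.prob_space_distr) (rule mi)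
    show "sets (D i) = sets (distr P borel (\<lambda>x. x i) \<Otimes>\<^sub>M distr P' borel (\<lambda>x. x i))"
      unfolding D_def by (simp cong: sets_pair_measure_cong)
    have "distr (D i) (distr P borel (\<lambda>x. x i)) fst = distr (D i) borel fst"
      by (rule distr_cong) auto
    also have "\<dots> = distr C borel (\<lambda>z. fst z i)"
      unfolding D_def by (subst distr_distr[OF measurable_fst mi(3)]) (simp add: comp_def)
    also have "\<dots> = distr (distr C (torus_power N) fst) borel (\<lambda>x. x i)"
      using i by (subst distr_distr[OF _ C'(5)]) (simp_all add: comp_def)
    finally show "distr (D i) (distr P borel (\<lambda>x. x i)) fst = distr P borel (\<lambda>x. x i)" unfolding C'(3) .
    have "distr (D i) (distr P' borel (\<lambda>x. x i)) snd = distr (D i) borel snd"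
      by (rule distr_cong) auto
    also have "\<dots> = distr C borel (\<lambda>z. snd z i)"
      unfolding D_def by (subst distr_distr[OF measurable_snd mi(3)]) (simp add: comp_def)
    also have "\<dots> = distr (distr C (torus_power N) snd) borel (\<lambda>x. x i)"
      using i by (subst distr_distr[OF _ C'(6)]) (simp_all add: comp_def)
    finally show "distr (D i) (distr P' borel (\<lambda>x. x i)) snd = distr P' borel (\<lambda>x. x i)" unfolding C'(4) .
  qed
  have "(\<Sum>i<N. wasserstein (rho a) (distr P borel (\<lambda>x. x i)) (distr P' borel (\<lambda>x. x i)))
      \<le> (\<Sum>i<N. \<integral>z. rho a (fst z i) (snd z i) \<partial>C)"
  proof (rule sum_mono)
    fix i assume "i \<in> {..<N}"
    then have i: "i < N" by simp
    have "wasserstein (rho a) (distr P borel (\<lambda>x. x i)) (distr P' borel (\<lambda>x. x i))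
        \<le> (\<integral>z. rho a (fst z) (snd z) \<partial>D i)"
      by (rule wasserstein_le_coupling[OF D[OF i] rho_nonneg[OF a]])
    also have "\<dots> = (\<integral>z. rho a (fst z i) (snd z i) \<partial>C)"
      unfolding D_def by (subst integral_distr[OF measurable_Pair[OF m[OF i]]]) auto
    finally show "wasserstein (rho a) (distr P borel (\<lambda>x. x i)) (distr P' borel (\<lambda>x. x i))
        \<le> (\<integral>z. rho a (fst z i) (snd z i) \<partial>C)" .
  qed
  also have "\<dots> = (\<integral>z. rho_sum a N (fst z) (snd z) \<partial>C)"
    unfolding rho_sum_def using int by (subst Bochner_Integration.integral_sum) auto
  finally show "(\<Sum>i<N. wasserstein (rho a) (distr P borel (\<lambda>x. x i)) (distr P' borel (\<lambda>x. x i)))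
      \<le> (\<integral>z. rho_sum a N (fst z) (snd z) \<partial>C)" .
qed

lemma integral_PiM_component:
  fixes f :: "'a \<Rightarrow> real"
  assumes "\<And>i. prob_space (M i)" "i \<in> I" and f: "f \<in> borel_measurable (M i)"
  shows "(\<integral>x. f (x i) \<partial>PiM I M) = (\<integral>x. f x \<partial>M i)"
proof -
  interpret product_prob_space M I by (intro product_prob_spaceI assms)
  have "(\<integral>x. f x \<partial>M i) = (\<integral>x. f x \<partial>distr (PiM I M) (M i) (\<lambda>\<omega>. \<omega> i))"
    by (simp add: PiM_component assms)
  also have "\<dots> = (\<integral>x. f (x i) \<partial>PiM I M)"
    using assms by (intro integral_distr) auto
  finally show ?thesis by simp
qed

text \<open>\<open>N\<close> independent copies of one near optimal coupling couple the two product
  laws.\<close>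

lemma wasserstein_PiM_iid_le:
  fixes \<eta> \<eta>' :: "('n :: finite) torus measure"
  assumes a: "a > 0"
    and \<eta>: "\<eta> \<in> space (prob_algebra borel)" and \<eta>': "\<eta>' \<in> space (prob_algebra borel)"
  shows "wasserstein (rho_sum a N) (PiM {..<N} (\<lambda>_. \<eta>)) (PiM {..<N} (\<lambda>_. \<eta>'))
    \<le> real N * wasserstein (rho a) \<eta> \<eta>'"
proof (rule field_le_epsilon)
  fix e :: real assume "e > 0"
  \<comment> \<open>The slack is paid once per coordinate; \<open>N + 1\<close> instead of
    \<open>N\<close> also covers \<open>N = 0\<close>.\<close>
  then have e': "e / (real N + 1) > 0" by simp
  obtain C where C: "C \<in> couplings \<eta> \<eta>'"
      "(\<integral>z. rho a (fst z) (snd z) \<partial>C) < wasserstein (rho a) \<eta> \<eta>' + e / (real N + 1)"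
    using wasserstein_approx[OF couplings_pair_measure[OF \<eta> \<eta>'] e'] by metis
  have s: "sets \<eta> = sets borel" "sets \<eta>' = sets borel" and p: "prob_space \<eta>" "prob_space \<eta>'"
    using \<eta> \<eta>' by (auto simp: space_prob_algebra)
  note C' = couplingsD[OF C(1) s]
  note [measurable_cong] = C'(2) s
  let ?I = "{..<N}"
  let ?CN = "PiM ?I (\<lambda>_. C)" and ?P = "PiM ?I (\<lambda>_. \<eta>)" and ?P' = "PiM ?I (\<lambda>_. \<eta>')"
  have pCN: "prob_space ?CN" by (intro prob_space_PiM C')
  interpret CN: prob_space ?CN by (rule pCN)
  have f: "fst \<in> C \<rightarrow>\<^sub>M \<eta>" "snd \<in> C \<rightarrow>\<^sub>M \<eta>'"
    using C'(5,6) by (simp_all add: measurable_cong_sets[OF refl s(1)] measurable_cong_sets[OF refl s(2)])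
  have mf: "compose ?I fst \<in> ?CN \<rightarrow>\<^sub>M ?P" and ms: "compose ?I snd \<in> ?CN \<rightarrow>\<^sub>M ?P'"
    unfolding compose_def using f by (auto intro!: measurable_restrict measurable_compose[OF measurable_component_singleton])
  define D where "D = distr ?CN (?P \<Otimes>\<^sub>M ?P') (\<lambda>\<omega>. (compose ?I fst \<omega>, compose ?I snd \<omega>))"
  have mD: "(\<lambda>\<omega>. (compose ?I fst \<omega>, compose ?I snd \<omega>)) \<in> ?CN \<rightarrow>\<^sub>M ?P \<Otimes>\<^sub>M ?P'"
    by (rule measurable_Pair[OF mf ms])
  have D: "D \<in> couplings ?P ?P'"
    unfolding couplings_def
  proof (intro CollectI conjI)
    show "prob_space D" unfolding D_def by (rule CN.prob_space_distr[OF mD])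
    show "sets D = sets (?P \<Otimes>\<^sub>M ?P')" by (simp add: D_def)
    have "distr D ?P fst = distr ?CN ?P (compose ?I fst)"
      unfolding D_def by (subst distr_distr[OF measurable_fst mD]) (simp add: comp_def)
    also have "\<dots> = PiM ?I (\<lambda>_. distr C \<eta> fst)"
      by (rule distr_PiM_finite_prob_space') (use C' p f in auto)
    also have "distr C \<eta> fst = \<eta>" using C(1) by (simp add: couplings_def)
    finally show "distr D ?P fst = ?P" .
    have "distr D ?P' snd = distr ?CN ?P' (compose ?I snd)"
      unfolding D_def by (subst distr_distr[OF measurable_snd mD]) (simp add: comp_def)
    also have "\<dots> = PiM ?I (\<lambda>_. distr C \<eta>' snd)"
      by (rule distr_PiM_finite_prob_space') (use C' p f in auto)
    also have "distr C \<eta>' snd = \<eta>'" using C(1) by (simp add: couplings_def)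
    finally show "distr D ?P' snd = ?P'" .
  qed
  have mc: "(\<lambda>x. x i) \<in> ?P \<rightarrow>\<^sub>M borel" "(\<lambda>x. x i) \<in> ?P' \<rightarrow>\<^sub>M borel" if "i < N" for i
    using that s measurable_component_singleton[of i ?I "\<lambda>_. \<eta>"] measurable_component_singleton[of i ?I "\<lambda>_. \<eta>'"]
    by (simp_all cong: measurable_cong_sets)
  have rm: "(\<lambda>z. rho a (fst z i) (snd z i)) \<in> borel_measurable (?P \<Otimes>\<^sub>M ?P')" if "i < N" for i
    by (intro measurable_rho measurable_compose[OF measurable_fst mc(1)[OF that]]
        measurable_compose[OF measurable_snd mc(2)[OF that]])
  have r: "(\<lambda>z. rho a (fst z) (snd z)) \<in> borel_measurable C" by measurable
  have "wasserstein (rho_sum a N) ?P ?P' \<le> (\<integral>z. rho_sum a N (fst z) (snd z) \<partial>D)"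
    by (rule wasserstein_le_coupling[OF D rho_sum_nonneg[OF a]])
  also have "\<dots> = (\<integral>\<omega>. (\<Sum>i<N. rho a (fst (\<omega> i)) (snd (\<omega> i))) \<partial>?CN)"
    unfolding D_def rho_sum_def
    by (subst integral_distr[OF mD]) (auto intro!: borel_measurable_sum rm sum.cong Bochner_Integration.integral_cong simp: compose_def)
  also have "\<dots> = (\<Sum>i<N. \<integral>\<omega>. rho a (fst (\<omega> i)) (snd (\<omega> i)) \<partial>?CN)"
  proof (rule Bochner_Integration.integral_sum)
    fix i assume "i \<in> ?I"
    then have "(\<lambda>\<omega>. rho a (fst (\<omega> i)) (snd (\<omega> i))) \<in> borel_measurable ?CN"
      using measurable_compose[OF measurable_component_singleton[of i ?I "\<lambda>_. C"] r] by simp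
    then show "integrable ?CN (\<lambda>\<omega>. rho a (fst (\<omega> i)) (snd (\<omega> i)))"
      by (intro CN.integrable_const_bound[of _ "1 / a"]) (auto simp: rho_nonneg[OF a] rho_le_inverse[OF a])
  qed
  also have "\<dots> = (\<Sum>i<N. \<integral>z. rho a (fst z) (snd z) \<partial>C)"
    by (intro sum.cong refl integral_PiM_component[of "\<lambda>_. C" _ _ "\<lambda>z. rho a (fst z) (snd z)"] C' r) auto
  also have "\<dots> \<le> real N * (wasserstein (rho a) \<eta> \<eta>' + e / (real N + 1))"
    using C(2) by (simp add: mult_left_mono)
  also have "\<dots> \<le> real N * wasserstein (rho a) \<eta> \<eta>' + e"
    using \<open>e > 0\<close> by (simp add: distrib_left field_simps)
  finally show "wasserstein (rho_sum a N) ?P ?P' \<le> real N * wasserstein (rho a) \<eta> \<eta>' + e" .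
qed

text \<open>A weak law of large numbers through the variance: mixed covariances vanish and diagonal
  ones are at most 1, so the centred sum has second moment at most \<open>N\<close>.\<close>

lemma iid_average_L1:
  fixes F :: "'a \<Rightarrow> real"
  assumes p: "prob_space \<eta>" and F [measurable]: "F \<in> borel_measurable \<eta>" and F01: "\<And>x. 0 \<le> F x" "\<And>x. F x \<le> 1"
    and N: "N \<ge> 1"
  shows "(\<integral>x. \<bar>(\<Sum>j<N. F (x j)) / real N - (\<integral>y. F y \<partial>\<eta>)\<bar> \<partial>PiM {..<N} (\<lambda>_. \<eta>)) \<le> 1 / sqrt N"
proof -
  interpret E: prob_space \<eta> by fact
  interpret PS: product_sigma_finite "\<lambda>_ :: nat. \<eta>" by unfold_locales
  let ?P = "PiM {..<N} (\<lambda>_. \<eta>)"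
  interpret P: prob_space ?P by (intro prob_space_PiM p)
  define f where "f x = F x - (\<integral>y. F y \<partial>\<eta>)" for x
  have fm [measurable]: "f \<in> borel_measurable \<eta>" unfolding f_def by measurable
  note I = integral_01[OF p F F01]
  have fb: "\<bar>f x\<bar> \<le> 1" for x using F01[of x] I(2,3) by (simp add: f_def abs_le_iff)
  have fi: "integrable \<eta> f" by (rule E.integrable_const_bound[of _ 1]) (use fb in auto)
  have f0: "(\<integral>x. f x \<partial>\<eta>) = 0" unfolding f_def using I(1) by (simp add: E.prob_space)
  have c: "(\<lambda>x. f (x i)) \<in> borel_measurable ?P" if "i < N" for i
    using measurable_compose[OF measurable_component_singleton[of i "{..<N}" "\<lambda>_. \<eta>"] fm] that by simp
  have int2: "integrable ?P (\<lambda>x. f (x i) * f (x j))" if "i < N" "j < N" for i j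
  proof (rule P.integrable_const_bound[of _ 1])
    have "\<bar>f (x i)\<bar> * \<bar>f (x j)\<bar> \<le> 1" for x by (intro mult_le_one fb abs_ge_zero)
    then show "AE x in ?P. norm (f (x i) * f (x j)) \<le> 1" by (simp add: abs_mult)
  qed (intro borel_measurable_times c that)
  have cov: "(\<integral>x. f (x i) * f (x j) \<partial>?P) \<le> (if i = j then 1 else 0)" if ij: "i < N" "j < N" for i j
  proof (cases "i = j")
    case True
    have "(\<integral>x. f (x i) * f (x j) \<partial>?P) \<le> (\<integral>x. 1 \<partial>?P)"
    proof (rule integral_mono[OF int2[OF ij]])
      fix x
      have "\<bar>f (x i)\<bar> * \<bar>f (x j)\<bar> \<le> 1" by (intro mult_le_one fb abs_ge_zero)
      then show "f (x i) * f (x j) \<le> 1"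
        using abs_ge_self[of "f (x i) * f (x j)"] by (simp add: abs_mult)
    qed simp
    also have "(\<integral>x. 1 \<partial>?P) = (1 :: real)"
      unfolding lebesgue_integral_const P.prob_space by simp
    finally show ?thesis using True by simp
  next
    case False
    \<comment> \<open>Padding with ones writes the product as one factor per coordinate, so that the
      integral of a product over all coordinates applies; the factor at \<open>i\<close> has mean
      0.\<close>
    define g where "g k y = (if k = i \<or> k = j then f y else 1)" for k y
    have gm: "integrable \<eta> (g k)" for k unfolding g_def by (cases "k = i \<or> k = j") (simp_all add: fi)
    have "(\<Prod>k<N. g k (x k)) = f (x i) * f (x j)" for x
    proof -
      have "(\<Prod>k\<in>{i, j}. g k (x k)) = (\<Prod>k<N. g k (x k))"
        by (rule prod.mono_neutral_left) (use ij in \<open>auto simp: g_def\<close>)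
      then show ?thesis using False by (simp add: g_def)
    qed
    then have "(\<integral>x. f (x i) * f (x j) \<partial>?P) = (\<integral>x. (\<Prod>k<N. g k (x k)) \<partial>?P)" by simp
    also have "\<dots> = (\<Prod>k<N. \<integral>y. g k y \<partial>\<eta>)"
      by (rule PS.product_integral_prod) (simp_all add: gm)
    also have "\<dots> = 0"
    proof (rule prod_zero)
      have "(\<integral>y. g i y \<partial>\<eta>) = 0" by (simp add: g_def f0)
      then show "\<exists>k\<in>{..<N}. (\<integral>y. g k y \<partial>\<eta>) = 0" using ij(1) by auto
    qed simp
    finally show ?thesis using False by simp
  qed
  define S where "S x = (\<Sum>j<N. f (x j))" for x
  have S: "(\<Sum>j<N. F (x j)) / real N - (\<integral>y. F y \<partial>\<eta>) = S x / real N" for x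
    using N by (simp add: S_def f_def sum_subtractf diff_divide_distrib)
  have S2: "(S x)\<^sup>2 = (\<Sum>i<N. \<Sum>j<N. f (x i) * f (x j))" for x
    by (simp add: S_def power2_eq_square sum_product)
  have "(\<integral>x. (S x)\<^sup>2 \<partial>?P) = (\<Sum>i<N. \<Sum>j<N. \<integral>x. f (x i) * f (x j) \<partial>?P)"
  proof -
    have "(\<integral>x. (S x)\<^sup>2 \<partial>?P) = (\<Sum>i<N. \<integral>x. (\<Sum>j<N. f (x i) * f (x j)) \<partial>?P)"
      unfolding S2 by (intro Bochner_Integration.integral_sum Bochner_Integration.integrable_sum int2) simp_all
    also have "\<dots> = (\<Sum>i<N. \<Sum>j<N. \<integral>x. f (x i) * f (x j) \<partial>?P)"
      by (intro sum.cong refl Bochner_Integration.integral_sum int2) simp_all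
    finally show ?thesis .
  qed
  also have "\<dots> \<le> (\<Sum>i<N. \<Sum>j<N. if i = j then 1 else 0)"
    by (intro sum_mono cov) auto
  also have "\<dots> = real N" by simp
  finally have var: "(\<integral>x. (S x)\<^sup>2 \<partial>?P) \<le> real N" .
  have Si: "integrable ?P (\<lambda>x. (S x)\<^sup>2)" unfolding S2 by (intro Bochner_Integration.integrable_sum int2) simp_all
  have Sm [measurable]: "S \<in> borel_measurable ?P" unfolding S_def by (intro borel_measurable_sum c) simp
  have Sb: "\<bar>S x\<bar> \<le> real N" for x
  proof -
    have "\<bar>S x\<bar> \<le> (\<Sum>j<N. \<bar>f (x j)\<bar>)" unfolding S_def by (rule sum_abs)
    also have "\<dots> \<le> of_nat (card {..<N}) * 1" by (rule sum_bounded_above) (rule fb)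
    finally show ?thesis by simp
  qed
  have aS: "integrable ?P (\<lambda>x. \<bar>S x\<bar> / real N)"
  proof (intro integrable_divide integrable_abs P.integrable_const_bound[of S "real N"] Sm)
    show "AE x in ?P. norm (S x) \<le> real N" using Sb by simp
  qed
  let ?d = "sqrt (real N)"
  have d: "?d > 0" "?d * ?d = real N" using N by auto
  \<comment> \<open>The pointwise bound
    \<open>2 * \<bar>S x\<bar> * sqrt N \<le> (S x)\<^sup>2 + N\<close> replaces the Cauchy-Schwarz
    inequality.\<close>
  have "(\<integral>x. \<bar>S x\<bar> / real N \<partial>?P) \<le> (\<integral>x. (1 / ?d + (S x)\<^sup>2 / (real N * ?d)) / 2 \<partial>?P)"
  proof (rule integral_mono[OF aS])
    show "integrable ?P (\<lambda>x. (1 / ?d + (S x)\<^sup>2 / (real N * ?d)) / 2)" using Si by auto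
    fix x
    have "0 \<le> (\<bar>S x\<bar> - ?d)\<^sup>2" by simp
    then have "2 * \<bar>S x\<bar> * ?d \<le> (S x)\<^sup>2 + real N"
      using d(2) by (simp add: power2_eq_square algebra_simps)
    then show "\<bar>S x\<bar> / real N \<le> (1 / ?d + (S x)\<^sup>2 / (real N * ?d)) / 2"
      using d N by (simp add: field_simps)
  qed
  also have "\<dots> = (1 / ?d + (\<integral>x. (S x)\<^sup>2 \<partial>?P) / (real N * ?d)) / 2"
    using Si by (simp add: P.prob_space)
  also have "\<dots> \<le> (1 / ?d + real N / (real N * ?d)) / 2"
    using var d N by (intro divide_right_mono add_left_mono) auto
  also have "\<dots> = 1 / ?d" using N by simp
  finally show ?thesis unfolding S by (simp add: abs_divide)
qed

section \<open>Mean field limit\<close>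

text \<open>One step of a normalised Feynman-Kac flow: the law of a moved particle conditioned on
  surviving the step. Only the normalisation makes it nonlinear in \<open>\<mu>\<close>.\<close>

definition mean_field_step ::
    "(('n :: finite) torus \<Rightarrow> real ^ 'n) \<Rightarrow> ('n torus \<Rightarrow> real) \<Rightarrow> real \<Rightarrow> 'n torus measure \<Rightarrow> 'n torus measure" where
  "mean_field_step b lam \<gamma> \<mu> = density (\<mu> \<bind> kernel_K b \<gamma>)
    (\<lambda>y. ennreal (exp (- \<gamma> * lam y) / (\<integral>y. exp (- \<gamma> * lam y) \<partial>(\<mu> \<bind> kernel_K b \<gamma>))))"

lemma density_normalized:
  fixes u :: "'a \<Rightarrow> real"
  assumes u [measurable]: "integrable M u" and u0: "\<And>x. 0 \<le> u x" and pos: "0 < (\<integral>x. u x \<partial>M)"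
  shows "prob_space (density M (\<lambda>x. ennreal (u x / (\<integral>x. u x \<partial>M))))"
    and "A \<in> sets M \<Longrightarrow> measure (density M (\<lambda>x. ennreal (u x / (\<integral>x. u x \<partial>M)))) A
      = (\<integral>x. indicator A x * u x \<partial>M) / (\<integral>x. u x \<partial>M)"
proof -
  let ?c = "\<integral>x. u x \<partial>M"
  have e: "emeasure (density M (\<lambda>x. ennreal (u x / ?c))) A = ennreal ((\<integral>x. indicator A x * u x \<partial>M) / ?c)"
    if A [measurable]: "A \<in> sets M" for A
  proof -
    have i: "integrable M (\<lambda>x. indicator A x * u x / ?c)"
      using integrable_mult_indicator[OF A u] by (simp add: mult.commute)
    have "emeasure (density M (\<lambda>x. ennreal (u x / ?c))) A = (\<integral>\<^sup>+x. ennreal (indicator A x * u x / ?c) \<partial>M)"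
      by (subst emeasure_density) (auto intro!: nn_integral_cong simp: indicator_def)
    also have "\<dots> = ennreal (\<integral>x. indicator A x * u x / ?c \<partial>M)"
      by (rule nn_integral_eq_integral[OF i]) (use u0 pos in \<open>auto simp: indicator_def\<close>)
    finally show ?thesis by simp
  qed
  have "(\<integral>x. indicator (space M) x * u x \<partial>M) = ?c"
    by (rule Bochner_Integration.integral_cong) auto
  then show "prob_space (density M (\<lambda>x. ennreal (u x / ?c)))"
    using e[OF sets.top] pos by (intro prob_spaceI) (simp add: space_density)
  show "measure (density M (\<lambda>x. ennreal (u x / ?c))) A = (\<integral>x. indicator A x * u x \<partial>M) / ?c"
    if "A \<in> sets M"
    unfolding measure_def e[OF that] using u0 pos
    by (auto intro!: enn2real_ennreal divide_nonneg_nonneg Bochner_Integration.integral_nonneg)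
qed

lemma mean_field_step:
  fixes b :: "('n :: finite) torus \<Rightarrow> real ^ 'n"
  assumes b: "b \<in> borel_measurable borel" and l [measurable]: "lam \<in> borel_measurable borel"
    and l0: "\<And>x. 0 \<le> lam x" and lC: "\<And>x. lam x \<le> C" and \<gamma>: "0 < \<gamma>"
    and \<mu>: "\<mu> \<in> space (prob_algebra borel)"
  shows "mean_field_step b lam \<gamma> \<mu> \<in> space (prob_algebra borel)"
    and "A \<in> sets borel \<Longrightarrow> measure (mean_field_step b lam \<gamma> \<mu>) A
      = (\<integral>x. \<integral>y. indicator A y * exp (- \<gamma> * lam y) \<partial>kernel_K b \<gamma> x \<partial>\<mu>)
        / (\<integral>x. \<integral>y. exp (- \<gamma> * lam y) \<partial>kernel_K b \<gamma> x \<partial>\<mu>)"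
proof -
  note B = bind_kernel_K[OF b \<mu>, of \<gamma>]
  have lm [measurable]: "lam \<in> borel_measurable (\<mu> \<bind> kernel_K b \<gamma>)"
    using l by (simp add: measurable_cong_sets[OF B(3) refl])
  have 01: "0 \<le> exp (- \<gamma> * lam y)" "exp (- \<gamma> * lam y) \<le> 1" for y
    using l0[of y] \<gamma> by auto
  have i: "integrable (\<mu> \<bind> kernel_K b \<gamma>) (\<lambda>y. exp (- \<gamma> * lam y))"
    by (rule integral_01[OF B(2) _ 01]) measurable
  have pos: "0 < (\<integral>y. exp (- \<gamma> * lam y) \<partial>(\<mu> \<bind> kernel_K b \<gamma>))"
    by (rule less_le_trans[OF exp_gt_zero integral_survival_ge[OF B(2) lm \<gamma> l0 lC]])
  note D = density_normalized[OF i 01(1) pos]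
  show "mean_field_step b lam \<gamma> \<mu> \<in> space (prob_algebra borel)"
    using D(1) B(3) by (simp add: mean_field_step_def space_prob_algebra)
  assume A: "A \<in> sets borel"
  show "measure (mean_field_step b lam \<gamma> \<mu>) A
      = (\<integral>x. \<integral>y. indicator A y * exp (- \<gamma> * lam y) \<partial>kernel_K b \<gamma> x \<partial>\<mu>)
        / (\<integral>x. \<integral>y. exp (- \<gamma> * lam y) \<partial>kernel_K b \<gamma> x \<partial>\<mu>)"
  proof -
    have "A \<in> sets (\<mu> \<bind> kernel_K b \<gamma>)" using A B(3) by simp
    from D(2)[OF this] show ?thesis
      unfolding mean_field_step_def
      using integral_bind_01(1)[OF \<mu> measurable_kernel_K[OF b, of \<gamma>], of "\<lambda>y. exp (- \<gamma> * lam y)"]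
        integral_bind_01(1)[OF \<mu> measurable_kernel_K[OF b, of \<gamma>], of "\<lambda>y. indicator A y * exp (- \<gamma> * lam y)"]
        01 A by (simp add: indicator_def)
  qed
qed

text \<open>The reference quotient \<open>u / v\<close> is at most 1, so an error in the denominator
  weighs no more than one in the numerator.\<close>

lemma ratio_perturb:
  fixes u v U V c :: real
  assumes "0 < c" "c \<le> V" "0 < v" "0 \<le> u" "u \<le> v"
  shows "\<bar>U / V - u / v\<bar> \<le> (\<bar>U - u\<bar> + \<bar>V - v\<bar>) / c"
proof -
  have V: "0 < V" using assms by linarith
  have "U / V - u / v = (U - u) / V + (u / v) * ((v - V) / V)"
    using V assms(3) by (simp add: field_simps)
  also have "\<bar>\<dots>\<bar> \<le> \<bar>(U - u) / V\<bar> + \<bar>(u / v) * ((v - V) / V)\<bar>" by (rule abs_triangle_ineq)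
  also have "\<bar>(u / v) * ((v - V) / V)\<bar> \<le> 1 * \<bar>(v - V) / V\<bar>"
    unfolding abs_mult using assms by (intro mult_right_mono) auto
  also have "\<bar>(U - u) / V\<bar> + 1 * \<bar>(v - V) / V\<bar> = (\<bar>U - u\<bar> + \<bar>V - v\<bar>) / V"
    using V by (simp add: abs_divide add_divide_distrib abs_minus_commute)
  also have "\<dots> \<le> (\<bar>U - u\<bar> + \<bar>V - v\<bar>) / c"
    using assms by (intro divide_left_mono) auto
  finally show ?thesis by simp
qed

text \<open>The numerator and the denominator average each fluctuate by at most
  \<open>1 / sqrt N\<close> in mean, and the denominator is at least
  \<open>exp (- \<gamma> * C)\<close>. A single set \<open>A\<close> is enough, because distances
  are later bounded through finitely many cells.\<close>

lemma marginal_kernel_R_approx: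
  fixes b :: "('n :: finite) torus \<Rightarrow> real ^ 'n"
  assumes b: "b \<in> borel_measurable borel" and l [measurable]: "lam \<in> borel_measurable borel"
    and l0: "\<And>x. 0 \<le> lam x" and lC: "\<And>x. lam x \<le> C" and \<gamma>: "0 < \<gamma>" and N: "N \<ge> 1"
    and \<eta>: "\<eta> \<in> space (prob_algebra borel)" and i: "i < N" and A [measurable]: "A \<in> sets borel"
  shows "\<bar>measure (distr (PiM {..<N} (\<lambda>_. \<eta>) \<bind> kernel_R b lam N \<gamma>) borel (\<lambda>x. x i)) A
      - measure (mean_field_step b lam \<gamma> \<eta>) A\<bar> \<le> 2 * exp (\<gamma> * C) / sqrt N"
proof -
  let ?P = "PiM {..<N} (\<lambda>_. \<eta>)"
  have p: "prob_space \<eta>" and s: "sets \<eta> = sets borel" using \<eta> by (auto simp: space_prob_algebra)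
  interpret P: prob_space ?P by (intro prob_space_PiM p)
  define F where "F x = (\<integral>y. indicator A y * exp (- \<gamma> * lam y) \<partial>kernel_K b \<gamma> x)" for x
  define G where "G x = (\<integral>y. exp (- \<gamma> * lam y) \<partial>kernel_K b \<gamma> x)" for x
  have 01: "0 \<le> exp (- \<gamma> * lam y)" "exp (- \<gamma> * lam y) \<le> 1"
    "0 \<le> indicator A y * exp (- \<gamma> * lam y)" "indicator A y * exp (- \<gamma> * lam y) \<le> 1" for y
    using l0[of y] \<gamma> by (auto simp: indicator_def)
  have mA: "(\<lambda>y. indicator A y * exp (- \<gamma> * lam y)) \<in> borel_measurable borel"
    "(\<lambda>y. exp (- \<gamma> * lam y)) \<in> borel_measurable borel" by measurable
  note KF = integral_kernel_K_01[OF b mA(1) 01(3,4), of \<gamma>, folded F_def]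
  note KG = integral_kernel_K_01[OF b mA(2) 01(1,2), of \<gamma>, folded G_def]
  have Fm: "F \<in> borel_measurable \<eta>" and Gm: "G \<in> borel_measurable \<eta>"
    using KF(1) KG(1) by (simp_all add: measurable_cong_sets[OF s refl])
  define c where "c = exp (- \<gamma> * C)"
  have Gc: "c \<le> G x" for x
    unfolding c_def G_def using prob_space_kernel_K[OF b, of \<gamma> x]
    by (intro integral_survival_ge \<gamma> l0 lC) (simp_all cong: measurable_cong_sets)
  have c0: "0 < c" by (simp add: c_def)
  define u where "u = (\<integral>x. F x \<partial>\<eta>)"
  define v where "v = (\<integral>x. G x \<partial>\<eta>)"
  note IF = integral_01[OF p Fm KF(2,3), folded u_def] and IG = integral_01[OF p Gm KG(2,3), folded v_def]
  have FG: "F x \<le> G x" for x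
    unfolding F_def G_def
  proof (rule integral_mono)
    have K: "prob_space (kernel_K b \<gamma> x)" "sets (kernel_K b \<gamma> x) = sets borel"
      by (rule prob_space_kernel_K[OF b])+
    show "integrable (kernel_K b \<gamma> x) (\<lambda>y. indicator A y * exp (- \<gamma> * lam y))"
      by (rule integral_01[OF K(1) _ 01(3,4)]) (use mA K(2) in \<open>simp cong: measurable_cong_sets\<close>)
    show "integrable (kernel_K b \<gamma> x) (\<lambda>y. exp (- \<gamma> * lam y))"
      by (rule integral_01[OF K(1) _ 01(1,2)]) (use mA K(2) in \<open>simp cong: measurable_cong_sets\<close>)
  qed (auto simp: indicator_def)
  have uv: "u \<le> v" unfolding u_def v_def by (rule integral_mono[OF IF(1) IG(1) FG])
  have cv: "c \<le> v"
  proof -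
    interpret E: prob_space \<eta> by (rule p)
    have "(\<integral>x. c \<partial>\<eta>) \<le> v" unfolding v_def by (rule integral_mono[OF _ IG(1) Gc]) simp
    then show ?thesis by (simp add: E.prob_space)
  qed
  have v0: "0 < v" using c0 cv by linarith
  define U where "U x = (\<Sum>j<N. F (x j)) / real N" for x
  define V where "V x = (\<Sum>j<N. G (x j)) / real N" for x
  have Vc: "c \<le> V x" for x
  proof -
    have "real (card {..<N}) * c \<le> (\<Sum>j<N. G (x j))" by (rule sum_bounded_below) (rule Gc)
    then show ?thesis using N by (simp add: V_def field_simps)
  qed
  have cF: "(\<lambda>x. F (x j)) \<in> borel_measurable ?P" and cG: "(\<lambda>x. G (x j)) \<in> borel_measurable ?P" if "j < N" for j
    using measurable_compose[OF measurable_component_singleton[of j "{..<N}" "\<lambda>_. \<eta>"] Fm]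
      measurable_compose[OF measurable_component_singleton[of j "{..<N}" "\<lambda>_. \<eta>"] Gm] that by simp_all
  have Um: "U \<in> borel_measurable ?P" and Vm: "V \<in> borel_measurable ?P"
    unfolding U_def V_def by (intro borel_measurable_divide borel_measurable_sum cF cG borel_measurable_const; simp)+
  have Ub: "0 \<le> U x" "U x \<le> V x" and Vb: "V x \<le> 1" for x
  proof -
    show "0 \<le> U x" unfolding U_def using KF(2) by (intro divide_nonneg_nonneg sum_nonneg) auto
    show "U x \<le> V x" unfolding U_def V_def using FG by (intro divide_right_mono sum_mono) auto
    have "(\<Sum>j<N. G (x j)) \<le> real (card {..<N}) * 1" by (rule sum_bounded_above) (rule KG(3))
    then show "V x \<le> 1" using N by (simp add: V_def field_simps)
  qed
  have Uab: "\<bar>U x - u\<bar> \<le> 1" "\<bar>V x - v\<bar> \<le> 1" for x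
    using Ub[of x] Vb[of x] IF(2,3) IG(2,3) by (auto simp: abs_le_iff)
  have iU: "integrable ?P (\<lambda>x. \<bar>U x - u\<bar>)"
    by (rule P.integrable_const_bound[of _ 1]) (use Uab Um in auto)
  have iV: "integrable ?P (\<lambda>x. \<bar>V x - v\<bar>)"
    by (rule P.integrable_const_bound[of _ 1]) (use Uab Vm in auto)
  have EU: "(\<integral>x. \<bar>U x - u\<bar> \<partial>?P) \<le> 1 / sqrt N"
    unfolding U_def u_def by (rule iid_average_L1[OF p Fm KF(2,3) N])
  have EV: "(\<integral>x. \<bar>V x - v\<bar> \<partial>?P) \<le> 1 / sqrt N"
    unfolding V_def v_def by (rule iid_average_L1[OF p Gm KG(2,3) N])
  have iF: "integrable ?P (\<lambda>x. F (x i))" "(\<integral>x. F (x i) \<partial>?P) = u"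
    unfolding u_def using i Fm p KF(2,3) cF[OF i]
    by (auto intro!: P.integrable_const_bound[of _ 1] integral_PiM_component[of "\<lambda>_. \<eta>"])
  have iG: "integrable ?P (\<lambda>x. G (x i))" "(\<integral>x. G (x i) \<partial>?P) = v"
    unfolding v_def using i Gm p KG(2,3) cG[OF i]
    by (auto intro!: P.integrable_const_bound[of _ 1] integral_PiM_component[of "\<lambda>_. \<eta>"])
  have rm: "(\<lambda>x. (1 - G (x i)) * (U x / V x - u / v)) \<in> borel_measurable ?P"
    using cG[OF i] Um Vm by measurable
  have r1: "\<bar>(1 - G (x i)) * (U x / V x - u / v)\<bar> \<le> (\<bar>U x - u\<bar> + \<bar>V x - v\<bar>) / c" for x
  proof -
    have "\<bar>(1 - G (x i)) * (U x / V x - u / v)\<bar> \<le> 1 * \<bar>U x / V x - u / v\<bar>"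
      unfolding abs_mult using KG(2,3)[of "x i"] by (intro mult_right_mono) auto
    also have "\<dots> \<le> (\<bar>U x - u\<bar> + \<bar>V x - v\<bar>) / c"
      using ratio_perturb[OF c0 Vc[of x] v0 IF(2) uv] by simp
    finally show ?thesis .
  qed
  have ib: "integrable ?P (\<lambda>x. (\<bar>U x - u\<bar> + \<bar>V x - v\<bar>) / c)" using iU iV by simp
  have ir: "integrable ?P (\<lambda>x. (1 - G (x i)) * (U x / V x - u / v))"
    by (rule Bochner_Integration.integrable_bound[OF ib rm]) (use r1 c0 in auto)
  \<comment> \<open>Particle \<open>i\<close> also occurs in the averages \<open>U\<close> and
    \<open>V\<close>. Separating the deterministic quotient leaves an error whose prefactor is at
    most 1 in absolute value, so this dependence does no harm.\<close>
  have split: "F (x i) + (1 - G (x i)) * U x / V x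
      = F (x i) + (1 - G (x i)) * (u / v) + (1 - G (x i)) * (U x / V x - u / v)" for x
    by (simp add: algebra_simps)
  have "measure (distr (?P \<bind> kernel_R b lam N \<gamma>) borel (\<lambda>x. x i)) A
      = (\<integral>x. F (x i) + (1 - G (x i)) * U x / V x \<partial>?P)"
    unfolding measure_marginal_kernel_R(1)[OF b l l0 lC \<gamma> N prob_space_PiM_iid[OF \<eta>] i A]
      measure_kernel_Q_empirical[OF b l l0 lC \<gamma> N A] F_def G_def U_def V_def ..
  also have "\<dots> = u + (1 - v) * (u / v) + (\<integral>x. (1 - G (x i)) * (U x / V x - u / v) \<partial>?P)"
    unfolding split using iF iG ir by (simp add: P.prob_space)
  \<comment> \<open>The exact identity behind the mean field limit: survivors contribute
    \<open>u\<close>, and the rejected mass \<open>1 - v\<close> is redistributed by the survivors'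
    law \<open>u / v\<close>.\<close>
  also have "u + (1 - v) * (u / v) = u / v" using v0 by (simp add: field_simps)
  finally have m: "measure (distr (?P \<bind> kernel_R b lam N \<gamma>) borel (\<lambda>x. x i)) A
      = u / v + (\<integral>x. (1 - G (x i)) * (U x / V x - u / v) \<partial>?P)" .
  have \<Phi>: "measure (mean_field_step b lam \<gamma> \<eta>) A = u / v"
    unfolding mean_field_step(2)[OF b l l0 lC \<gamma> \<eta> A] u_def v_def F_def G_def ..
  have "\<bar>measure (distr (?P \<bind> kernel_R b lam N \<gamma>) borel (\<lambda>x. x i)) A
      - measure (mean_field_step b lam \<gamma> \<eta>) A\<bar> = \<bar>\<integral>x. (1 - G (x i)) * (U x / V x - u / v) \<partial>?P\<bar>"
    unfolding m \<Phi> by simp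
  also have "\<dots> \<le> (\<integral>x. \<bar>(1 - G (x i)) * (U x / V x - u / v)\<bar> \<partial>?P)" by (rule integral_abs_bound)
  also have "\<dots> \<le> (\<integral>x. (\<bar>U x - u\<bar> + \<bar>V x - v\<bar>) / c \<partial>?P)"
    by (rule integral_mono[OF integrable_abs[OF ir] ib r1])
  also have "\<dots> = ((\<integral>x. \<bar>U x - u\<bar> \<partial>?P) + (\<integral>x. \<bar>V x - v\<bar> \<partial>?P)) / c" using iU iV by simp
  also have "\<dots> \<le> (1 / sqrt N + 1 / sqrt N) / c" using EU EV c0 by (intro divide_right_mono add_mono) auto
  also have "\<dots> = 2 * exp (\<gamma> * C) / sqrt N" by (simp add: c_def exp_minus divide_inverse)
  finally show ?thesis .
qed

text \<open>Summing over \<open>N\<close> coordinates and dividing by \<open>N\<close> leaves the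
  factor \<open>k\<close> untouched. The assumption \<open>R\<close> covers every \<open>N\<close>,
  since \<open>N\<close> is chosen only after the error \<open>e\<close> and the partition.\<close>

lemma mean_field_step_contraction:
  fixes b :: "('n :: finite) torus \<Rightarrow> real ^ 'n"
  assumes b: "b \<in> borel_measurable borel" and l: "lam \<in> borel_measurable borel"
    and l0: "\<And>x. 0 \<le> lam x" and lC: "\<And>x. lam x \<le> C" and \<gamma>: "0 < \<gamma>" and a: "a > 0"
    and \<eta>: "\<eta> \<in> space (prob_algebra borel)" and \<eta>': "\<eta>' \<in> space (prob_algebra borel)" and k: "0 \<le> k"
    and R: "\<And>N P P'. N \<ge> 1 \<Longrightarrow> P \<in> space (prob_algebra (torus_power N)) \<Longrightarrow>
      P' \<in> space (prob_algebra (torus_power N)) \<Longrightarrow>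
      wasserstein (rho_sum a N) (P \<bind> kernel_R b lam N \<gamma>) (P' \<bind> kernel_R b lam N \<gamma>)
        \<le> k * wasserstein (rho_sum a N) P P'"
  shows "wasserstein (rho a) (mean_field_step b lam \<gamma> \<eta>) (mean_field_step b lam \<gamma> \<eta>')
    \<le> k * wasserstein (rho a) \<eta> \<eta>'"
proof (rule field_le_epsilon)
  fix e :: real assume "e > 0"
  then have e4: "e / 4 > 0" by simp
  obtain idx :: "'n torus \<Rightarrow> nat" and n where idx: "idx \<in> measurable borel (count_space UNIV)"
    "\<And>x. idx x < n" "\<And>x y. idx x = idx y \<Longrightarrow> dist x y \<le> e / 4"
    using torus_partition[OF e4] by metis
  \<comment> \<open>Each of the \<open>n\<close> cells contributes at most
    \<open>2 * exp (\<gamma> * C) / sqrt N\<close>; \<open>n + 1\<close> keeps \<open>D\<close>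
    positive without a case distinction. The choice of \<open>\<delta>\<close> below gives
    \<open>D * \<delta> / a = e / 4\<close>.\<close>
  define D where "D = (real n + 1) * (2 * exp (\<gamma> * C))"
  have D: "D > 0" by (simp add: D_def)
  define \<delta> where "\<delta> = e * a / (4 * D)"
  have \<delta>: "\<delta> > 0" unfolding \<delta>_def using \<open>e > 0\<close> a D by simp
  obtain N0 :: nat where N0: "(1 / \<delta>)\<^sup>2 \<le> real N0" using real_arch_simple by blast
  define N where "N = max N0 1"
  have N: "N \<ge> 1" and "(1 / \<delta>)\<^sup>2 \<le> real N" using N0 by (auto simp: N_def)
  then have "1 / \<delta> \<le> sqrt N" using \<delta> by (intro real_le_rsqrt)
  then have sN: "1 / sqrt N \<le> \<delta>" using \<delta> N by (simp add: field_simps)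
  let ?m = "\<lambda>\<eta> i. distr (PiM {..<N} (\<lambda>_. \<eta>) \<bind> kernel_R b lam N \<gamma>) borel (\<lambda>x. x i)"
  let ?\<Phi> = "mean_field_step b lam \<gamma>"
  \<comment> \<open>Both orders are bounded, which replaces symmetry of
    \<open>wasserstein\<close>.\<close>
  have near: "wasserstein (rho a) (?m \<eta> i) (?\<Phi> \<eta>) \<le> e / 2" "wasserstein (rho a) (?\<Phi> \<eta>) (?m \<eta> i) \<le> e / 2"
    "?m \<eta> i \<in> space (prob_algebra borel)"
    if \<eta>: "\<eta> \<in> space (prob_algebra borel)" and i: "i < N" for \<eta> i
  proof -
    have PR: "PiM {..<N} (\<lambda>_. \<eta>) \<bind> kernel_R b lam N \<gamma> \<in> space (prob_algebra (torus_power N))"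
      by (rule measure_marginal_kernel_R(2)[OF b l l0 lC \<gamma> N prob_space_PiM_iid[OF \<eta>] i sets.top])
    then have PR': "prob_space (PiM {..<N} (\<lambda>_. \<eta>) \<bind> kernel_R b lam N \<gamma>)"
      "sets (PiM {..<N} (\<lambda>_. \<eta>) \<bind> kernel_R b lam N \<gamma>) = sets (torus_power N)"
      by (auto simp: space_prob_algebra)
    have "(\<lambda>x. x i) \<in> (PiM {..<N} (\<lambda>_. \<eta>) \<bind> kernel_R b lam N \<gamma>) \<rightarrow>\<^sub>M borel"
      using measurable_torus_power_component[OF i] by (simp add: measurable_cong_sets[OF PR'(2) refl])
    then have "prob_space (?m \<eta> i)" by (rule prob_space.prob_space_distr[OF PR'(1)])
    then show m: "?m \<eta> i \<in> space (prob_algebra borel)" by (simp add: space_prob_algebra)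
    have M: "?\<Phi> \<eta> \<in> space (prob_algebra borel)" by (rule mean_field_step(1)[OF b l l0 lC \<gamma> \<eta>])
    have "(\<Sum>j<n. \<bar>measure (?m \<eta> i) {x. idx x = j} - measure (?\<Phi> \<eta>) {x. idx x = j}\<bar>)
        \<le> real (card {..<n}) * (2 * exp (\<gamma> * C) / sqrt N)"
    proof (rule sum_bounded_above)
      fix j
      have "{x \<in> space borel. idx x = j} \<in> sets borel" using idx(1) by measurable
      then show "\<bar>measure (?m \<eta> i) {x. idx x = j} - measure (?\<Phi> \<eta>) {x. idx x = j}\<bar> \<le> 2 * exp (\<gamma> * C) / sqrt N"
        by (intro marginal_kernel_R_approx[OF b l l0 lC \<gamma> N \<eta> i]) simp
    qed
    also have "\<dots> \<le> (real n + 1) * (2 * exp (\<gamma> * C) * (1 / sqrt N))"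
    proof -
      have "0 \<le> 2 * exp (\<gamma> * C) / sqrt (real N)" by simp
      then show ?thesis by (simp add: distrib_right add_divide_distrib)
    qed
    also have "\<dots> \<le> (real n + 1) * (2 * exp (\<gamma> * C) * \<delta>)"
      using sN by (intro mult_left_mono) auto
    also have "\<dots> = D * \<delta>" by (simp only: D_def mult.assoc)
    also have "\<dots> = e * a / 4" using D by (simp add: \<delta>_def)
    finally have S: "(\<Sum>j<n. \<bar>measure (?m \<eta> i) {x. idx x = j} - measure (?\<Phi> \<eta>) {x. idx x = j}\<bar>) / a \<le> e / 4"
      using a by (simp add: field_simps)
    have "wasserstein (rho a) (?m \<eta> i) (?\<Phi> \<eta>) \<le> e / 4
        + (\<Sum>j<n. \<bar>measure (?m \<eta> i) {x. idx x = j} - measure (?\<Phi> \<eta>) {x. idx x = j}\<bar>) / a"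
      using e4 by (intro wasserstein_le_partition[OF a _ m M idx]) auto
    with S show "wasserstein (rho a) (?m \<eta> i) (?\<Phi> \<eta>) \<le> e / 2" by linarith
    have "wasserstein (rho a) (?\<Phi> \<eta>) (?m \<eta> i) \<le> e / 4
        + (\<Sum>j<n. \<bar>measure (?\<Phi> \<eta>) {x. idx x = j} - measure (?m \<eta> i) {x. idx x = j}\<bar>) / a"
      using e4 by (intro wasserstein_le_partition[OF a _ M m idx]) auto
    with S show "wasserstein (rho a) (?\<Phi> \<eta>) (?m \<eta> i) \<le> e / 2"
      unfolding abs_minus_commute[of "measure (?\<Phi> \<eta>) _"] by linarith
  qed
  let ?W = "wasserstein (rho a) (?\<Phi> \<eta>) (?\<Phi> \<eta>')"
  have M: "?\<Phi> \<eta> \<in> space (prob_algebra borel)" "?\<Phi> \<eta>' \<in> space (prob_algebra borel)"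
    by (rule mean_field_step(1)[OF b l l0 lC \<gamma>]; fact)+
  \<comment> \<open>In every coordinate the replacement of \<open>\<Phi>\<close> by the marginal
    loses at most \<open>e / 2\<close> at either end.\<close>
  have "real N * (?W - e) = (\<Sum>i<N. ?W - e)" by simp
  also have "\<dots> \<le> (\<Sum>i<N. wasserstein (rho a) (?m \<eta> i) (?m \<eta>' i))"
  proof (rule sum_mono)
    fix i assume "i \<in> {..<N}"
    then have i: "i < N" by simp
    note n1 = near[OF \<eta> i] and n2 = near[OF \<eta>' i]
    have "?W \<le> wasserstein (rho a) (?\<Phi> \<eta>) (?m \<eta> i) + wasserstein (rho a) (?m \<eta> i) (?\<Phi> \<eta>')"
      by (rule wasserstein_triangle[OF a M(1) n1(3) M(2)])
    also have "wasserstein (rho a) (?m \<eta> i) (?\<Phi> \<eta>')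
        \<le> wasserstein (rho a) (?m \<eta> i) (?m \<eta>' i) + wasserstein (rho a) (?m \<eta>' i) (?\<Phi> \<eta>')"
      by (rule wasserstein_triangle[OF a n1(3) n2(3) M(2)])
    finally show "?W - e \<le> wasserstein (rho a) (?m \<eta> i) (?m \<eta>' i)"
      using n1(2) n2(1) by linarith
  qed
  also have "\<dots> \<le> wasserstein (rho_sum a N) (PiM {..<N} (\<lambda>_. \<eta>) \<bind> kernel_R b lam N \<gamma>)
      (PiM {..<N} (\<lambda>_. \<eta>') \<bind> kernel_R b lam N \<gamma>)"
    \<comment> \<open>The index \<open>0\<close> and the set \<open>{}\<close> are dummies: only the
      membership in the space of laws is taken from this lemma.\<close>
    using N by (intro wasserstein_marginals_le[OF a]
        measure_marginal_kernel_R(2)[OF b l l0 lC \<gamma> N prob_space_PiM_iid[OF \<eta>], of 0 "{}"]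
        measure_marginal_kernel_R(2)[OF b l l0 lC \<gamma> N prob_space_PiM_iid[OF \<eta>'], of 0 "{}"]) auto
  also have "\<dots> \<le> k * wasserstein (rho_sum a N) (PiM {..<N} (\<lambda>_. \<eta>)) (PiM {..<N} (\<lambda>_. \<eta>'))"
    by (intro R N prob_space_PiM_iid \<eta> \<eta>')
  also have "\<dots> \<le> k * (real N * wasserstein (rho a) \<eta> \<eta>')"
    by (intro mult_left_mono wasserstein_PiM_iid_le a \<eta> \<eta>' k)
  finally have "real N * (?W - e) \<le> real N * (k * wasserstein (rho a) \<eta> \<eta>')" by (simp add: mult_ac)
  then have "?W - e \<le> k * wasserstein (rho a) \<eta> \<eta>'" using N by (simp add: mult_le_cancel_left)
  then show "?W \<le> k * wasserstein (rho a) \<eta> \<eta>' + e" by simp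
qed

section \<open>Weighted laws and survival laws\<close>

text \<open>The common form of the two sides of the limit. The survival law and the laws of the
  weighted Euler scheme are weighted laws over the same \<open>M\<close>, so comparing them reduces
  to convergence of weights and positions for almost every outcome.\<close>

definition weighted_law :: "'w measure \<Rightarrow> ('w \<Rightarrow> real) \<Rightarrow> ('w \<Rightarrow> 'a :: topological_space) \<Rightarrow> 'a measure" where
  "weighted_law M u X = distr (density M (\<lambda>\<omega>. ennreal (u \<omega> / (\<integral>\<omega>. u \<omega> \<partial>M)))) borel X"

lemma weighted_law:
  assumes "integrable M u" "\<And>\<omega>. 0 \<le> u \<omega>" "0 < (\<integral>\<omega>. u \<omega> \<partial>M)" "X \<in> borel_measurable M"
  shows "weighted_law M u X \<in> space (prob_algebra borel)"
    and "A \<in> sets borel \<Longrightarrow>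
      measure (weighted_law M u X) A = (\<integral>\<omega>. indicator A (X \<omega>) * u \<omega> \<partial>M) / (\<integral>\<omega>. u \<omega> \<partial>M)"
    and "f \<in> borel_measurable borel \<Longrightarrow>
      (\<integral>x. f x \<partial>weighted_law M u X) = (\<integral>\<omega>. u \<omega> * f (X \<omega>) \<partial>M) / (\<integral>\<omega>. u \<omega> \<partial>M)"
proof -
  let ?D = "density M (\<lambda>\<omega>. ennreal (u \<omega> / (\<integral>\<omega>. u \<omega> \<partial>M)))"
  interpret D: prob_space ?D by (rule density_normalized(1)[OF assms(1-3)])
  have X [measurable]: "X \<in> ?D \<rightarrow>\<^sub>M borel" using assms(4) by simp
  show "weighted_law M u X \<in> space (prob_algebra borel)"
    unfolding weighted_law_def using D.prob_space_distr[OF X] by (simp add: space_prob_algebra)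
  show "measure (weighted_law M u X) A = (\<integral>\<omega>. indicator A (X \<omega>) * u \<omega> \<partial>M) / (\<integral>\<omega>. u \<omega> \<partial>M)"
    if A: "A \<in> sets borel"
  proof -
    have "measure (weighted_law M u X) A = measure ?D (X -` A \<inter> space M)"
      unfolding weighted_law_def using A by (subst measure_distr[OF X]) simp_all
    also have "\<dots> = (\<integral>\<omega>. indicator (X -` A \<inter> space M) \<omega> * u \<omega> \<partial>M) / (\<integral>\<omega>. u \<omega> \<partial>M)"
      by (rule density_normalized(2)[OF assms(1-3)]) (rule measurable_sets[OF assms(4) A])
    also have "(\<integral>\<omega>. indicator (X -` A \<inter> space M) \<omega> * u \<omega> \<partial>M) = (\<integral>\<omega>. indicator A (X \<omega>) * u \<omega> \<partial>M)"
      by (rule Bochner_Integration.integral_cong) (auto simp: indicator_def)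
    finally show ?thesis .
  qed
  show "(\<integral>x. f x \<partial>weighted_law M u X) = (\<integral>\<omega>. u \<omega> * f (X \<omega>) \<partial>M) / (\<integral>\<omega>. u \<omega> \<partial>M)"
    if f: "f \<in> borel_measurable borel"
  proof -
    have "(\<integral>x. f x \<partial>weighted_law M u X) = (\<integral>\<omega>. f (X \<omega>) \<partial>?D)"
      unfolding weighted_law_def by (rule integral_distr[OF X f])
    also have "\<dots> = (\<integral>\<omega>. (u \<omega> / (\<integral>\<omega>. u \<omega> \<partial>M)) * f (X \<omega>) \<partial>M)"
      using assms f measurable_compose[OF assms(4) f]
      by (subst integral_density) (auto intro!: AE_I2 divide_nonneg_pos)
    also have "\<dots> = (\<integral>\<omega>. u \<omega> * f (X \<omega>) / (\<integral>\<omega>. u \<omega> \<partial>M) \<partial>M)"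
      by (rule Bochner_Integration.integral_cong) auto
    finally show ?thesis by simp
  qed
qed

text \<open>With a common weight, the pair \<open>(X, Y)\<close> under the tilted measure is already
  a coupling.\<close>

lemma wasserstein_weighted_law_le:
  fixes X Y :: "'w \<Rightarrow> ('n :: finite) torus"
  assumes a: "a > 0" and u: "integrable M u" and u0: "\<And>\<omega>. 0 \<le> u \<omega>" and pos: "0 < (\<integral>\<omega>. u \<omega> \<partial>M)"
    and X [measurable]: "X \<in> borel_measurable M" and Y [measurable]: "Y \<in> borel_measurable M"
  shows "wasserstein (rho a) (weighted_law M u X) (weighted_law M u Y)
    \<le> (\<integral>\<omega>. u \<omega> * rho a (X \<omega>) (Y \<omega>) \<partial>M) / (\<integral>\<omega>. u \<omega> \<partial>M)"
proof -
  have [measurable]: "u \<in> borel_measurable M" using u by simp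
  let ?D = "density M (\<lambda>\<omega>. ennreal (u \<omega> / (\<integral>\<omega>. u \<omega> \<partial>M)))"
  interpret D: prob_space ?D by (rule density_normalized(1)[OF u u0 pos])
  have XY: "(\<lambda>\<omega>. (X \<omega>, Y \<omega>)) \<in> ?D \<rightarrow>\<^sub>M borel \<Otimes>\<^sub>M borel" by simp
  have mX: "X \<in> ?D \<rightarrow>\<^sub>M borel" "Y \<in> ?D \<rightarrow>\<^sub>M borel" by simp_all
  define C where "C = distr ?D (borel \<Otimes>\<^sub>M borel) (\<lambda>\<omega>. (X \<omega>, Y \<omega>))"
  have C: "C \<in> couplings (weighted_law M u X) (weighted_law M u Y)"
    unfolding couplings_def
  proof (intro CollectI conjI)
    show "prob_space C" unfolding C_def by (rule D.prob_space_distr[OF XY])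
    show "sets C = sets (weighted_law M u X \<Otimes>\<^sub>M weighted_law M u Y)"
      unfolding C_def weighted_law_def by (simp cong: sets_pair_measure_cong)
    have "distr C (weighted_law M u X) fst = distr C borel fst"
      by (rule distr_cong) (simp_all add: weighted_law_def)
    also have "\<dots> = weighted_law M u X"
      unfolding C_def weighted_law_def by (subst distr_distr[OF measurable_fst XY]) (simp add: comp_def)
    finally show "distr C (weighted_law M u X) fst = weighted_law M u X" .
    have "distr C (weighted_law M u Y) snd = distr C borel snd"
      by (rule distr_cong) (simp_all add: weighted_law_def)
    also have "\<dots> = weighted_law M u Y"
      unfolding C_def weighted_law_def by (subst distr_distr[OF measurable_snd XY]) (simp add: comp_def)
    finally show "distr C (weighted_law M u Y) snd = weighted_law M u Y" .
  qed
  have "wasserstein (rho a) (weighted_law M u X) (weighted_law M u Y) \<le> (\<integral>z. rho a (fst z) (snd z) \<partial>C)"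
    by (rule wasserstein_le_coupling[OF C rho_nonneg[OF a]])
  also have "\<dots> = (\<integral>\<omega>. rho a (X \<omega>) (Y \<omega>) \<partial>?D)"
    unfolding C_def by (subst integral_distr[OF XY]) simp_all
  also have "\<dots> = (\<integral>\<omega>. (u \<omega> / (\<integral>\<omega>. u \<omega> \<partial>M)) * rho a (X \<omega>) (Y \<omega>) \<partial>M)"
    using u0 pos by (subst integral_density) (auto intro!: AE_I2 divide_nonneg_pos)
  also have "\<dots> = (\<integral>\<omega>. u \<omega> * rho a (X \<omega>) (Y \<omega>) / (\<integral>\<omega>. u \<omega> \<partial>M) \<partial>M)"
    by (rule Bochner_Integration.integral_cong) auto
  finally show ?thesis by simp
qed

text \<open>A vanishing integral would force \<open>v = 0\<close> almost everywhere, which a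
  probability excludes.\<close>

lemma integral_pos_01:
  fixes v :: "'a \<Rightarrow> real"
  assumes p: "prob_space M" and v: "v \<in> borel_measurable M" "\<And>x. 0 < v x" "\<And>x. v x \<le> 1"
  shows "integrable M v" "0 < (\<integral>x. v x \<partial>M)"
proof -
  interpret prob_space M by fact
  show i: "integrable M v" by (rule integral_01[OF p v(1)]) (simp_all add: v less_imp_le)
  have "(\<integral>x. v x \<partial>M) \<noteq> 0"
  proof
    assume "(\<integral>x. v x \<partial>M) = 0"
    moreover have "AE x in M. 0 \<le> v x" by (simp add: v less_imp_le)
    ultimately have "AE x in M. v x = 0" using integral_nonneg_eq_0_iff_AE[OF i] by simp
    moreover have "v x \<noteq> 0" for x using v(2)[of x] by simp
    ultimately show False by simp
  qed
  moreover have "0 \<le> (\<integral>x. v x \<partial>M)" by (simp add: v less_imp_le)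
  ultimately show "0 < (\<integral>x. v x \<partial>M)" by simp
qed

text \<open>Weights and positions are changed separately, through the law with the new weight and
  the limiting position: a coupling handles the positions, a partition the weights.\<close>

lemma weighted_law_convergence:
  fixes X :: "'w \<Rightarrow> ('n :: finite) torus"
  assumes p: "prob_space M" and a: "a > 0" and e: "e > 0"
    and X [measurable]: "X \<in> borel_measurable M" and Xn [measurable]: "\<And>n. Xn n \<in> borel_measurable M"
    and u [measurable]: "u \<in> borel_measurable M" and un [measurable]: "\<And>n. un n \<in> borel_measurable M"
    and u01: "\<And>\<omega>. 0 < u \<omega>" "\<And>\<omega>. u \<omega> \<le> 1" and un01: "\<And>n \<omega>. 0 < un n \<omega>" "\<And>n \<omega>. un n \<omega> \<le> 1"
    and limu: "AE \<omega> in M. (\<lambda>n. un n \<omega>) \<longlonglongrightarrow> u \<omega>"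
    and limX: "AE \<omega> in M. (\<lambda>n. dist (Xn n \<omega>) (X \<omega>)) \<longlonglongrightarrow> 0"
  shows "\<forall>\<^sub>F n in sequentially.
      wasserstein (rho a) (weighted_law M (un n) (Xn n)) (weighted_law M u X) \<le> e \<and>
      wasserstein (rho a) (weighted_law M u X) (weighted_law M (un n) (Xn n)) \<le> e"
proof -
  interpret prob_space M by fact
  note iu = integral_pos_01(1)[OF p u u01] and pu = integral_pos_01(2)[OF p u u01]
    and iun = integral_pos_01(1)[OF p un un01] and pun = integral_pos_01(2)[OF p un un01]
  have u0: "0 \<le> u \<omega>" "0 \<le> un n \<omega>" for \<omega> n using u01(1) un01(1) by (simp_all add: less_imp_le)
  note wl = weighted_law(1)[OF iu u0(1) pu X] and wln = weighted_law(1)[OF iun u0(2) pun X]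
    and wlnn = weighted_law(1)[OF iun u0(2) pun Xn]
  have Lu: "(\<lambda>n. \<integral>\<omega>. un n \<omega> \<partial>M) \<longlonglongrightarrow> (\<integral>\<omega>. u \<omega> \<partial>M)"
    by (rule integral_dominated_convergence[where w = "\<lambda>_. 1"]) (use limu u0 un01 in auto)
  \<comment> \<open>The position is held at \<open>X\<close>, so this works for every Borel set;
    boundaries of cells play no part as they would in weak convergence.\<close>
  have LA: "(\<lambda>n. measure (weighted_law M (un n) X) A) \<longlonglongrightarrow> measure (weighted_law M u X) A"
    if A [measurable]: "A \<in> sets borel" for A
  proof -
    have "(\<lambda>n. \<integral>\<omega>. indicator A (X \<omega>) * un n \<omega> \<partial>M) \<longlonglongrightarrow> (\<integral>\<omega>. indicator A (X \<omega>) * u \<omega> \<partial>M)"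
    proof (rule integral_dominated_convergence[where w = "\<lambda>_. 1"])
      show "AE \<omega> in M. (\<lambda>n. indicator A (X \<omega>) * un n \<omega>) \<longlonglongrightarrow> indicator A (X \<omega>) * u \<omega>"
        using limu by eventually_elim (intro tendsto_mult tendsto_const)
      show "AE \<omega> in M. norm (indicator A (X \<omega>) * un n \<omega>) \<le> 1" for n
        using u0 un01 by (auto simp: indicator_def)
    qed auto
    then show ?thesis
      unfolding weighted_law(2)[OF iu u0(1) pu X A] weighted_law(2)[OF iun u0(2) pun X A]
      using pu by (intro tendsto_divide Lu) auto
  qed
  have L\<rho>: "(\<lambda>n. (\<integral>\<omega>. un n \<omega> * rho a (Xn n \<omega>) (X \<omega>) \<partial>M) / (\<integral>\<omega>. un n \<omega> \<partial>M)) \<longlonglongrightarrow> 0"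
  proof -
    have "(\<lambda>n. \<integral>\<omega>. un n \<omega> * rho a (Xn n \<omega>) (X \<omega>) \<partial>M) \<longlonglongrightarrow> (\<integral>\<omega>. 0 \<partial>M)"
    proof (rule integral_dominated_convergence[where w = "\<lambda>_. 1 / a"])
      have b: "0 \<le> un n \<omega> * rho a (Xn n \<omega>) (X \<omega>)" "un n \<omega> * rho a (Xn n \<omega>) (X \<omega>) \<le> 1 * rho a (Xn n \<omega>) (X \<omega>)" for n \<omega>
        by (rule mult_nonneg_nonneg[OF u0(2) rho_nonneg[OF a]], rule mult_right_mono[OF un01(2) rho_nonneg[OF a]])
      have b': "un n \<omega> * rho a (Xn n \<omega>) (X \<omega>) \<le> dist (Xn n \<omega>) (X \<omega>)" for n \<omega>
        using b(2)[of n \<omega>] rho_le_dist[OF a, of "Xn n \<omega>" "X \<omega>"] by linarith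
      show "AE \<omega> in M. (\<lambda>n. un n \<omega> * rho a (Xn n \<omega>) (X \<omega>)) \<longlonglongrightarrow> 0"
        using limX
      proof eventually_elim
        case (elim \<omega>)
        show ?case
          by (rule tendsto_sandwich[OF _ _ tendsto_const elim])
            (use b(1) b' in \<open>auto intro!: always_eventually\<close>)
      qed
      show "AE \<omega> in M. norm (un n \<omega> * rho a (Xn n \<omega>) (X \<omega>)) \<le> 1 / a" for n
      proof (rule AE_I2)
        fix \<omega>
        show "norm (un n \<omega> * rho a (Xn n \<omega>) (X \<omega>)) \<le> 1 / a"
          using b[of n \<omega>] rho_le_inverse[OF a, of "Xn n \<omega>" "X \<omega>"] by simp
      qed
    qed auto
    then have "(\<lambda>n. (\<integral>\<omega>. un n \<omega> * rho a (Xn n \<omega>) (X \<omega>) \<partial>M) / (\<integral>\<omega>. un n \<omega> \<partial>M)) \<longlonglongrightarrow> 0 / (\<integral>\<omega>. u \<omega> \<partial>M)"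
      using pu by (intro tendsto_divide Lu) auto
    then show ?thesis by simp
  qed
  have e3: "e / 3 > 0" using e by simp
  obtain idx :: "'n torus \<Rightarrow> nat" and m where idx: "idx \<in> measurable borel (count_space UNIV)"
    "\<And>x. idx x < m" "\<And>x y. idx x = idx y \<Longrightarrow> dist x y \<le> e / 3"
    using torus_partition[OF e3] by metis
  have cell: "{x. idx x = i} \<in> sets borel" for i
  proof -
    have "{x \<in> space borel. idx x = i} \<in> sets borel" using idx(1) by measurable
    then show ?thesis by simp
  qed
  let ?S = "\<lambda>n. (\<Sum>i<m. \<bar>measure (weighted_law M (un n) X) {x. idx x = i} - measure (weighted_law M u X) {x. idx x = i}\<bar>) / a"
  have "?S \<longlonglongrightarrow> (\<Sum>i<m. \<bar>measure (weighted_law M u X) {x. idx x = i} - measure (weighted_law M u X) {x. idx x = i}\<bar>) / a"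
    using a by (intro tendsto_divide tendsto_const tendsto_sum tendsto_rabs tendsto_diff LA cell) auto
  then have "?S \<longlonglongrightarrow> 0" by simp
  from order_tendstoD(2)[OF this e3] order_tendstoD(2)[OF L\<rho> e3]
  show ?thesis
  proof eventually_elim
    \<comment> \<open>One third of \<open>e\<close> each for the mesh of the partition, the masses
      of the cells and the positions.\<close>
    case (elim n)
    have "wasserstein (rho a) (weighted_law M (un n) X) (weighted_law M u X) \<le> e / 3 + ?S n"
      using e3 by (intro wasserstein_le_partition[OF a _ wln wl idx]) auto
    moreover have "wasserstein (rho a) (weighted_law M (un n) (Xn n)) (weighted_law M (un n) X) \<le> e / 3"
      using wasserstein_weighted_law_le[OF a iun u0(2) pun Xn X, of n n] elim(2) by linarith
    moreover have "wasserstein (rho a) (weighted_law M (un n) (Xn n)) (weighted_law M u X)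
        \<le> wasserstein (rho a) (weighted_law M (un n) (Xn n)) (weighted_law M (un n) X)
          + wasserstein (rho a) (weighted_law M (un n) X) (weighted_law M u X)"
      by (rule wasserstein_triangle[OF a wlnn wln wl])
    moreover have "wasserstein (rho a) (weighted_law M u X) (weighted_law M (un n) X) \<le> e / 3 + ?S n"
      unfolding abs_minus_commute[of "measure (weighted_law M (un n) X) _"]
      using e3 by (intro wasserstein_le_partition[OF a _ wl wln idx]) auto
    moreover have "wasserstein (rho a) (weighted_law M (un n) X) (weighted_law M (un n) (Xn n)) \<le> e / 3"
      using wasserstein_weighted_law_le[OF a iun u0(2) pun X Xn, of n n] elim(2)
      unfolding rho_commute[of a "X _"] by linarith
    moreover have "wasserstein (rho a) (weighted_law M u X) (weighted_law M (un n) (Xn n))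
        \<le> wasserstein (rho a) (weighted_law M u X) (weighted_law M (un n) X)
          + wasserstein (rho a) (weighted_law M (un n) X) (weighted_law M (un n) (Xn n))"
      by (rule wasserstein_triangle[OF a wl wln wlnn])
    ultimately show ?case using elim(1) by linarith
  qed
qed

text \<open>Used for the clock against the path of \<open>Z\<close> and for the initial point
  against the path of \<open>B\<close>: a function of the path then splits off as a product factor,
  which opens the way to Fubini.\<close>

lemma indep_rv_distr:
  assumes p: "prob_space M" and ind: "indep_rv M S X S' Y"
    and f: "f \<in> S \<rightarrow>\<^sub>M T" and g: "g \<in> S' \<rightarrow>\<^sub>M T'"
  shows "distr M (T \<Otimes>\<^sub>M T') (\<lambda>\<omega>. (f (X \<omega>), g (Y \<omega>)))
    = distr M T (\<lambda>\<omega>. f (X \<omega>)) \<Otimes>\<^sub>M distr M T' (\<lambda>\<omega>. g (Y \<omega>))"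
proof (rule pair_measure_eqI[symmetric])
  interpret prob_space M by fact
  have X: "X \<in> M \<rightarrow>\<^sub>M S" and Y: "Y \<in> M \<rightarrow>\<^sub>M S'"
    and I: "indep_set {X -` A \<inter> space M | A. A \<in> sets S} {Y -` A \<inter> space M | A. A \<in> sets S'}"
    using ind by (auto simp: indep_rv_def)
  note fX = measurable_compose[OF X f] and gY = measurable_compose[OF Y g]
  show "sigma_finite_measure (distr M T (\<lambda>\<omega>. f (X \<omega>)))" "sigma_finite_measure (distr M T' (\<lambda>\<omega>. g (Y \<omega>)))"
    using prob_space_distr[OF fX] prob_space_distr[OF gY]
    by (auto intro: prob_space_imp_sigma_finite)
  show "sets (distr M T (\<lambda>\<omega>. f (X \<omega>)) \<Otimes>\<^sub>M distr M T' (\<lambda>\<omega>. g (Y \<omega>)))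
      = sets (distr M (T \<Otimes>\<^sub>M T') (\<lambda>\<omega>. (f (X \<omega>), g (Y \<omega>))))"
    by (simp cong: sets_pair_measure_cong)
  fix A B assume "A \<in> sets (distr M T (\<lambda>\<omega>. f (X \<omega>)))" "B \<in> sets (distr M T' (\<lambda>\<omega>. g (Y \<omega>)))"
  then have A: "A \<in> sets T" and B: "B \<in> sets T'" by auto
  define a where "a = (\<lambda>\<omega>. f (X \<omega>)) -` A \<inter> space M"
  define b where "b = (\<lambda>\<omega>. g (Y \<omega>)) -` B \<inter> space M"
  have a: "a = X -` (f -` A \<inter> space S) \<inter> space M" using measurable_space[OF X] by (auto simp: a_def)
  have b: "b = Y -` (g -` B \<inter> space S') \<inter> space M" using measurable_space[OF Y] by (auto simp: b_def)
  have "prob (a \<inter> b) = prob a * prob b"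
    by (rule indep_setD[OF I]) (use a b measurable_sets[OF f A] measurable_sets[OF g B] in blast)+
  moreover have "(\<lambda>\<omega>. (f (X \<omega>), g (Y \<omega>))) -` (A \<times> B) \<inter> space M = a \<inter> b" by (auto simp: a_def b_def)
  ultimately show "emeasure (distr M T (\<lambda>\<omega>. f (X \<omega>))) A * emeasure (distr M T' (\<lambda>\<omega>. g (Y \<omega>))) B
      = emeasure (distr M (T \<Otimes>\<^sub>M T') (\<lambda>\<omega>. (f (X \<omega>), g (Y \<omega>)))) (A \<times> B)"
    using A B fX gY by (simp add: emeasure_distr a_def[symmetric] b_def[symmetric] emeasure_eq_measure ennreal_mult)
qed

lemma prob_algebra_borel_eqI:
  assumes "\<mu> \<in> space (prob_algebra borel)" "\<nu> \<in> space (prob_algebra borel)"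
    and "\<And>A. A \<in> sets borel \<Longrightarrow> measure \<mu> A = measure \<nu> A"
  shows "\<mu> = \<nu>"
proof (rule measure_eqI)
  have p: "prob_space \<mu>" "prob_space \<nu>" and s: "sets \<mu> = sets borel" "sets \<nu> = sets borel"
    using assms by (auto simp: space_prob_algebra)
  interpret m: prob_space \<mu> by fact
  interpret n: prob_space \<nu> by fact
  show "sets \<mu> = sets \<nu>" using s by simp
  fix A assume "A \<in> sets \<mu>"
  then show "emeasure \<mu> A = emeasure \<nu> A"
    using assms(3)[of A] s by (simp add: m.emeasure_eq_measure n.emeasure_eq_measure)
qed

text \<open>The values \<open>u j\<close> need not be values of \<open>h\<close>. Thus one induction
  serves for Riemann sums of a continuous function and for the sums of the drift and of
  \<open>lam\<close> along the Euler scheme.\<close>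

lemma riemann_sum_error:
  fixes h :: "real \<Rightarrow> 'e :: banach"
  assumes \<gamma>: "0 \<le> \<gamma>" and h: "continuous_on {0..real k * \<gamma>} h"
    and u: "\<And>j s. j < k \<Longrightarrow> real j * \<gamma> \<le> s \<Longrightarrow> s \<le> real (Suc j) * \<gamma> \<Longrightarrow> norm (u j - h s) \<le> c j"
  shows "norm (\<gamma> *\<^sub>R (\<Sum>j<k. u j) - integral {0..real k * \<gamma>} h) \<le> \<gamma> * (\<Sum>j<k. c j)"
  using h u
proof (induction k)
  case (Suc k)
  let ?p = "real k * \<gamma>" and ?q = "real (Suc k) * \<gamma>"
  have pq: "0 \<le> ?p" "?p \<le> ?q" using \<gamma> by (simp_all add: algebra_simps)
  have c1: "continuous_on {0..?p} h" and c2: "continuous_on {?p..?q} h"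
    using Suc.prems(1) pq by (auto intro: continuous_on_subset)
  have IH: "norm (\<gamma> *\<^sub>R (\<Sum>j<k. u j) - integral {0..?p} h) \<le> \<gamma> * (\<Sum>j<k. c j)"
    using c1 Suc.prems(2) by (intro Suc.IH) auto
  have split: "integral {0..?q} h = integral {0..?p} h + integral {?p..?q} h"
    using Henstock_Kurzweil_Integration.integral_combine[OF pq integrable_continuous_real[OF Suc.prems(1)]] by simp
  have "integral {?p..?q} (\<lambda>s. u k - h s) = integral {?p..?q} (\<lambda>s. u k) - integral {?p..?q} h"
    by (intro Henstock_Kurzweil_Integration.integral_diff integrable_continuous_real c2 continuous_on_const)
  also have "integral {?p..?q} (\<lambda>s. u k) = \<gamma> *\<^sub>R u k"
    using pq by (simp add: algebra_simps)
  finally have "\<gamma> *\<^sub>R u k - integral {?p..?q} h = integral {?p..?q} (\<lambda>s. u k - h s)" by simp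
  moreover have "norm (integral {?p..?q} (\<lambda>s. u k - h s)) \<le> c k * (?q - ?p)"
    using Suc.prems(2)[of k]
    by (intro integral_bound pq continuous_on_diff continuous_on_const c2) auto
  moreover have "?q - ?p = \<gamma>" by (simp add: algebra_simps)
  ultimately have step: "norm (\<gamma> *\<^sub>R u k - integral {?p..?q} h) \<le> \<gamma> * c k" by (simp add: mult.commute)
  have "\<gamma> *\<^sub>R (\<Sum>j<Suc k. u j) - integral {0..?q} h
      = (\<gamma> *\<^sub>R (\<Sum>j<k. u j) - integral {0..?p} h) + (\<gamma> *\<^sub>R u k - integral {?p..?q} h)"
    unfolding split by (simp add: scaleR_add_right)
  also have "norm \<dots> \<le> norm (\<gamma> *\<^sub>R (\<Sum>j<k. u j) - integral {0..?p} h) + norm (\<gamma> *\<^sub>R u k - integral {?p..?q} h)"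
    by (rule norm_triangle_ineq)
  also have "\<dots> \<le> \<gamma> * (\<Sum>j<k. c j) + \<gamma> * c k" using IH step by linarith
  finally show ?case by (simp add: distrib_left)
qed simp

lemma eventually_small_oscillation:
  fixes h :: "real \<Rightarrow> 'e :: metric_space"
  assumes "continuous_on {0..t} h" "e > 0"
  shows "\<forall>\<^sub>F n in sequentially. \<forall>s\<in>{0..t}. \<forall>s'\<in>{0..t}. \<bar>s - s'\<bar> \<le> t / real (Suc n) \<longrightarrow> dist (h s) (h s') \<le> e"
proof -
  have "uniformly_continuous_on {0..t} h" by (rule compact_uniformly_continuous[OF assms(1) compact_Icc])
  then obtain d where d: "d > 0" "\<And>s s'. s \<in> {0..t} \<Longrightarrow> s' \<in> {0..t} \<Longrightarrow> dist s' s < d \<Longrightarrow> dist (h s') (h s) < e"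
    using assms(2) unfolding uniformly_continuous_on_def by metis
  have "(\<lambda>n. t / real (Suc n)) \<longlonglongrightarrow> 0" by (rule LIMSEQ_Suc[OF lim_const_over_n])
  from order_tendstoD(2)[OF this d(1)] show ?thesis
  proof eventually_elim
    case (elim n)
    show ?case
    proof (intro ballI impI)
      fix s s' assume s: "s \<in> {0..t}" "s' \<in> {0..t}" "\<bar>s - s'\<bar> \<le> t / real (Suc n)"
      then have "dist s s' < d" using elim by (simp add: dist_real_def)
      from d(2)[OF s(2,1) this] show "dist (h s) (h s') \<le> e" by simp
    qed
  qed
qed

lemma riemann_sum_tendsto:
  fixes h :: "real \<Rightarrow> real"
  assumes t: "0 \<le> t" and h: "continuous_on {0..t} h"
  shows "(\<lambda>n. t / real (Suc n) * (\<Sum>j<Suc n. h (real j * (t / real (Suc n))))) \<longlonglongrightarrow> integral {0..t} h"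
proof (rule metric_LIMSEQ_I)
  fix e :: real assume "e > 0"
  \<comment> \<open>\<open>t + 1\<close> instead of \<open>t\<close> covers \<open>t = 0\<close> and
    makes the final inequality strict.\<close>
  then have e: "e / (t + 1) > 0" using t by simp
  from eventually_small_oscillation[OF h e]
  have "\<forall>\<^sub>F n in sequentially. dist (t / real (Suc n) * (\<Sum>j<Suc n. h (real j * (t / real (Suc n))))) (integral {0..t} h) < e"
  proof eventually_elim
    case (elim n)
    let ?g = "t / real (Suc n)"
    have g: "0 \<le> ?g" "real (Suc n) * ?g = t" using t by simp_all
    have le: "real j * ?g \<le> t" if "j \<le> Suc n" for j
      using mult_right_mono[OF _ g(1), of "real j" "real (Suc n)"] that g(2) by simp
    have "norm (?g *\<^sub>R (\<Sum>j<Suc n. h (real j * ?g)) - integral {0..real (Suc n) * ?g} h) \<le> ?g * (\<Sum>j<Suc n. e / (t + 1))"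
    proof (rule riemann_sum_error[OF g(1)])
      show "continuous_on {0..real (Suc n) * ?g} h" unfolding g(2) by (rule h)
      fix j s assume j: "j < Suc n" and s: "real j * ?g \<le> s" "s \<le> real (Suc j) * ?g"
      have 0: "0 \<le> real j * ?g" by (rule mult_nonneg_nonneg[OF of_nat_0_le_iff g(1)])
      have "\<bar>real j * ?g - s\<bar> \<le> ?g" using s by (simp add: distrib_right del: times_divide_eq_right)
      moreover have "real j * ?g \<in> {0..t}" "s \<in> {0..t}"
        using 0 s le[of j] le[of "Suc j"] j by (auto simp del: of_nat_Suc times_divide_eq_right)
      ultimately have "dist (h (real j * ?g)) (h s) \<le> e / (t + 1)" using elim by blast
      then show "norm (h (real j * ?g) - h s) \<le> e / (t + 1)" by (simp only: dist_norm)
    qed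
    also have "\<dots> = t * (e / (t + 1))" by simp
    also have "\<dots> < e" using \<open>e > 0\<close> t by (simp add: field_simps)
    finally show ?case unfolding g(2) by (simp add: dist_norm)
  qed
  then show "\<exists>N. \<forall>n\<ge>N. dist (t / real (Suc n) * (\<Sum>j<Suc n. h (real j * (t / real (Suc n))))) (integral {0..t} h) < e"
    by (simp only: eventually_sequentially)
qed

text \<open>The delicate direction is from right to left, since the killing time is an infimum.
  Continuity of the accumulated rate gives an \<open>r > t\<close> still below \<open>E\<close>, and
  monotonicity makes this \<open>r\<close> a lower bound of the killing set.\<close>

lemma less_killing_time_iff:
  assumes Z: "continuous_on {0..} (\<lambda>t. Z t \<omega>)" and lam: "continuous_on UNIV lam"
    and lam0: "\<And>x. 0 \<le> lam x" and t: "0 \<le> t"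
  shows "ereal t < killing_time lam Z E \<omega> \<longleftrightarrow> integral {0..t} (\<lambda>s. lam (Z s \<omega>)) < E \<omega>"
proof -
  define \<Lambda> where "\<Lambda> r = integral {0..r} (\<lambda>s. lam (Z s \<omega>))" for r
  have c: "continuous_on {0..r} (\<lambda>s. lam (Z s \<omega>))" for r
    by (rule continuous_on_compose2[OF lam]) (auto intro: continuous_on_subset[OF Z])
  have mono: "\<Lambda> r \<le> \<Lambda> r'" if "r \<le> r'" for r r'
    unfolding \<Lambda>_def by (rule integral_subset_le) (use that lam0 c in \<open>auto intro: integrable_continuous_real\<close>)
  show ?thesis
  proof
    assume less: "ereal t < killing_time lam Z E \<omega>"
    show "integral {0..t} (\<lambda>s. lam (Z s \<omega>)) < E \<omega>"
    proof (rule ccontr)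
      assume "\<not> ?thesis"
      then have "killing_time lam Z E \<omega> \<le> ereal t"
        unfolding killing_time_def using t by (intro Inf_lower) auto
      with less show False by simp
    qed
  next
    assume less: "integral {0..t} (\<lambda>s. lam (Z s \<omega>)) < E \<omega>"
    have "continuous_on {0..t + 1} \<Lambda>"
      unfolding \<Lambda>_def by (rule indefinite_integral_continuous_1) (rule integrable_continuous_real[OF c])
    then have "continuous (at t within {0..t + 1}) \<Lambda>"
      using t by (simp add: continuous_on_eq_continuous_within)
    then have "\<forall>\<^sub>F r in at t within {0..t + 1}. \<Lambda> r < E \<omega>"
      using less unfolding continuous_within \<Lambda>_def[symmetric] by (rule order_tendstoD(2))
    then obtain d where d: "d > 0" "\<And>r. r \<in> {0..t + 1} \<Longrightarrow> r \<noteq> t \<Longrightarrow> dist r t < d \<Longrightarrow> \<Lambda> r < E \<omega>"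
      unfolding eventually_at by auto
    \<comment> \<open>The minimum with 1 keeps \<open>r\<close> in the interval on which continuity
      was established.\<close>
    define r where "r = t + min 1 (d / 2)"
    have r: "t < r" "\<Lambda> r < E \<omega>"
      using d t by (auto simp: r_def dist_real_def min_def intro!: d(2))
    have "ereal r \<le> killing_time lam Z E \<omega>"
      unfolding killing_time_def
    proof (rule Inf_greatest)
      fix x assume "x \<in> {ereal s |s. 0 \<le> s \<and> E \<omega> \<le> integral {0..s} (\<lambda>s. lam (Z s \<omega>))}"
      then obtain s where s: "x = ereal s" "E \<omega> \<le> \<Lambda> s" by (auto simp: \<Lambda>_def)
      then show "ereal r \<le> x" using r(2) mono[of s r] by (cases "r \<le> s") auto
    qed
    with r(1) show "ereal t < killing_time lam Z E \<omega>" by (meson less_ereal.simps(1) less_le_trans)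
  qed
qed

text \<open>The clock is independent of the path and exceeds \<open>c \<ge> 0\<close> with
  probability \<open>exp (- c)\<close>; integrating it out turns conditioning on survival into a
  weight on paths.\<close>

lemma survival_law_eq:
  fixes Z :: "real \<Rightarrow> 'w \<Rightarrow> ('n :: finite) torus"
  assumes K: "killed_diffusion M b B Z E" and lip: "L-lipschitz_on UNIV lam"
    and lam0: "\<And>x. 0 \<le> lam x" and t: "0 \<le> t"
  shows "survival_law M lam Z E t
      = weighted_law M (\<lambda>\<omega>. exp (- integral {0..t} (\<lambda>s. lam (Z s \<omega>)))) (Z t)"
    and "(\<lambda>\<omega>. integral {0..t} (\<lambda>s. lam (Z s \<omega>))) \<in> borel_measurable M"
proof -
  have D: "torus_diffusion M b B Z" and Ed: "distributed M lborel E (exponential_density 1)"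
    and ind: "indep_rv M borel E (PiM {0..} (\<lambda>_. borel)) (path_of Z)"
    using K by (auto simp: killed_diffusion_def)
  have p: "prob_space M" and Zm: "\<And>t. t \<ge> 0 \<Longrightarrow> Z t \<in> borel_measurable M"
    and Zc: "\<And>\<omega>. \<omega> \<in> space M \<Longrightarrow> continuous_on {0..} (\<lambda>t. Z t \<omega>)"
    using D by (auto simp: torus_diffusion_def brownian_motion_def)
  interpret prob_space M by (rule p)
  have lc: "continuous_on UNIV lam" by (rule lipschitz_on_continuous_on[OF lip])
  have lm [measurable]: "lam \<in> borel_measurable borel" by (rule borel_measurable_continuous_onI[OF lc])
  note Zt [measurable] = Zm[OF t]
  have Em [measurable]: "E \<in> borel_measurable M" using Ed by (simp add: distributed_def)
  let ?PT = "PiM {0..} (\<lambda>_. borel) :: (real \<Rightarrow> 'n torus) measure"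
  \<comment> \<open>Independence is stated for \<open>path_of Z\<close> in a product space, whose
    measurable sets see only countably many times. The integral is therefore recovered as a limit of
    Riemann sums, which is measurable there.\<close>
  define R where "R n x = t / real (Suc n) * (\<Sum>j<Suc n. lam (x (real j * (t / real (Suc n)))))"
    for n and x :: "real \<Rightarrow> 'n torus"
  define \<Lambda>p where "\<Lambda>p x = lim (\<lambda>n. R n x)" for x
  define \<Lambda> where "\<Lambda> \<omega> = integral {0..t} (\<lambda>s. lam (Z s \<omega>))" for \<omega>
  have comp: "(\<lambda>x. x s) \<in> ?PT \<rightarrow>\<^sub>M borel" if "0 \<le> s" for s
    by (rule measurable_component_singleton) (use that in simp)
  have "R n \<in> borel_measurable ?PT" for n
    unfolding R_def using t
    by (intro borel_measurable_times borel_measurable_const borel_measurable_sum measurable_compose[OF comp lm]) simp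
  then have \<Lambda>pm [measurable]: "\<Lambda>p \<in> borel_measurable ?PT"
    unfolding \<Lambda>p_def by (intro borel_measurable_lim_metric)
  have \<Lambda>p: "\<Lambda>p (path_of Z \<omega>) = \<Lambda> \<omega>" if "\<omega> \<in> space M" for \<omega>
  proof -
    have "continuous_on {0..t} (\<lambda>s. lam (Z s \<omega>))"
      by (rule continuous_on_compose2[OF lc]) (auto intro: continuous_on_subset[OF Zc[OF that]])
    from riemann_sum_tendsto[OF t this]
    have "(\<lambda>n. R n (path_of Z \<omega>)) \<longlonglongrightarrow> \<Lambda> \<omega>"
      using t by (simp add: R_def \<Lambda>_def path_of_def)
    then show ?thesis unfolding \<Lambda>p_def by (rule limI)
  qed
  have path [measurable]: "path_of Z \<in> M \<rightarrow>\<^sub>M ?PT" using ind by (simp add: indep_rv_def)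
  have \<Lambda>m [measurable]: "\<Lambda> \<in> borel_measurable M"
    using measurable_compose[OF path \<Lambda>pm] by (subst measurable_cong[OF \<Lambda>p[symmetric]]) simp_all
  then show "(\<lambda>\<omega>. integral {0..t} (\<lambda>s. lam (Z s \<omega>))) \<in> borel_measurable M" by (simp only: \<Lambda>_def[abs_def])
  \<comment> \<open>This is wanted for every outcome, also outside \<open>space M\<close>, where the
    path need not be continuous. If the integral fails to exist, its value is 0 by
    convention.\<close>
  have \<Lambda>0: "0 \<le> \<Lambda> \<omega>" for \<omega> unfolding \<Lambda>_def
    by (cases "(\<lambda>s. lam (Z s \<omega>)) integrable_on {0..t}")
      (auto intro: Henstock_Kurzweil_Integration.integral_nonneg lam0 simp: not_integrable_integral)
  define f where "f x = (\<Lambda>p x, x t)" for x :: "real \<Rightarrow> 'n torus"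
  have pt: "path_of Z \<omega> t = Z t \<omega>" for \<omega> using t by (simp add: path_of_def)
  have fm: "f \<in> ?PT \<rightarrow>\<^sub>M borel \<Otimes>\<^sub>M borel" unfolding f_def by (intro measurable_Pair \<Lambda>pm comp t)
  define N where "N = distr M (borel \<Otimes>\<^sub>M borel) (\<lambda>\<omega>. (\<Lambda> \<omega>, Z t \<omega>))"
  have LZ: "(\<lambda>\<omega>. (\<Lambda> \<omega>, Z t \<omega>)) \<in> M \<rightarrow>\<^sub>M borel \<Otimes>\<^sub>M borel" by measurable
  have N: "distr M (borel \<Otimes>\<^sub>M borel) (\<lambda>\<omega>. f (path_of Z \<omega>)) = N"
    unfolding N_def by (intro distr_cong refl) (simp add: f_def \<Lambda>p pt)
  have joint: "distr M (borel \<Otimes>\<^sub>M (borel \<Otimes>\<^sub>M borel)) (\<lambda>\<omega>. (E \<omega>, (\<Lambda> \<omega>, Z t \<omega>))) = distr M borel E \<Otimes>\<^sub>M N"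
  proof -
    have "distr M (borel \<Otimes>\<^sub>M (borel \<Otimes>\<^sub>M borel)) (\<lambda>\<omega>. (E \<omega>, (\<Lambda> \<omega>, Z t \<omega>)))
        = distr M (borel \<Otimes>\<^sub>M (borel \<Otimes>\<^sub>M borel)) (\<lambda>\<omega>. (E \<omega>, f (path_of Z \<omega>)))"
      by (intro distr_cong refl) (simp add: f_def \<Lambda>p pt)
    also have "\<dots> = distr M borel E \<Otimes>\<^sub>M N"
      using indep_rv_distr[OF p ind measurable_ident fm] N by simp
    finally show ?thesis .
  qed
  have pN: "prob_space N" unfolding N_def by (rule prob_space_distr[OF LZ])
  have pE: "prob_space (distr M borel E)" by (rule prob_space_distr[OF Em])
  interpret N: prob_space N by (rule pN)
  interpret DE: prob_space "distr M borel E" by (rule pE)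
  interpret EN: pair_sigma_finite "distr M borel E" N ..
  have Egt: "emeasure (distr M borel E) {e. c < e} = ennreal (exp (- c))" if "0 \<le> c" for c
  proof -
    have "emeasure (distr M borel E) {e. c < e} = emeasure M {\<omega> \<in> space M. c < E \<omega>}"
      by (subst emeasure_distr) (auto simp: vimage_def Int_def conj_commute)
    then show ?thesis
      using exponential_distributedD_gt[OF Ed that] by (simp add: emeasure_eq_measure)
  qed
  define S where "S = {\<omega> \<in> space M. ereal t < killing_time lam Z E \<omega>}"
  have S: "S = {\<omega> \<in> space M. \<Lambda> \<omega> < E \<omega>}"
    unfolding S_def \<Lambda>_def using less_killing_time_iff[of Z _ lam t E, OF Zc lc lam0 t] by auto
  have Sm: "S \<in> sets M" unfolding S by measurable
  define u where "u \<omega> = exp (- \<Lambda> \<omega>)" for \<omega>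
  have um [measurable]: "u \<in> borel_measurable M" unfolding u_def by measurable
  have u01: "0 < u \<omega>" "u \<omega> \<le> 1" for \<omega> using \<Lambda>0 by (simp_all add: u_def)
  \<comment> \<open>Fubini with the clock innermost: for a fixed path the section is the event that
    the clock exceeds \<open>\<Lambda> \<omega>\<close>. With \<open>A = UNIV\<close> the same
    identity supplies the normalisation.\<close>
  have key: "measure M (Z t -` A \<inter> S) = (\<integral>\<omega>. indicator A (Z t \<omega>) * u \<omega> \<partial>M)" if A [measurable]: "A \<in> sets borel" for A
  proof -
    let ?T = "{y \<in> space ((borel :: real measure) \<Otimes>\<^sub>M ((borel :: real measure) \<Otimes>\<^sub>M borel)). fst (snd y) < fst y \<and> snd (snd y) \<in> A}"
    have T: "?T \<in> sets (borel \<Otimes>\<^sub>M (borel \<Otimes>\<^sub>M borel))" by measurable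
    have "emeasure M (Z t -` A \<inter> S) = emeasure (distr M (borel \<Otimes>\<^sub>M (borel \<Otimes>\<^sub>M borel)) (\<lambda>\<omega>. (E \<omega>, (\<Lambda> \<omega>, Z t \<omega>)))) ?T"
      by (subst emeasure_distr[OF _ T]) (auto simp: S space_pair_measure intro!: arg_cong[where f = "emeasure M"])
    also have "\<dots> = (\<integral>\<^sup>+y. emeasure (distr M borel E) ((\<lambda>x. (x, y)) -` ?T) \<partial>N)"
      unfolding joint using T by (intro EN.emeasure_pair_measure_alt2) (simp add: N_def cong: sets_pair_measure_cong)
    also have "\<dots> = (\<integral>\<^sup>+\<omega>. emeasure (distr M borel E) ((\<lambda>x. (x, (\<Lambda> \<omega>, Z t \<omega>))) -` ?T) \<partial>M)"
    proof -
      have "(\<lambda>y. emeasure (distr M borel E) ((\<lambda>x. (x, y)) -` ?T)) \<in> borel_measurable N"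
        by (rule EN.measurable_emeasure_Pair2) (use T in \<open>simp add: N_def cong: sets_pair_measure_cong\<close>)
      then show ?thesis unfolding N_def by (subst nn_integral_distr[OF LZ]) simp_all
    qed
    also have "\<dots> = (\<integral>\<^sup>+\<omega>. ennreal (indicator A (Z t \<omega>) * u \<omega>) \<partial>M)"
    proof (rule nn_integral_cong)
      fix \<omega>
      have "(\<lambda>x. (x, (\<Lambda> \<omega>, Z t \<omega>))) -` ?T = (if Z t \<omega> \<in> A then {e. \<Lambda> \<omega> < e} else {})"
        by (auto simp: space_pair_measure)
      then show "emeasure (distr M borel E) ((\<lambda>x. (x, (\<Lambda> \<omega>, Z t \<omega>))) -` ?T) = ennreal (indicator A (Z t \<omega>) * u \<omega>)"
        using Egt[OF \<Lambda>0] by (simp add: u_def)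
    qed
    also have "\<dots> = ennreal (\<integral>\<omega>. indicator A (Z t \<omega>) * u \<omega> \<partial>M)"
      using u01 by (intro integral_01(4)[OF p, symmetric]) (auto simp: indicator_def less_imp_le)
    finally show ?thesis
      using u01 by (simp add: less_imp_le emeasure_eq_measure Bochner_Integration.integral_nonneg)
  qed
  have "S = Z t -` UNIV \<inter> S" by auto
  with key[of UNIV] have PS: "measure M S = (\<integral>\<omega>. u \<omega> \<partial>M)" by simp
  note ui = integral_pos_01(1)[OF p um u01] and pos = integral_pos_01(2)[OF p um u01]
  have S0: "emeasure M S \<noteq> 0" "emeasure M S \<noteq> \<infinity>"
    using pos PS by (simp_all add: emeasure_eq_measure)
  interpret U: prob_space "uniform_measure M S" by (rule prob_space_uniform_measure[OF S0])
  have ZU: "Z t \<in> uniform_measure M S \<rightarrow>\<^sub>M borel" by simp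
  have u0: "0 \<le> u \<omega>" for \<omega> using u01(1) by (simp add: less_imp_le)
  have "survival_law M lam Z E t = weighted_law M u (Z t)"
  proof (rule prob_algebra_borel_eqI)
    show "survival_law M lam Z E t \<in> space (prob_algebra borel)"
      unfolding survival_law_def S_def[symmetric] using U.prob_space_distr[OF ZU] by (simp add: space_prob_algebra)
    show "weighted_law M u (Z t) \<in> space (prob_algebra borel)" by (rule weighted_law(1)[OF ui u0 pos Zt])
    fix A :: "'n torus set" assume A: "A \<in> sets borel"
    have ZA: "Z t -` A \<inter> space M \<in> sets M" using Zt A by (rule measurable_sets)
    have "measure (survival_law M lam Z E t) A = measure (uniform_measure M S) (Z t -` A \<inter> space M)"
      unfolding survival_law_def S_def[symmetric] using A by (subst measure_distr[OF ZU]) simp_all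
    also have "\<dots> = measure M (S \<inter> (Z t -` A \<inter> space M)) / measure M S"
      by (rule measure_uniform_measure[OF S0 ZA])
    also have "S \<inter> (Z t -` A \<inter> space M) = Z t -` A \<inter> S" by (auto simp: S)
    finally show "measure (survival_law M lam Z E t) A = measure (weighted_law M u (Z t)) A"
      unfolding key[OF A] PS weighted_law(2)[OF ui u0 pos Zt A] .
  qed
  then show "survival_law M lam Z E t = weighted_law M (\<lambda>\<omega>. exp (- integral {0..t} (\<lambda>s. lam (Z s \<omega>)))) (Z t)"
    unfolding u_def[abs_def] \<Lambda>_def .
qed

section \<open>The law of the Euler scheme\<close>

text \<open>The noise is a sequence of ready-made increments, so the same recursion is analysed in
  law for iid Gaussian increments and pathwise for increments of the driving Brownian
  motion.\<close>

primrec euler :: "(('n :: finite) torus \<Rightarrow> real ^ 'n) \<Rightarrow> real \<Rightarrow> 'n torus \<Rightarrow> (nat \<Rightarrow> real ^ 'n) \<Rightarrow> nat \<Rightarrow> 'n torus" where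
  "euler b \<gamma> x \<xi> 0 = x"
| "euler b \<gamma> x \<xi> (Suc k) = torus_shift (euler b \<gamma> x \<xi> k) (\<gamma> *\<^sub>R b (euler b \<gamma> x \<xi> k) + \<xi> k)"

text \<open>The positions after steps 1 to \<open>k\<close> count and the starting point does not,
  because \<open>mean_field_step\<close> weights after the move.\<close>

definition euler_weight ::
    "(('n :: finite) torus \<Rightarrow> real ^ 'n) \<Rightarrow> ('n torus \<Rightarrow> real) \<Rightarrow> real \<Rightarrow> 'n torus \<Rightarrow> (nat \<Rightarrow> real ^ 'n) \<Rightarrow> nat \<Rightarrow> real" where
  "euler_weight b lam \<gamma> x \<xi> k = exp (- (\<gamma> * (\<Sum>j<k. lam (euler b \<gamma> x \<xi> (Suc j)))))"

lemma euler_cong: "(\<And>j. j < k \<Longrightarrow> \<xi> j = \<xi>' j) \<Longrightarrow> euler b \<gamma> x \<xi> k = euler b \<gamma> x \<xi>' k"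
  by (induction k) auto

lemma euler_weight_cong:
  assumes "\<And>j. j < k \<Longrightarrow> \<xi> j = \<xi>' j"
  shows "euler_weight b lam \<gamma> x \<xi> k = euler_weight b lam \<gamma> x \<xi>' k"
  unfolding euler_weight_def using assms
  by (intro arg_cong[where f = "\<lambda>s. exp (- (\<gamma> * s))"] sum.cong refl arg_cong[where f = lam] euler_cong) auto

text \<open>The discrete form of the integrated equation: the noise enters only through its sum, as
  it does in the diffusion.\<close>

lemma euler_eq_shift:
  "euler b \<gamma> x \<xi> k = torus_shift x (\<gamma> *\<^sub>R (\<Sum>j<k. b (euler b \<gamma> x \<xi> j)) + (\<Sum>j<k. \<xi> j))"
proof (induction k)
  case (Suc k)
  show ?case
    unfolding euler.simps(2) by (subst Suc.IH) (simp add: torus_shift_shift scaleR_add_right add_ac)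
qed simp

lemma measurable_euler:
  assumes b [measurable]: "b \<in> borel_measurable borel" and x: "f \<in> borel_measurable M"
    and \<xi>: "\<And>j. j < n \<Longrightarrow> (\<lambda>p. g p j) \<in> borel_measurable M" and k: "k \<le> n"
  shows "(\<lambda>p. euler b \<gamma> (f p) (g p) k) \<in> borel_measurable M"
  using k
proof (induction k)
  case (Suc k)
  then have [measurable]: "(\<lambda>p. euler b \<gamma> (f p) (g p) k) \<in> borel_measurable M" "(\<lambda>p. g p k) \<in> borel_measurable M"
    using \<xi> by auto
  show ?case unfolding euler.simps(2) by measurable
qed (simp add: x)

lemma measurable_euler_weight:
  assumes "b \<in> borel_measurable borel" "lam \<in> borel_measurable borel" "f \<in> borel_measurable M"
    and "\<And>j. j < n \<Longrightarrow> (\<lambda>p. g p j) \<in> borel_measurable M" "k \<le> n"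
  shows "(\<lambda>p. euler_weight b lam \<gamma> (f p) (g p) k) \<in> borel_measurable M"
proof -
  have "(\<lambda>p. lam (euler b \<gamma> (f p) (g p) (Suc j))) \<in> borel_measurable M" if "j < k" for j
    by (rule measurable_compose[OF measurable_euler[OF assms(1,3,4)] assms(2)]) (use assms(5) that in auto)
  then have "(\<lambda>p. \<Sum>j<k. lam (euler b \<gamma> (f p) (g p) (Suc j))) \<in> borel_measurable M"
    by (intro borel_measurable_sum) auto
  then show ?thesis unfolding euler_weight_def by measurable
qed

lemma euler_weight_01:
  assumes "0 \<le> \<gamma>" "\<And>x. 0 \<le> lam x"
  shows "0 < euler_weight b lam \<gamma> x \<xi> k" "euler_weight b lam \<gamma> x \<xi> k \<le> 1"
  using assms by (auto simp: euler_weight_def intro!: mult_nonneg_nonneg sum_nonneg)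

section \<open>Gaussian increments and the Markov property of the scheme\<close>

definition gauss_step :: "real \<Rightarrow> (real ^ ('n :: finite)) measure" where
  "gauss_step \<gamma> = distr std_gauss borel (\<lambda>y. sqrt \<gamma> *\<^sub>R y)"

lemma prob_space_gauss_step: "prob_space (gauss_step \<gamma>)" "sets (gauss_step \<gamma>) = sets borel"
proof -
  interpret prob_space std_gauss by (rule prob_space_std_gauss)
  show "prob_space (gauss_step \<gamma>)" unfolding gauss_step_def by (rule prob_space_distr) measurable
qed (simp add: gauss_step_def)

lemma nn_integral_kernel_K:
  assumes [measurable]: "g \<in> borel_measurable borel"
  shows "(\<integral>\<^sup>+y. g (torus_shift x (\<gamma> *\<^sub>R b x + y)) \<partial>gauss_step \<gamma>) = (\<integral>\<^sup>+y. g y \<partial>kernel_K b \<gamma> x)"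
  unfolding gauss_step_def kernel_K_def by (simp add: nn_integral_distr)

text \<open>The last increment is integrated out; nothing else in the integrand depends on it
  except the last position.\<close>

lemma euler_markov:
  fixes b :: "('n :: finite) torus \<Rightarrow> real ^ 'n" and g :: "'n torus \<Rightarrow> real"
  assumes b: "b \<in> borel_measurable borel" and l: "lam \<in> borel_measurable borel"
    and l0: "\<And>x. 0 \<le> lam x" and \<gamma>: "0 \<le> \<gamma>" and \<eta>: "\<eta> \<in> space (prob_algebra borel)"
    and g [measurable]: "g \<in> borel_measurable borel" and g01: "\<And>x. 0 \<le> g x" "\<And>x. g x \<le> 1"
    and M: "prob_space M" and X0: "X0 \<in> borel_measurable M"
    and \<xi>: "\<And>j. (\<lambda>\<omega>. \<xi> \<omega> j) \<in> borel_measurable M"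
    and joint: "\<And>n. distr M (borel \<Otimes>\<^sub>M PiM {..<n} (\<lambda>_. borel)) (\<lambda>\<omega>. (X0 \<omega>, restrict (\<xi> \<omega>) {..<n}))
      = \<eta> \<Otimes>\<^sub>M PiM {..<n} (\<lambda>_. gauss_step \<gamma>)"
  shows "(\<integral>\<omega>. euler_weight b lam \<gamma> (X0 \<omega>) (\<xi> \<omega>) n * g (euler b \<gamma> (X0 \<omega>) (\<xi> \<omega>) (Suc n)) \<partial>M)
    = (\<integral>\<omega>. euler_weight b lam \<gamma> (X0 \<omega>) (\<xi> \<omega>) n * (\<integral>y. g y \<partial>kernel_K b \<gamma> (euler b \<gamma> (X0 \<omega>) (\<xi> \<omega>) n)) \<partial>M)"
proof -
  let ?G = "gauss_step \<gamma> :: (real ^ 'n) measure"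
  interpret M: prob_space M by (rule M)
  interpret PS: product_sigma_finite "\<lambda>_ :: nat. ?G"
    by (intro product_sigma_finite.intro prob_space_imp_sigma_finite prob_space_gauss_step)
  interpret PN: prob_space "PiM {..<m} (\<lambda>_. ?G)" for m by (intro prob_space_PiM prob_space_gauss_step)
  have s: "sets \<eta> = sets borel" using \<eta> by (simp add: space_prob_algebra)
  have sP: "sets (PiM {..<m} (\<lambda>_. ?G)) = sets (PiM {..<m} (\<lambda>_. borel))" for m
    by (intro sets_PiM_cong refl prob_space_gauss_step)
  have sJ: "sets (\<eta> \<Otimes>\<^sub>M PiM {..<m} (\<lambda>_. ?G)) = sets (borel \<Otimes>\<^sub>M PiM {..<m} (\<lambda>_. borel))" for m
    by (intro sets_pair_measure_cong s sP)
  have rest: "(\<lambda>\<omega>. restrict (\<xi> \<omega>) {..<m}) \<in> M \<rightarrow>\<^sub>M PiM {..<m} (\<lambda>_. borel)" for m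
    by (intro measurable_restrict \<xi>)
  have pair: "(\<lambda>\<omega>. (X0 \<omega>, restrict (\<xi> \<omega>) {..<m})) \<in> M \<rightarrow>\<^sub>M borel \<Otimes>\<^sub>M PiM {..<m} (\<lambda>_. borel)" for m
    by (intro measurable_Pair X0 rest)
  define k where "k z = (\<integral>y. g y \<partial>kernel_K b \<gamma> z)" for z
  note k01 = integral_kernel_K_01[OF b g g01, of \<gamma>, folded k_def]
  have ek: "ennreal (k z) = (\<integral>\<^sup>+y. ennreal (g y) \<partial>kernel_K b \<gamma> z)" for z
    unfolding k_def using prob_space_kernel_K[OF b, of \<gamma> z] g01
    by (intro integral_01(4)) (simp_all cong: measurable_cong_sets)
  let ?e = "\<lambda>x \<xi>. euler b \<gamma> x \<xi>" and ?w = "\<lambda>x \<xi>. euler_weight b lam \<gamma> x \<xi> n"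
  have comp: "(\<lambda>p. snd p j) \<in> borel_measurable (borel \<Otimes>\<^sub>M PiM {..<m} (\<lambda>_. borel))" if "j < m" for j m
    using that by (intro measurable_compose[OF measurable_snd] measurable_component_singleton) auto
  have em: "(\<lambda>p. ?e (fst p) (snd p) i) \<in> borel_measurable (borel \<Otimes>\<^sub>M PiM {..<m} (\<lambda>_. borel))" if "i \<le> m" for i m
    by (rule measurable_euler[OF b measurable_fst comp that])
  have wm: "(\<lambda>p. ?w (fst p) (snd p)) \<in> borel_measurable (borel \<Otimes>\<^sub>M PiM {..<m} (\<lambda>_. borel))" if "n \<le> m" for m
    by (rule measurable_euler_weight[OF b l measurable_fst comp that])
  have w01: "0 < ?w x \<xi>" "?w x \<xi> \<le> 1" for x \<xi> by (rule euler_weight_01[OF \<gamma> l0])+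
  \<comment> \<open>Only the first \<open>m\<close> increments occur, so the integral depends on the
    joint law of the start and these increments, which is a product.\<close>
  have transfer: "(\<integral>\<^sup>+\<omega>. ennreal (?w (X0 \<omega>) (\<xi> \<omega>) * f (?e (X0 \<omega>) (\<xi> \<omega>) m)) \<partial>M)
      = (\<integral>\<^sup>+x. \<integral>\<^sup>+\<zeta>. ennreal (?w x \<zeta> * f (?e x \<zeta> m)) \<partial>PiM {..<m} (\<lambda>_. ?G) \<partial>\<eta>)" (is "?lhs = _")
    and slice: "(\<lambda>\<zeta>. ennreal (?w x \<zeta> * f (?e x \<zeta> m))) \<in> borel_measurable (PiM {..<m} (\<lambda>_. ?G))"
    if f: "f \<in> borel_measurable borel" and m: "n \<le> m" for f :: "'n torus \<Rightarrow> real" and m x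
  proof -
    have \<phi>: "(\<lambda>p. ennreal (?w (fst p) (snd p) * f (?e (fst p) (snd p) m)))
        \<in> borel_measurable (borel \<Otimes>\<^sub>M PiM {..<m} (\<lambda>_. borel))"
      using wm[OF m] measurable_compose[OF em[of m m] f] by measurable
    from measurable_compose[OF measurable_Pair1'[of x borel] this]
    show "(\<lambda>\<zeta>. ennreal (?w x \<zeta> * f (?e x \<zeta> m))) \<in> borel_measurable (PiM {..<m} (\<lambda>_. ?G))"
      by (simp add: measurable_cong_sets[OF sP refl])
    have "?lhs = (\<integral>\<^sup>+\<omega>. ennreal (?w (X0 \<omega>) (restrict (\<xi> \<omega>) {..<m}) * f (?e (X0 \<omega>) (restrict (\<xi> \<omega>) {..<m}) m)) \<partial>M)"
      using m by (intro nn_integral_cong arg_cong[where f = ennreal] arg_cong2[where f = "(*)"]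
        arg_cong[where f = f] euler_weight_cong euler_cong) simp_all
    also have "\<dots> = (\<integral>\<^sup>+p. ennreal (?w (fst p) (snd p) * f (?e (fst p) (snd p) m)) \<partial>(\<eta> \<Otimes>\<^sub>M PiM {..<m} (\<lambda>_. ?G)))"
      unfolding joint[symmetric] by (subst nn_integral_distr[OF pair]) (use \<phi> in \<open>simp_all del: restrict_apply\<close>)
    also have "\<dots> = (\<integral>\<^sup>+x. \<integral>\<^sup>+\<zeta>. ennreal (?w x \<zeta> * f (?e x \<zeta> m)) \<partial>PiM {..<m} (\<lambda>_. ?G) \<partial>\<eta>)"
      by (subst PN.nn_integral_fst[symmetric]) (use \<phi> in \<open>simp_all add: measurable_cong_sets[OF sJ refl]\<close>)
    finally show "?lhs = (\<integral>\<^sup>+x. \<integral>\<^sup>+\<zeta>. ennreal (?w x \<zeta> * f (?e x \<zeta> m)) \<partial>PiM {..<m} (\<lambda>_. ?G) \<partial>\<eta>)" .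
  qed
  have "(\<integral>\<^sup>+\<omega>. ennreal (?w (X0 \<omega>) (\<xi> \<omega>) * g (?e (X0 \<omega>) (\<xi> \<omega>) (Suc n))) \<partial>M)
      = (\<integral>\<^sup>+x. \<integral>\<^sup>+\<zeta>. ennreal (?w x \<zeta> * g (?e x \<zeta> (Suc n))) \<partial>PiM {..<Suc n} (\<lambda>_. ?G) \<partial>\<eta>)"
    by (rule transfer[OF g]) simp
  also have "\<dots> = (\<integral>\<^sup>+x. \<integral>\<^sup>+\<zeta>. ennreal (?w x \<zeta> * k (?e x \<zeta> n)) \<partial>PiM {..<n} (\<lambda>_. ?G) \<partial>\<eta>)"
  proof (rule nn_integral_cong)
    fix x
    have "(\<integral>\<^sup>+\<zeta>. ennreal (?w x \<zeta> * g (?e x \<zeta> (Suc n))) \<partial>PiM {..<Suc n} (\<lambda>_. ?G))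
        = (\<integral>\<^sup>+\<zeta>. \<integral>\<^sup>+y. ennreal (?w x (\<zeta>(n := y)) * g (?e x (\<zeta>(n := y)) (Suc n))) \<partial>?G \<partial>PiM {..<n} (\<lambda>_. ?G))"
      using slice[OF g le_SucI[OF order_refl], of x]
      unfolding lessThan_Suc by (intro PS.product_nn_integral_insert) simp_all
    also have "\<dots> = (\<integral>\<^sup>+\<zeta>. ennreal (?w x \<zeta> * k (?e x \<zeta> n)) \<partial>PiM {..<n} (\<lambda>_. ?G))"
    proof (rule nn_integral_cong)
      fix \<zeta>
      \<comment> \<open>Counting from 0, increment \<open>n\<close> drives the step from
        \<open>n\<close> to \<open>n + 1\<close>; weight and position after \<open>n\<close> steps
        use only earlier increments.\<close>
      have w: "?w x (\<zeta>(n := y)) = ?w x \<zeta>" for y by (rule euler_weight_cong) simp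
      have e: "?e x (\<zeta>(n := y)) n = ?e x \<zeta> n" for y by (rule euler_cong) simp
      have "(\<integral>\<^sup>+y. ennreal (?w x (\<zeta>(n := y)) * g (?e x (\<zeta>(n := y)) (Suc n))) \<partial>?G)
          = (\<integral>\<^sup>+y. ennreal (?w x \<zeta>) * ennreal (g (torus_shift (?e x \<zeta> n) (\<gamma> *\<^sub>R b (?e x \<zeta> n) + y))) \<partial>?G)"
        using w01 g01 by (intro nn_integral_cong) (simp add: w e ennreal_mult less_imp_le)
      also have "\<dots> = ennreal (?w x \<zeta>) * (\<integral>\<^sup>+y. ennreal (g (torus_shift (?e x \<zeta> n) (\<gamma> *\<^sub>R b (?e x \<zeta> n) + y))) \<partial>?G)"
        by (rule nn_integral_cmult) (simp add: measurable_cong_sets[OF prob_space_gauss_step(2) refl])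
      also have "\<dots> = ennreal (?w x \<zeta>) * ennreal (k (?e x \<zeta> n))"
        unfolding ek by (subst nn_integral_kernel_K) simp_all
      finally show "(\<integral>\<^sup>+y. ennreal (?w x (\<zeta>(n := y)) * g (?e x (\<zeta>(n := y)) (Suc n))) \<partial>?G) = ennreal (?w x \<zeta> * k (?e x \<zeta> n))"
        using w01 k01 by (simp add: ennreal_mult less_imp_le)
    qed
    finally show "(\<integral>\<^sup>+\<zeta>. ennreal (?w x \<zeta> * g (?e x \<zeta> (Suc n))) \<partial>PiM {..<Suc n} (\<lambda>_. ?G))
      = (\<integral>\<^sup>+\<zeta>. ennreal (?w x \<zeta> * k (?e x \<zeta> n)) \<partial>PiM {..<n} (\<lambda>_. ?G))" .
  qed
  also have "\<dots> = (\<integral>\<^sup>+\<omega>. ennreal (?w (X0 \<omega>) (\<xi> \<omega>) * k (?e (X0 \<omega>) (\<xi> \<omega>) n)) \<partial>M)"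
    by (rule transfer[OF k01(1) order_refl, symmetric])
  finally have nn: "(\<integral>\<^sup>+\<omega>. ennreal (?w (X0 \<omega>) (\<xi> \<omega>) * g (?e (X0 \<omega>) (\<xi> \<omega>) (Suc n))) \<partial>M)
      = (\<integral>\<^sup>+\<omega>. ennreal (?w (X0 \<omega>) (\<xi> \<omega>) * k (?e (X0 \<omega>) (\<xi> \<omega>) n)) \<partial>M)" .
  have e1: "(\<lambda>\<omega>. ?e (X0 \<omega>) (\<xi> \<omega>) i) \<in> borel_measurable M" for i
    by (rule measurable_euler[OF b X0 \<xi> order_refl])
  have w1: "(\<lambda>\<omega>. ?w (X0 \<omega>) (\<xi> \<omega>)) \<in> borel_measurable M"
    by (rule measurable_euler_weight[OF b l X0 \<xi> order_refl])
  have int: "ennreal (\<integral>\<omega>. ?w (X0 \<omega>) (\<xi> \<omega>) * f (?e (X0 \<omega>) (\<xi> \<omega>) i) \<partial>M)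
      = (\<integral>\<^sup>+\<omega>. ennreal (?w (X0 \<omega>) (\<xi> \<omega>) * f (?e (X0 \<omega>) (\<xi> \<omega>) i)) \<partial>M)"
    "0 \<le> (\<integral>\<omega>. ?w (X0 \<omega>) (\<xi> \<omega>) * f (?e (X0 \<omega>) (\<xi> \<omega>) i) \<partial>M)"
    if f: "f \<in> borel_measurable borel" "\<And>x. 0 \<le> f x" "\<And>x. f x \<le> (1 :: real)" for f i
    using w01 f(2,3) borel_measurable_times[OF w1 measurable_compose[OF e1 f(1)]]
    by (intro integral_01(4)[OF M] integral_01(2)[OF M]; simp add: less_imp_le mult_le_one)+
  show ?thesis
    using nn unfolding int(1)[OF g g01, symmetric] int(1)[OF k01, symmetric]
    using int(2)[OF g g01, of "Suc n"] int(2)[OF k01, of n] by (simp add: k_def del: euler.simps)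
qed

text \<open>By the Markov property, applying \<open>kernel_K\<close> under the weighted law amounts
  to moving the scheme once more under the old weight; the extra factor of
  \<open>mean_field_step\<close> then completes the new weight.\<close>

lemma weighted_law_euler:
  fixes b :: "('n :: finite) torus \<Rightarrow> real ^ 'n"
  assumes b: "b \<in> borel_measurable borel" and l [measurable]: "lam \<in> borel_measurable borel"
    and l0: "\<And>x. 0 \<le> lam x" and lC: "\<And>x. lam x \<le> C" and \<gamma>: "0 < \<gamma>" and \<eta>: "\<eta> \<in> space (prob_algebra borel)"
    and M: "prob_space M" and X0: "X0 \<in> borel_measurable M" "distr M borel X0 = \<eta>"
    and \<xi>: "\<And>j. (\<lambda>\<omega>. \<xi> \<omega> j) \<in> borel_measurable M"
    and joint: "\<And>n. distr M (borel \<Otimes>\<^sub>M PiM {..<n} (\<lambda>_. borel)) (\<lambda>\<omega>. (X0 \<omega>, restrict (\<xi> \<omega>) {..<n}))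
      = \<eta> \<Otimes>\<^sub>M PiM {..<n} (\<lambda>_. gauss_step \<gamma>)"
  shows "weighted_law M (\<lambda>\<omega>. euler_weight b lam \<gamma> (X0 \<omega>) (\<xi> \<omega>) n) (\<lambda>\<omega>. euler b \<gamma> (X0 \<omega>) (\<xi> \<omega>) n)
    = (mean_field_step b lam \<gamma> ^^ n) \<eta>"
proof (induction n)
  case 0
  interpret prob_space M by (rule M)
  show ?case
    by (simp add: weighted_law_def euler_weight_def prob_space density_1 X0)
next
  case (Suc n)
  let ?e = "\<lambda>i \<omega>. euler b \<gamma> (X0 \<omega>) (\<xi> \<omega>) i" and ?w = "\<lambda>i \<omega>. euler_weight b lam \<gamma> (X0 \<omega>) (\<xi> \<omega>) i"
  have e: "?e i \<in> borel_measurable M" for i by (rule measurable_euler[OF b X0(1) \<xi> order_refl])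
  have w: "?w i \<in> borel_measurable M" for i by (rule measurable_euler_weight[OF b l X0(1) \<xi> order_refl])
  have w01: "0 < ?w i \<omega>" "?w i \<omega> \<le> 1" for i \<omega> by (rule euler_weight_01[OF less_imp_le[OF \<gamma>] l0])+
  have w0: "0 \<le> ?w i \<omega>" for i \<omega> using w01(1) by (rule less_imp_le)
  note iw = integral_pos_01[OF M w w01]
  note wl = weighted_law[OF iw(1) w0 iw(2) e]
  let ?\<mu> = "weighted_law M (?w n) (?e n)"
  have wS: "?w (Suc n) \<omega> = ?w n \<omega> * exp (- \<gamma> * lam (?e (Suc n) \<omega>))" for \<omega>
    unfolding euler_weight_def by (simp add: distrib_left exp_add[symmetric] exp_diff exp_minus divide_inverse del: euler.simps)
  have 01: "0 \<le> exp (- \<gamma> * lam y)" "exp (- \<gamma> * lam y) \<le> 1" for y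
    using l0[of y] \<gamma> by auto
  have step: "(\<integral>x. \<integral>y. g y \<partial>kernel_K b \<gamma> x \<partial>?\<mu>) = (\<integral>\<omega>. ?w n \<omega> * g (?e (Suc n) \<omega>) \<partial>M) / (\<integral>\<omega>. ?w n \<omega> \<partial>M)"
    if g: "g \<in> borel_measurable borel" "\<And>x. 0 \<le> g x" "\<And>x. g x \<le> 1" for g
    unfolding wl(3)[OF integral_kernel_K_01(1)[OF b g]]
      euler_markov[OF b l l0 less_imp_le[OF \<gamma>] \<eta> g M X0(1) \<xi> joint] ..
  have "weighted_law M (?w (Suc n)) (?e (Suc n)) = mean_field_step b lam \<gamma> ?\<mu>"
  proof (rule prob_algebra_borel_eqI)
    show "weighted_law M (?w (Suc n)) (?e (Suc n)) \<in> space (prob_algebra borel)" by (rule wl(1))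
    show "mean_field_step b lam \<gamma> ?\<mu> \<in> space (prob_algebra borel)"
      by (rule mean_field_step(1)[OF b l l0 lC \<gamma> wl(1)])
    fix A :: "'n torus set" assume A [measurable]: "A \<in> sets borel"
    have m: "(\<lambda>y. indicator A y * exp (- \<gamma> * lam y)) \<in> borel_measurable borel"
      "(\<lambda>y. exp (- \<gamma> * lam y)) \<in> borel_measurable borel" by measurable
    have "measure (mean_field_step b lam \<gamma> ?\<mu>) A
        = ((\<integral>\<omega>. ?w n \<omega> * (indicator A (?e (Suc n) \<omega>) * exp (- \<gamma> * lam (?e (Suc n) \<omega>))) \<partial>M) / (\<integral>\<omega>. ?w n \<omega> \<partial>M))
          / ((\<integral>\<omega>. ?w n \<omega> * exp (- \<gamma> * lam (?e (Suc n) \<omega>)) \<partial>M) / (\<integral>\<omega>. ?w n \<omega> \<partial>M))"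
      unfolding mean_field_step(2)[OF b l l0 lC \<gamma> wl(1) A]
      using 01 by (subst step[OF m(1)], simp_all only: step[OF m(2) 01] mult_nonneg_nonneg indicator_pos_le)
        (auto simp: indicator_def)
    \<comment> \<open>The old normalisation occurs above and below and cancels, so normalising at
      each step agrees with normalising once at the end.\<close>
    also have "\<dots> = (\<integral>\<omega>. indicator A (?e (Suc n) \<omega>) * ?w (Suc n) \<omega> \<partial>M) / (\<integral>\<omega>. ?w (Suc n) \<omega> \<partial>M)"
      using iw(2)[of n] unfolding wS by (simp add: mult_ac del: euler.simps)
    finally show "measure (weighted_law M (?w (Suc n)) (?e (Suc n))) A = measure (mean_field_step b lam \<gamma> ?\<mu>) A"
      unfolding wl(2)[OF A] by simp
  qed
  then show ?case unfolding Suc.IH by simp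
qed

text \<open>The increments are independent of each other as increments of \<open>B\<close>, and of
  the start because they are a function of the path of \<open>B\<close>.\<close>

lemma brownian_increments_joint:
  fixes B :: "real \<Rightarrow> 'w \<Rightarrow> real ^ ('n :: finite)" and Z0 :: "'w \<Rightarrow> 'a :: topological_space"
  assumes B: "brownian_motion M B" and ind: "indep_rv M borel Z0 (PiM {0..} (\<lambda>_. borel)) (path_of B)"
    and \<gamma>: "0 < \<gamma>"
  defines "\<xi> \<equiv> \<lambda>\<omega> j. B (real (Suc j) * \<gamma>) \<omega> - B (real j * \<gamma>) \<omega>"
  shows "distr M (borel \<Otimes>\<^sub>M PiM {..<n} (\<lambda>_. borel)) (\<lambda>\<omega>. (Z0 \<omega>, restrict (\<xi> \<omega>) {..<n}))
      = distr M borel Z0 \<Otimes>\<^sub>M PiM {..<n} (\<lambda>_. gauss_step \<gamma>)"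
    and "(\<lambda>\<omega>. \<xi> \<omega> j) \<in> borel_measurable M"
proof -
  have p: "prob_space M" and Bm: "\<And>t. t \<ge> 0 \<Longrightarrow> B t \<in> borel_measurable M"
    and Bd: "\<And>s t. 0 \<le> s \<Longrightarrow> s < t \<Longrightarrow>
      distr M borel (\<lambda>\<omega>. B t \<omega> - B s \<omega>) = distr std_gauss borel (\<lambda>y. sqrt (t - s) *\<^sub>R y)"
    and Bi: "\<And>(n :: nat) \<tau>. 0 \<le> \<tau> 0 \<Longrightarrow> strict_mono_on {..n} \<tau> \<Longrightarrow>
      prob_space.indep_vars M (\<lambda>_. borel) (\<lambda>i \<omega>. B (\<tau> (Suc i)) \<omega> - B (\<tau> i) \<omega>) {..<n}"
    using B unfolding brownian_motion_def by blast+
  interpret prob_space M by (rule p)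
  have pos: "0 \<le> real j * \<gamma>" for j using \<gamma> by simp
  have \<xi>m: "(\<lambda>\<omega>. \<xi> \<omega> j) \<in> borel_measurable M" for j
    unfolding \<xi>_def by (intro borel_measurable_diff Bm pos)
  then show "(\<lambda>\<omega>. \<xi> \<omega> j) \<in> borel_measurable M" .
  have law: "distr M borel (\<lambda>\<omega>. \<xi> \<omega> j) = gauss_step \<gamma>" for j
    unfolding \<xi>_def gauss_step_def using \<gamma> pos by (subst Bd) (auto simp: algebra_simps)
  have rest: "distr M (PiM {..<n} (\<lambda>_. borel)) (\<lambda>\<omega>. restrict (\<xi> \<omega>) {..<n}) = PiM {..<n} (\<lambda>_. gauss_step \<gamma>)"
  \<comment> \<open>The product characterisation of independence is applied to a nonempty index set;
    for \<open>n = 0\<close> both laws are the point mass at the empty function.\<close>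
  proof (cases "n = 0")
    case True
    have "distr M (PiM {} (\<lambda>_. borel)) (\<lambda>\<omega>. restrict (\<xi> \<omega>) {}) = distr M (PiM {} (\<lambda>_. borel)) (\<lambda>\<omega>. \<lambda>_. undefined)"
      by (intro distr_cong) auto
    also have "\<dots> = return (PiM {} (\<lambda>_. borel)) (\<lambda>_. undefined)"
      by (rule distr_const) (simp add: space_PiM)
    also have "\<dots> = PiM {} (\<lambda>_. gauss_step \<gamma>)"
    proof (rule measure_eqI)
      show "sets (return (PiM {} (\<lambda>_. borel)) (\<lambda>_. undefined)) = sets (PiM {} (\<lambda>_. gauss_step \<gamma> :: (real ^ 'n) measure))"
        by (simp add: sets_PiM_empty)
      fix A assume "A \<in> sets (return (PiM {} (\<lambda>_. borel :: (real ^ 'n) measure)) (\<lambda>_ :: nat. undefined))"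
      then have "A = {} \<or> A = {\<lambda>_. undefined}" by (simp add: sets_PiM_empty)
      then show "emeasure (return (PiM {} (\<lambda>_. borel)) (\<lambda>_. undefined)) A = emeasure (PiM {} (\<lambda>_. gauss_step \<gamma>)) A"
        by (auto simp: sets_PiM_empty)
    qed
    finally show ?thesis using True by simp
  next
    case False
    have "strict_mono_on {..n} (\<lambda>j. real j * \<gamma>)"
      using \<gamma> by (auto simp: strict_mono_on_def)
    from Bi[OF _ this] have "indep_vars (\<lambda>_. borel) (\<lambda>j \<omega>. \<xi> \<omega> j) {..<n}" by (simp add: \<xi>_def)
    then have "distr M (PiM {..<n} (\<lambda>_. borel)) (\<lambda>\<omega>. \<lambda>j\<in>{..<n}. \<xi> \<omega> j) = PiM {..<n} (\<lambda>j. distr M borel (\<lambda>\<omega>. \<xi> \<omega> j))"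
      using False by (subst (asm) indep_vars_iff_distr_eq_PiM') (auto simp: \<xi>m lessThan_empty_iff)
    then show ?thesis by (simp only: law)
  qed
  let ?f = "\<lambda>(x :: real \<Rightarrow> real ^ 'n). \<lambda>j\<in>{..<n}. x (real (Suc j) * \<gamma>) - x (real j * \<gamma>)"
  have f: "?f \<in> PiM {0..} (\<lambda>_. borel) \<rightarrow>\<^sub>M PiM {..<n} (\<lambda>_. borel)"
    by (intro measurable_restrict borel_measurable_diff measurable_component_singleton) (use pos in \<open>auto simp del: of_nat_Suc\<close>)
  have fp: "?f (path_of B \<omega>) = restrict (\<xi> \<omega>) {..<n}" for \<omega>
    using pos by (auto simp: path_of_def \<xi>_def restrict_def fun_eq_iff simp del: of_nat_Suc)
  from indep_rv_distr[OF p ind measurable_ident f]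
  show "distr M (borel \<Otimes>\<^sub>M PiM {..<n} (\<lambda>_. borel)) (\<lambda>\<omega>. (Z0 \<omega>, restrict (\<xi> \<omega>) {..<n}))
      = distr M borel Z0 \<Otimes>\<^sub>M PiM {..<n} (\<lambda>_. gauss_step \<gamma>)"
    unfolding fp rest by simp
qed

section \<open>Convergence of the Euler scheme\<close>

text \<open>A discrete Gronwall argument for a fixed path: the noise cancels, and the drift error
  consists of the oscillation \<open>\<delta>\<close> of \<open>b\<close> along the path and
  \<open>C\<close> times the earlier errors. All earlier positions enter, hence the strong
  induction.\<close>

lemma euler_error:
  fixes b :: "('n :: finite) torus \<Rightarrow> real ^ 'n" and z :: "real \<Rightarrow> 'n torus"
  assumes lip: "C-lipschitz_on UNIV b" and C: "C > 0" and \<gamma>: "0 \<le> \<gamma>" and z: "continuous_on {0..} z"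
    and eq: "\<And>s. 0 \<le> s \<Longrightarrow> z s = torus_shift (z 0) (integral {0..s} (\<lambda>r. b (z r)) + \<beta> s)" and \<beta>0: "\<beta> 0 = 0"
    and osc: "\<And>s s'. s \<in> {0..real N * \<gamma>} \<Longrightarrow> s' \<in> {0..real N * \<gamma>} \<Longrightarrow> \<bar>s - s'\<bar> \<le> \<gamma> \<Longrightarrow> dist (b (z s)) (b (z s')) \<le> \<delta>"
    and k: "k \<le> N"
  shows "dist (euler b \<gamma> (z 0) (\<lambda>j. \<beta> (real (Suc j) * \<gamma>) - \<beta> (real j * \<gamma>)) k) (z (real k * \<gamma>))
    \<le> \<delta> / C * ((1 + \<gamma> * C) ^ k - 1)"
  using k
proof (induction k rule: less_induct)
  case (less k)
  let ?e = "\<lambda>j. euler b \<gamma> (z 0) (\<lambda>j. \<beta> (real (Suc j) * \<gamma>) - \<beta> (real j * \<gamma>)) j"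
  let ?I = "integral {0..real k * \<gamma>} (\<lambda>r. b (z r))"
  have pos: "0 \<le> real j * \<gamma>" for j using \<gamma> by simp
  have le: "real j * \<gamma> \<le> real N * \<gamma>" if "j \<le> N" for j using that \<gamma> by (intro mult_right_mono) auto
  have e: "?e k = torus_shift (z 0) (\<gamma> *\<^sub>R (\<Sum>j<k. b (?e j)) + \<beta> (real k * \<gamma>))"
  proof -
    \<comment> \<open>The increments telescope to \<open>\<beta>\<close> at the current time, the
      same noise term as in the equation for \<open>z\<close>.\<close>
    have "(\<Sum>j<k. \<beta> (real (Suc j) * \<gamma>) - \<beta> (real j * \<gamma>)) = \<beta> (real k * \<gamma>)"
      using sum_lessThan_telescope[of "\<lambda>j. \<beta> (real j * \<gamma>)" k] \<beta>0 by simp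
    then show ?thesis by (subst euler_eq_shift) simp
  qed
  have "dist (?e k) (z (real k * \<gamma>)) \<le> norm (\<gamma> *\<^sub>R (\<Sum>j<k. b (?e j)) - ?I)"
    unfolding e eq[OF pos, of k]
    using dist_torus_shift_le[of "z 0" "\<gamma> *\<^sub>R (\<Sum>j<k. b (?e j)) + \<beta> (real k * \<gamma>)" "z 0" "?I + \<beta> (real k * \<gamma>)"]
    by (simp only: dist_self add_0 add_diff_cancel_right)
  \<comment> \<open>The inductive bound times \<open>C\<close> is
    \<open>\<delta> * ((1 + \<gamma> * C) ^ j - 1)\<close>; adding the oscillation
    \<open>\<delta>\<close> absorbs the \<open>- 1\<close>, so that a geometric sum remains.\<close>
  also have "\<dots> \<le> \<gamma> * (\<Sum>j<k. \<delta> * (1 + \<gamma> * C) ^ j)"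
  proof (rule riemann_sum_error[OF \<gamma>])
    show "continuous_on {0..real k * \<gamma>} (\<lambda>r. b (z r))"
      by (rule continuous_on_compose2[OF lipschitz_on_continuous_on[OF lip]])
        (auto intro: continuous_on_subset[OF z])
    fix j s assume j: "j < k" and s: "real j * \<gamma> \<le> s" "s \<le> real (Suc j) * \<gamma>"
    have "s \<le> real N * \<gamma>" using s(2) le[of "Suc j"] j less.prems by simp
    moreover have "0 \<le> s" using s(1) pos[of j] by simp
    moreover have "\<bar>real j * \<gamma> - s\<bar> \<le> \<gamma>" using s by (simp add: algebra_simps)
    ultimately have o: "dist (b (z (real j * \<gamma>))) (b (z s)) \<le> \<delta>"
      using pos[of j] le[of j] j less.prems by (intro osc) auto
    have "dist (b (?e j)) (b (z (real j * \<gamma>))) \<le> C * dist (?e j) (z (real j * \<gamma>))"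
      by (rule lipschitz_onD[OF lip]) simp_all
    also have "\<dots> \<le> C * (\<delta> / C * ((1 + \<gamma> * C) ^ j - 1))"
      using less.IH[OF j] less.prems j C by (intro mult_left_mono) auto
    also have "\<dots> = \<delta> * ((1 + \<gamma> * C) ^ j - 1)" using C by simp
    finally have "dist (b (?e j)) (b (z s)) \<le> \<delta> * ((1 + \<gamma> * C) ^ j - 1) + \<delta>"
      using dist_triangle[of "b (?e j)" "b (z s)" "b (z (real j * \<gamma>))"] o by linarith
    then show "norm (b (?e j) - b (z s)) \<le> \<delta> * (1 + \<gamma> * C) ^ j"
      by (simp add: dist_norm algebra_simps)
  qed
  also have "\<dots> = \<delta> / C * ((1 + \<gamma> * C) ^ k - 1)"
  proof -
    have "(\<gamma> * C) * (\<Sum>j<k. (1 + \<gamma> * C) ^ j) = (1 + \<gamma> * C) ^ k - 1"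
      using power_diff_1_eq[of "1 + \<gamma> * C" k] by simp
    then have "\<gamma> * (\<Sum>j<k. (1 + \<gamma> * C) ^ j) = ((1 + \<gamma> * C) ^ k - 1) / C"
      using C by (simp add: field_simps)
    then show ?thesis by (simp add: sum_distrib_left[symmetric] mult.left_commute[of \<gamma>])
  qed
  finally show ?case .
qed

text \<open>The closeness is uniform in \<open>k\<close> because the weight collects
  \<open>lam\<close> along the whole scheme, not only at its last position.\<close>

lemma euler_converges:
  fixes b :: "('n :: finite) torus \<Rightarrow> real ^ 'n" and z :: "real \<Rightarrow> 'n torus"
  assumes lip: "C-lipschitz_on UNIV b" and C: "C > 0" and t: "0 \<le> t" and z: "continuous_on {0..} z"
    and eq: "\<And>s. 0 \<le> s \<Longrightarrow> z s = torus_shift (z 0) (integral {0..s} (\<lambda>r. b (z r)) + \<beta> s)" and \<beta>0: "\<beta> 0 = 0"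
    and e: "e > 0"
  defines "\<gamma> \<equiv> \<lambda>n. t / real (Suc n)"
  shows "\<forall>\<^sub>F n in sequentially. \<forall>k\<le>Suc n.
    dist (euler b (\<gamma> n) (z 0) (\<lambda>j. \<beta> (real (Suc j) * \<gamma> n) - \<beta> (real j * \<gamma> n)) k) (z (real k * \<gamma> n)) \<le> e"
proof -
  \<comment> \<open>Chosen so that \<open>\<delta> / C * exp (t * C) = e\<close>, where
    \<open>exp (t * C)\<close> bounds the powers of \<open>1 + \<gamma> n * C\<close> over all
    steps.\<close>
  define \<delta> where "\<delta> = e * C / exp (t * C)"
  have \<delta>: "\<delta> > 0" using e C by (simp add: \<delta>_def)
  have "continuous_on {0..t} (\<lambda>r. b (z r))"
    by (rule continuous_on_compose2[OF lipschitz_on_continuous_on[OF lip]]) (auto intro: continuous_on_subset[OF z])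
  from eventually_small_oscillation[OF this \<delta>] show ?thesis
  proof eventually_elim
    case (elim n)
    have g: "0 \<le> \<gamma> n" "real (Suc n) * \<gamma> n = t" using t by (simp_all add: \<gamma>_def)
    show ?case
    proof (intro allI impI)
      fix k assume k: "k \<le> Suc n"
      have "dist (euler b (\<gamma> n) (z 0) (\<lambda>j. \<beta> (real (Suc j) * \<gamma> n) - \<beta> (real j * \<gamma> n)) k) (z (real k * \<gamma> n))
          \<le> \<delta> / C * ((1 + \<gamma> n * C) ^ k - 1)"
      proof (rule euler_error[OF lip C g(1) z eq \<beta>0 _ k])
        fix s s' assume "s \<in> {0..real (Suc n) * \<gamma> n}" "s' \<in> {0..real (Suc n) * \<gamma> n}" "\<bar>s - s'\<bar> \<le> \<gamma> n"
        then show "dist (b (z s)) (b (z s')) \<le> \<delta>" using elim unfolding g(2) by (simp add: \<gamma>_def)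
      qed
      also have "(1 + \<gamma> n * C) ^ k \<le> exp (t * C)"
      proof -
        have "(1 + \<gamma> n * C) ^ k \<le> (1 + \<gamma> n * C) ^ Suc n"
          using g(1) C k by (intro power_increasing) auto
        also have "\<dots> \<le> exp (\<gamma> n * C) ^ Suc n"
          using g(1) C by (intro power_mono) auto
        also have "\<dots> = exp (t * C)"
          unfolding exp_of_nat_mult[symmetric] using g(2) by (simp add: mult.assoc[symmetric])
        finally show ?thesis .
      qed
      then have "\<delta> / C * ((1 + \<gamma> n * C) ^ k - 1) \<le> \<delta> / C * exp (t * C)"
        using \<delta> C by (intro mult_left_mono) auto
      also have "\<dots> = e" using C by (simp add: \<delta>_def)
      finally show "dist (euler b (\<gamma> n) (z 0) (\<lambda>j. \<beta> (real (Suc j) * \<gamma> n) - \<beta> (real j * \<gamma> n)) k) (z (real k * \<gamma> n)) \<le> e" .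
    qed
  qed
qed

lemma euler_weight_converges:
  fixes b :: "('n :: finite) torus \<Rightarrow> real ^ 'n" and z :: "real \<Rightarrow> 'n torus"
  assumes lip: "C-lipschitz_on UNIV b" and C: "C > 0" and t: "0 \<le> t" and z: "continuous_on {0..} z"
    and eq: "\<And>s. 0 \<le> s \<Longrightarrow> z s = torus_shift (z 0) (integral {0..s} (\<lambda>r. b (z r)) + \<beta> s)" and \<beta>0: "\<beta> 0 = 0"
    and lam: "L-lipschitz_on UNIV lam"
  defines "\<gamma> \<equiv> \<lambda>n. t / real (Suc n)"
  shows "(\<lambda>n. euler_weight b lam (\<gamma> n) (z 0) (\<lambda>j. \<beta> (real (Suc j) * \<gamma> n) - \<beta> (real j * \<gamma> n)) (Suc n))
    \<longlonglongrightarrow> exp (- integral {0..t} (\<lambda>s. lam (z s)))"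
  unfolding euler_weight_def
proof (intro tendsto_exp tendsto_minus)
  let ?e = "\<lambda>n. euler b (\<gamma> n) (z 0) (\<lambda>j. \<beta> (real (Suc j) * \<gamma> n) - \<beta> (real j * \<gamma> n))"
  let ?I = "integral {0..t} (\<lambda>s. lam (z s))"
  have L: "0 \<le> L" by (rule lipschitz_on_nonneg[OF lam])
  have c: "continuous_on {0..t} (\<lambda>s. lam (z s))"
    by (rule continuous_on_compose2[OF lipschitz_on_continuous_on[OF lam]]) (auto intro: continuous_on_subset[OF z])
  show "(\<lambda>n. \<gamma> n * (\<Sum>j<Suc n. lam (?e n (Suc j)))) \<longlonglongrightarrow> ?I"
  proof (rule metric_LIMSEQ_I)
    fix e :: real assume "e > 0"
    \<comment> \<open>Each node contributes an error of at most \<open>2 * d\<close>: one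
      \<open>d\<close> for the oscillation of \<open>lam\<close> along \<open>z\<close>, one for the
      Euler error, where \<open>L * (d / (L + 1)) \<le> d\<close> also holds for
      \<open>L = 0\<close>. Over total time \<open>t\<close> this stays below
      \<open>e\<close>.\<close>
    define d where "d = e / (2 * (t + 1))"
    have d: "d > 0" "2 * (t * d) < e" using \<open>e > 0\<close> t by (simp_all add: d_def field_simps)
    have d': "d / (L + 1) > 0" using d L by simp
    have near: "\<forall>\<^sub>F n in sequentially. \<forall>k\<le>Suc n. dist (?e n k) (z (real k * \<gamma> n)) \<le> d / (L + 1)"
      unfolding \<gamma>_def by (rule euler_converges[where \<beta> = \<beta>, OF lip C t z _ \<beta>0 d']) (rule eq)
    have "\<forall>\<^sub>F n in sequentially. dist (\<gamma> n * (\<Sum>j<Suc n. lam (?e n (Suc j)))) ?I < e"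
      using eventually_small_oscillation[OF c d(1)] near
    proof eventually_elim
      case (elim n)
      have g: "0 \<le> \<gamma> n" "real (Suc n) * \<gamma> n = t" using t by (simp_all add: \<gamma>_def)
      have pos: "0 \<le> real j * \<gamma> n" for j using g(1) by simp
      have le: "real j * \<gamma> n \<le> t" if "j \<le> Suc n" for j
        using that g(1) unfolding g(2)[symmetric] by (intro mult_right_mono) auto
      have "norm (\<gamma> n *\<^sub>R (\<Sum>j<Suc n. lam (?e n (Suc j))) - integral {0..real (Suc n) * \<gamma> n} (\<lambda>s. lam (z s)))
          \<le> \<gamma> n * (\<Sum>j<Suc n. 2 * d)"
      proof (rule riemann_sum_error[OF g(1)])
        show "continuous_on {0..real (Suc n) * \<gamma> n} (\<lambda>s. lam (z s))" unfolding g(2) by (rule c)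
        fix j s assume j: "j < Suc n" and s: "real j * \<gamma> n \<le> s" "s \<le> real (Suc j) * \<gamma> n"
        \<comment> \<open>The weight is summed at right end points, so the scheme after
          \<open>j + 1\<close> steps is compared with \<open>z\<close> at the end of the
          interval.\<close>
        let ?r = "real (Suc j) * \<gamma> n"
        have "s \<le> t" "?r \<le> t" using s(2) le[of "Suc j"] j by linarith+
        moreover have "0 \<le> s" using s(1) pos[of j] by linarith
        moreover have "\<bar>?r - s\<bar> \<le> \<gamma> n" using s by (simp add: algebra_simps)
        ultimately have o: "dist (lam (z ?r)) (lam (z s)) \<le> d"
          using elim(1) pos[of "Suc j"] by (simp add: \<gamma>_def del: of_nat_Suc)
        have "dist (lam (?e n (Suc j))) (lam (z ?r)) \<le> L * dist (?e n (Suc j)) (z ?r)"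
          by (rule lipschitz_onD[OF lam]) simp_all
        also have "\<dots> \<le> L * (d / (L + 1))"
          using elim(2) j L by (intro mult_left_mono) (auto simp del: euler.simps of_nat_Suc)
        also have "\<dots> \<le> d" using d(1) L by (simp add: field_simps)
        finally have "dist (lam (?e n (Suc j))) (lam (z s)) \<le> 2 * d"
          using dist_triangle[of "lam (?e n (Suc j))" "lam (z s)" "lam (z ?r)"] o by linarith
        then show "norm (lam (?e n (Suc j)) - lam (z s)) \<le> 2 * d" by (simp only: dist_norm)
      qed
      also have "\<dots> = 2 * ((real (Suc n) * \<gamma> n) * d)" by simp
      also have "\<dots> = 2 * (t * d)" unfolding g(2) ..
      finally show ?case using d(2) unfolding g(2) by (simp add: dist_norm del: euler.simps)
    qed
    then show "\<exists>N. \<forall>n\<ge>N. dist (\<gamma> n * (\<Sum>j<Suc n. lam (?e n (Suc j)))) ?I < e"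
      by (simp only: eventually_sequentially)
  qed
qed

text \<open>The scheme is built on \<open>M\<close> itself, from \<open>Z 0\<close> and the
  increments of \<open>B\<close>. Its weighted law is then an iterate of
  \<open>mean_field_step\<close>, while its paths converge almost surely to those of
  \<open>Z\<close>.\<close>

lemma survival_law_limit:
  fixes Z :: "real \<Rightarrow> 'w \<Rightarrow> ('n :: finite) torus"
  assumes K: "killed_diffusion M b B Z E" and C1: "C1_torus b" and lip: "L-lipschitz_on UNIV lam"
    and lam0: "\<And>x. 0 \<le> lam x" and t: "0 < t" and a: "a > 0" and e: "e > 0"
    and \<eta>: "\<eta> \<in> space (prob_algebra borel)" "distr M borel (Z 0) = \<eta>"
  shows "survival_law M lam Z E t \<in> space (prob_algebra borel)"
    and "\<forall>\<^sub>F n in sequentially.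
      wasserstein (rho a) ((mean_field_step b lam (t / real (Suc n)) ^^ Suc n) \<eta>) (survival_law M lam Z E t) \<le> e \<and>
      wasserstein (rho a) (survival_law M lam Z E t) ((mean_field_step b lam (t / real (Suc n)) ^^ Suc n) \<eta>) \<le> e"
proof -
  have D: "torus_diffusion M b B Z" using K by (simp add: killed_diffusion_def)
  have BM: "brownian_motion M B" and Zm: "\<And>t. t \<ge> 0 \<Longrightarrow> Z t \<in> borel_measurable M"
    and ind: "indep_rv M borel (Z 0) (PiM {0..} (\<lambda>_. borel)) (path_of B)"
    and Zc: "\<And>\<omega>. \<omega> \<in> space M \<Longrightarrow> continuous_on {0..} (\<lambda>t. Z t \<omega>)"
    and Zeq: "AE \<omega> in M. \<forall>t\<ge>0. Z t \<omega> = torus_shift (Z 0 \<omega>) (integral {0..t} (\<lambda>s. b (Z s \<omega>)) + B t \<omega>)"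
    using D by (auto simp: torus_diffusion_def)
  have p: "prob_space M" and B0: "AE \<omega> in M. B 0 \<omega> = 0" using BM by (auto simp: brownian_motion_def)
  obtain C where C: "C > 0" "C-lipschitz_on UNIV b" using C1_torus_lipschitz[OF C1] .
  obtain C' where "\<And>x. \<bar>lam x\<bar> \<le> C'" using torus_lipschitz_bounded[OF lip] by metis
  then have lC: "lam x \<le> C'" for x by (meson abs_le_iff)
  have bm: "b \<in> borel_measurable borel" by (rule measurable_torus_lipschitz[OF C(2)])
  have lm: "lam \<in> borel_measurable borel"
    by (intro borel_measurable_continuous_onI lipschitz_on_continuous_on[OF lip])
  have t0: "0 \<le> t" using t by simp
  define \<gamma> where "\<gamma> n = t / real (Suc n)" for n
  have \<gamma>: "0 < \<gamma> n" for n using t by (simp add: \<gamma>_def)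
  define \<xi> where "\<xi> n \<omega> j = B (real (Suc j) * \<gamma> n) \<omega> - B (real j * \<gamma> n) \<omega>" for n \<omega> j
  note J = brownian_increments_joint[OF BM ind \<gamma>, folded \<xi>_def, unfolded \<eta>(2)]
  define w where "w n \<omega> = euler_weight b lam (\<gamma> n) (Z 0 \<omega>) (\<xi> n \<omega>) (Suc n)" for n \<omega>
  define X where "X n \<omega> = euler b (\<gamma> n) (Z 0 \<omega>) (\<xi> n \<omega>) (Suc n)" for n \<omega>
  define u where "u \<omega> = exp (- integral {0..t} (\<lambda>s. lam (Z s \<omega>)))" for \<omega>
  have Z0: "Z 0 \<in> borel_measurable M" by (rule Zm) simp
  have Xm: "X n \<in> borel_measurable M" for n
    unfolding X_def by (rule measurable_euler[OF bm Z0 J(2) order_refl])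
  have wm: "w n \<in> borel_measurable M" for n
    unfolding w_def by (rule measurable_euler_weight[OF bm lm Z0 J(2) order_refl])
  have w01: "0 < w n \<omega>" "w n \<omega> \<le> 1" for n \<omega>
    unfolding w_def by (rule euler_weight_01[OF less_imp_le[OF \<gamma>] lam0])+
  have um: "u \<in> borel_measurable M"
    unfolding u_def using survival_law_eq(2)[OF K lip lam0 t0] by measurable
  have I0: "0 \<le> integral {0..t} (\<lambda>s. lam (Z s \<omega>))" for \<omega>
    by (cases "(\<lambda>s. lam (Z s \<omega>)) integrable_on {0..t}")
      (auto intro: Henstock_Kurzweil_Integration.integral_nonneg lam0 simp: not_integrable_integral)
  have u01: "0 < u \<omega>" "u \<omega> \<le> 1" for \<omega> using I0 by (simp_all add: u_def)
  have S: "survival_law M lam Z E t = weighted_law M u (Z t)"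
    using survival_law_eq(1)[OF K lip lam0 t0] by (simp add: u_def[abs_def])
  show "survival_law M lam Z E t \<in> space (prob_algebra borel)"
    unfolding S by (intro weighted_law(1) integral_pos_01[OF p um u01] less_imp_le u01 Zm t0)
  have iter: "(mean_field_step b lam (\<gamma> n) ^^ Suc n) \<eta> = weighted_law M (w n) (X n)" for n
    unfolding w_def X_def
    by (rule weighted_law_euler[OF bm lm lam0 lC \<gamma> \<eta>(1) p Z0 \<eta>(2) J(2) J(1), symmetric])
  have limw: "AE \<omega> in M. (\<lambda>n. w n \<omega>) \<longlonglongrightarrow> u \<omega>"
    using Zeq B0 AE_space
  proof eventually_elim
    case (elim \<omega>)
    show ?case
      unfolding w_def u_def \<xi>_def \<gamma>_def
      by (rule euler_weight_converges[where z = "\<lambda>s. Z s \<omega>" and \<beta> = "\<lambda>s. B s \<omega>", OF C(2,1) t0 Zc[OF elim(3)] _ elim(2) lip]) (use elim(1) in blast)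
  qed
  have limX: "AE \<omega> in M. (\<lambda>n. dist (X n \<omega>) (Z t \<omega>)) \<longlonglongrightarrow> 0"
    using Zeq B0 AE_space
  proof eventually_elim
    case (elim \<omega>)
    have "\<forall>\<^sub>F n in sequentially. dist (X n \<omega>) (Z t \<omega>) \<le> r" if r: "r > 0" for r
    proof -
      have "\<forall>\<^sub>F n in sequentially. \<forall>k\<le>Suc n. dist (euler b (\<gamma> n) (Z 0 \<omega>) (\<xi> n \<omega>) k) (Z (real k * \<gamma> n) \<omega>) \<le> r"
        unfolding \<xi>_def \<gamma>_def
        by (rule euler_converges[where z = "\<lambda>s. Z s \<omega>" and \<beta> = "\<lambda>s. B s \<omega>", OF C(2,1) t0 Zc[OF elim(3)] _ elim(2) r]) (use elim(1) in blast)
      then show ?thesis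
      proof eventually_elim
        case (elim n)
        have "real (Suc n) * \<gamma> n = t" by (simp add: \<gamma>_def)
        with spec[OF elim, of "Suc n"] show ?case by (simp only: X_def order_refl simp_thms)
      qed
    qed
    note near = this
    show ?case
    proof (rule tendstoI)
      fix r :: real assume r: "r > 0"
      then have "r / 2 > 0" by simp
      from near[OF this] show "\<forall>\<^sub>F n in sequentially. dist (dist (X n \<omega>) (Z t \<omega>)) 0 < r"
        by eventually_elim (use r in simp)
    qed
  qed
  show "\<forall>\<^sub>F n in sequentially.
      wasserstein (rho a) ((mean_field_step b lam (t / real (Suc n)) ^^ Suc n) \<eta>) (survival_law M lam Z E t) \<le> e \<and>
      wasserstein (rho a) (survival_law M lam Z E t) ((mean_field_step b lam (t / real (Suc n)) ^^ Suc n) \<eta>) \<le> e"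
    unfolding S iter[unfolded \<gamma>_def]
    by (rule weighted_law_convergence[OF p a e Zm[OF t0] Xm um wm u01 w01 limw limX])
qed

text \<open>Time 0 stands apart because the step \<open>t / (n + 1)\<close> would be 0, and the
  discrete kernels are studied for positive steps. Here the weight is constantly 1.\<close>

lemma survival_law_0:
  fixes Z :: "real \<Rightarrow> 'w \<Rightarrow> ('n :: finite) torus"
  assumes K: "killed_diffusion M b B Z E" and lip: "L-lipschitz_on UNIV lam" and lam0: "\<And>x. 0 \<le> lam x"
  shows "survival_law M lam Z E 0 = distr M borel (Z 0)"
proof -
  have "prob_space M"
    using K by (simp add: killed_diffusion_def torus_diffusion_def brownian_motion_def)
  then show ?thesis
    using survival_law_eq(1)[OF K lip lam0, of 0]
    by (simp add: weighted_law_def prob_space.prob_space density_1)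
qed

theorem corollary18:
  fixes b :: "('n :: finite) torus \<Rightarrow> real ^ 'n"
    and lam :: "'n torus \<Rightarrow> real"
    and c1 c2 a \<gamma>0 L t :: real
    and \<eta> \<eta>' :: "'n torus measure"
    and M :: "'w measure" and B :: "real \<Rightarrow> 'w \<Rightarrow> real ^ 'n"
    and Z :: "real \<Rightarrow> 'w \<Rightarrow> 'n torus" and E :: "'w \<Rightarrow> real"
    and M' :: "'v measure" and B' :: "real \<Rightarrow> 'v \<Rightarrow> real ^ 'n"
    and Z' :: "real \<Rightarrow> 'v \<Rightarrow> 'n torus" and E' :: "'v \<Rightarrow> real"
  assumes drift: "C1_torus b"
    and constants_pos: "c1 > 0" "a > 0" "\<gamma>0 > 0" "c2 > 0"
    and contraction_K: "\<And>\<gamma> \<mu> \<nu>. 0 < \<gamma> \<Longrightarrow> \<gamma> \<le> \<gamma>0 \<Longrightarrow>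
      \<mu> \<in> space (prob_algebra borel) \<Longrightarrow> \<nu> \<in> space (prob_algebra borel) \<Longrightarrow>
      wasserstein (rho a) (\<mu> \<bind> kernel_K b \<gamma>) (\<nu> \<bind> kernel_K b \<gamma>)
        \<le> (1 - c1 * \<gamma>) * wasserstein (rho a) \<mu> \<nu>"
    and contraction_R: "\<And>l Ll \<gamma> N \<mu> \<nu>.
      (\<forall>x. 0 \<le> l x) \<Longrightarrow> Ll-lipschitz_on UNIV l \<Longrightarrow>
      0 < \<gamma> \<Longrightarrow> \<gamma> \<le> \<gamma>0 \<Longrightarrow> N \<ge> 1 \<Longrightarrow>
      \<mu> \<in> space (prob_algebra (torus_power N)) \<Longrightarrow>
      \<nu> \<in> space (prob_algebra (torus_power N)) \<Longrightarrow>
      wasserstein (rho_sum a N) (\<mu> \<bind> kernel_R b l N \<gamma>) (\<nu> \<bind> kernel_R b l N \<gamma>)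
        \<le> (1 - \<gamma> * kappa c1 c2 Ll l \<gamma>) * wasserstein (rho_sum a N) \<mu> \<nu>"
    and lam_nonneg: "\<forall>x. 0 \<le> lam x"
    and lam_lipschitz: "L-lipschitz_on UNIV lam"
    and initial_laws: "\<eta> \<in> space (prob_algebra borel)" "\<eta>' \<in> space (prob_algebra borel)"
    and Z: "killed_diffusion M b B Z E" "distr M borel (Z 0) = \<eta>"
    and Z': "killed_diffusion M' b B' Z' E'" "distr M' borel (Z' 0) = \<eta>'"
    and t: "t \<ge> 0"
  shows "wasserstein (rho a) (survival_law M lam Z E t) (survival_law M' lam Z' E' t)
           \<le> exp (- (c1 - c2 * L) * t) * wasserstein (rho a) \<eta> \<eta>'"
proof (cases "t = 0")
  case True
  have l0: "0 \<le> lam x" for x using lam_nonneg by simp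
  with True show ?thesis
    using survival_law_0[OF Z(1) lam_lipschitz l0] survival_law_0[OF Z'(1) lam_lipschitz l0] Z(2) Z'(2) by simp
next
  case False
  with t have t: "0 < t" by simp
  have a: "a > 0" and l0: "\<And>x. 0 \<le> lam x" using constants_pos lam_nonneg by auto
  obtain C where C: "C > 0" "C-lipschitz_on UNIV b" using C1_torus_lipschitz[OF drift] .
  obtain Cl where "\<And>x. \<bar>lam x\<bar> \<le> Cl" using torus_lipschitz_bounded[OF lam_lipschitz] by metis
  then have lC: "lam x \<le> Cl" for x by (meson abs_le_iff)
  have bm: "b \<in> borel_measurable borel" by (rule measurable_torus_lipschitz[OF C(2)])
  have lm: "lam \<in> borel_measurable borel"
    by (intro borel_measurable_continuous_onI lipschitz_on_continuous_on[OF lam_lipschitz])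
  have L: "0 \<le> L" by (rule lipschitz_on_nonneg[OF lam_lipschitz])
  define \<gamma> where "\<gamma> n = t / real (Suc n)" for n
  define \<kappa> where "\<kappa> n = kappa c1 c2 L lam (\<gamma> n)" for n
  let ?\<Phi> = "\<lambda>n. mean_field_step b lam (\<gamma> n)"
  let ?W = "wasserstein (rho a) \<eta> \<eta>'"
  have \<gamma>: "0 < \<gamma> n" for n using t by (simp add: \<gamma>_def)
  have \<gamma>lim: "\<gamma> \<longlonglongrightarrow> 0" unfolding \<gamma>_def[abs_def] by (rule LIMSEQ_Suc[OF lim_const_over_n])
  have \<kappa>lim: "\<kappa> \<longlonglongrightarrow> c1 - c2 * L"
  proof -
    have "(\<lambda>n. c1 - c2 * L * exp (\<gamma> n * (SUP x. \<bar>lam x\<bar>))) \<longlonglongrightarrow> c1 - c2 * L * exp (0 * (SUP x. \<bar>lam x\<bar>))"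
      by (intro tendsto_intros \<gamma>lim)
    then show ?thesis by (simp add: \<kappa>_def[abs_def] kappa_def)
  qed
  have \<Phi>mem: "(?\<Phi> n ^^ k) \<mu> \<in> space (prob_algebra borel)" if "\<mu> \<in> space (prob_algebra borel)" for n k \<mu>
    using that by (induction k) (auto intro: mean_field_step(1)[OF bm lm l0 lC \<gamma>])
  \<comment> \<open>The bound \<open>\<gamma>0\<close> admits the assumed contraction;
    \<open>1 / c1\<close> makes \<open>1 - \<gamma> n * \<kappa> n\<close> nonnegative, because
    \<open>\<kappa> n \<le> c1\<close>. Nonnegativity is what permits iteration and powers.\<close>
  have "0 < min \<gamma>0 (1 / c1)" using constants_pos by simp
  from order_tendstoD(2)[OF \<gamma>lim this]
  have bound: "\<forall>\<^sub>F n in sequentially.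
      wasserstein (rho a) ((?\<Phi> n ^^ Suc n) \<eta>) ((?\<Phi> n ^^ Suc n) \<eta>') \<le> exp (- \<kappa> n * t) * ?W"
  proof eventually_elim
    case (elim n)
    have "\<gamma> n * c1 \<le> 1" using elim constants_pos(1) by (simp add: field_simps)
    moreover have "\<kappa> n \<le> c1" unfolding \<kappa>_def kappa_def using constants_pos(4) L by simp
    then have "\<gamma> n * \<kappa> n \<le> \<gamma> n * c1" using \<gamma>[of n] by (intro mult_left_mono) auto
    ultimately have k0: "0 \<le> 1 - \<gamma> n * \<kappa> n" by linarith
    have step: "wasserstein (rho a) (?\<Phi> n \<mu>) (?\<Phi> n \<nu>) \<le> (1 - \<gamma> n * \<kappa> n) * wasserstein (rho a) \<mu> \<nu>"
      if "\<mu> \<in> space (prob_algebra borel)" "\<nu> \<in> space (prob_algebra borel)" for \<mu> \<nu>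
      unfolding \<kappa>_def
      by (rule mean_field_step_contraction[OF bm lm l0 lC \<gamma> a that k0[unfolded \<kappa>_def]])
        (rule contraction_R[OF lam_nonneg lam_lipschitz \<gamma>], use elim in auto)
    have W0: "0 \<le> ?W"
      by (rule wasserstein_nonneg[OF couplings_pair_measure[OF initial_laws] rho_nonneg[OF a]])
    have "wasserstein (rho a) ((?\<Phi> n ^^ k) \<eta>) ((?\<Phi> n ^^ k) \<eta>') \<le> (1 - \<gamma> n * \<kappa> n) ^ k * ?W" for k
    proof (induction k)
      case (Suc k)
      have "wasserstein (rho a) ((?\<Phi> n ^^ Suc k) \<eta>) ((?\<Phi> n ^^ Suc k) \<eta>')
          \<le> (1 - \<gamma> n * \<kappa> n) * wasserstein (rho a) ((?\<Phi> n ^^ k) \<eta>) ((?\<Phi> n ^^ k) \<eta>')"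
        using step[OF \<Phi>mem[OF initial_laws(1)] \<Phi>mem[OF initial_laws(2)]] by simp
      also have "\<dots> \<le> (1 - \<gamma> n * \<kappa> n) * ((1 - \<gamma> n * \<kappa> n) ^ k * ?W)"
        using Suc.IH k0 by (rule mult_left_mono)
      finally show ?case by (simp add: mult.assoc)
    qed simp
    then have "wasserstein (rho a) ((?\<Phi> n ^^ Suc n) \<eta>) ((?\<Phi> n ^^ Suc n) \<eta>') \<le> (1 - \<gamma> n * \<kappa> n) ^ Suc n * ?W" .
    \<comment> \<open>From \<open>1 - x \<le> exp (- x)\<close>, valid for either sign of
      \<open>\<kappa> n\<close>; the \<open>n + 1\<close> steps of length \<open>\<gamma> n\<close>
      then add up to \<open>t\<close>.\<close>
    also have "(1 - \<gamma> n * \<kappa> n) ^ Suc n \<le> exp (- (\<gamma> n * \<kappa> n)) ^ Suc n"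
      using exp_ge_add_one_self[of "- (\<gamma> n * \<kappa> n)"] k0 by (intro power_mono) auto
    also have "exp (- (\<gamma> n * \<kappa> n)) ^ Suc n = exp (- \<kappa> n * t)"
      unfolding exp_of_nat_mult[symmetric] by (simp add: \<gamma>_def)
    finally show ?case using W0 by (simp add: mult_right_mono)
  qed
  let ?S = "survival_law M lam Z E t" and ?S' = "survival_law M' lam Z' E' t"
  have R: "(\<lambda>n. exp (- \<kappa> n * t) * ?W) \<longlonglongrightarrow> exp (- (c1 - c2 * L) * t) * ?W"
    by (intro tendsto_intros \<kappa>lim)
  show ?thesis
  proof (rule field_le_epsilon)
    fix e :: real assume "e > 0"
    then have e: "e / 2 > 0" by simp
    note S = survival_law_limit[OF Z(1) drift lam_lipschitz l0 t a e initial_laws(1) Z(2), folded \<gamma>_def]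
    note S' = survival_law_limit[OF Z'(1) drift lam_lipschitz l0 t a e initial_laws(2) Z'(2), folded \<gamma>_def]
    \<comment> \<open>The left side does not depend on \<open>n\<close>. The iterates from the two
      initial laws serve as intermediate points, so the two diffusions are never coupled to each
      other.\<close>
    have "\<forall>\<^sub>F n in sequentially. wasserstein (rho a) ?S ?S' \<le> exp (- \<kappa> n * t) * ?W + e"
      using bound S(2) S'(2)
    proof eventually_elim
      case (elim n)
      let ?A = "(?\<Phi> n ^^ Suc n) \<eta>" and ?A' = "(?\<Phi> n ^^ Suc n) \<eta>'"
      note A = \<Phi>mem[OF initial_laws(1), of "Suc n" n] and A' = \<Phi>mem[OF initial_laws(2), of "Suc n" n]
      have "wasserstein (rho a) ?S ?S' \<le> wasserstein (rho a) ?S ?A + wasserstein (rho a) ?A ?S'"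
        by (rule wasserstein_triangle[OF a S(1) A S'(1)])
      also have "wasserstein (rho a) ?A ?S' \<le> wasserstein (rho a) ?A ?A' + wasserstein (rho a) ?A' ?S'"
        by (rule wasserstein_triangle[OF a A A' S'(1)])
      finally show ?case using elim by linarith
    qed
    then show "wasserstein (rho a) ?S ?S' \<le> exp (- (c1 - c2 * L) * t) * ?W + e"
      by (intro tendsto_lowerbound[OF tendsto_add[OF R tendsto_const]]) simp_all
  qed
qed

end
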